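(* Let $T>0$ and $m>\frac32+1$, and let $(u,F)$ with $u,F\in C([0,T);H^m(\mathbb{R}^3))$ be a classical solution of the ideal viscoelastic system (V). Suppose there exist functions $U:\mathbb{R}^3\to\mathbb{R}^3$ and $E:\mathbb{R}^3\to\mathbb{R}^{3\times3}$ such that (i) $U,E\in C_0^1(\mathbb{R}^3)$; (ii) there exists $q>0$ such that $\Omega,E\in L^r(\mathbb{R}^3)$ for all $r\in(0,q)$, where $\Omega=\nabla\times U$; (iii) $$\sup_{0<t<T}\frac{1}{T-t}\left\|u(\cdot,t)-\frac{1}{\sqrt{T-t}}U\!\left(\frac{\cdot}{\sqrt{T-t}}\right)\right\|_{L^1}+\sup_{0<t<T}\frac{1}{T-t}\left\|F(\cdot,t)-\frac{1}{\sqrt{T-t}}E\!\left(\frac{\cdot}{\sqrt{T-t}}\right)\right\|_{L^1}<\infty;$$ (iv) $$\lim_{t\nearrow T}(T-t)\left\|\nabla u(\cdot,t)-\frac{1}{\sqrt{T-t}}\nabla\!\left[U\!\left(\frac{\cdot}{\sqrt{T-t}}\right)\right]\right\|_{L^\infty}+\lim_{t\nearrow T}(T-t)\left\|\nabla F(\cdot,t)-\frac{1}{\sqrt{T-t}}\nabla\!\left[E\!\left(\frac{\cdot}{\sqrt{T-t}}\right)\right]\right\|_{L^\infty}=0,$$ where $\nabla[\,\cdot\,]$ denotes the gradient in $x$ of the composite function $x\mapsto U(x/\sqrt{T-t})$, respectively $x\mapsto E(x/\sqrt{T-t})$. Then $U=0$ and $E=0$. Moreover, there exists $\delta>0$ such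 that $(u,F)$ can be extended to a solution of (V) on $[0,T+\delta]\times\mathbb{R}^3$ with $u,F\in C([0,T+\delta];H^m(\mathbb{R}^3))$.
   Context: The ideal viscoelastic system (V) in $\mathbb{R}^3$ for a velocity $u=u(x,t)\in\mathbb{R}^3$, a deformation tensor $F=F(x,t)\in\mathbb{R}^{3\times3}$ with $k$-th column $F^k$, and a scalar pressure $p=p(x,t)$ is $$u_t+(u\cdot\nabla)u=-\nabla p+\sum_{k=1}^3(F^k\cdot\nabla)F^k,\qquad F^k_t+(u\cdot\nabla)F^k=(F^k\cdot\nabla)u\ (k=1,2,3),$$ $$\operatorname{div}u=\operatorname{div}F^k=0\ (k=1,2,3),\qquad u(x,0)=u_0(x),\quad F(x,0)=F_0(x).$$ $H^m(\mathbb{R}^3)$ is the $L^2$-based Sobolev space; all function spaces are of vector- or matrix-valued functions as appropriate, and norms $L^1,L^\infty$ are over $\mathbb{R}^3$. $C_0^1(\mathbb{R}^3)$ denotes the continuously differentiable functions that, together with their first derivatives, tend to zero at infinity. For $0<r<1$, $L^r(\mathbb{R}^3)$ means the measurable functions $f$ with $\int_{\mathbb{R}^3}|f|^r\,dx<\infty$. *)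

theory Defs
  imports "HOL-Analysis.Analysis" "HOL-Probability.Essential_Supremum"
begin

section \<open>Differential operators\<close>

text \<open>Matrices are of type \<^typ>\<open>real^3^3\<close> with entry \<open>A $ i $ k\<close> in row \<open>i\<close> and column \<open>k\<close>,
  so the vector \<open>F^k\<close> of the equations is the library's \<open>column k F\<close>.\<close>

definition partial_deriv :: "3 \<Rightarrow> (real^3 \<Rightarrow> 'b::real_normed_vector) \<Rightarrow> real^3 \<Rightarrow> 'b" where
  "partial_deriv j f x = frechet_derivative f (at x) (axis j 1)"

text \<open>The \<open>j\<close>-th entry of the gradient is the \<open>j\<close>-th partial derivative, for scalar, vector and
  matrix valued functions alike; its norm is the Euclidean norm of all first partial derivatives.\<close>

definition grad :: "(real^3 \<Rightarrow> 'b::real_normed_vector) \<Rightarrow> real^3 \<Rightarrow> 'b^3" where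
  "grad f x = (\<chi> j. partial_deriv j f x)"

definition divergence :: "(real^3 \<Rightarrow> real^3) \<Rightarrow> real^3 \<Rightarrow> real" where
  "divergence v x = (\<Sum>j\<in>UNIV. partial_deriv j v x $ j)"

definition curl :: "(real^3 \<Rightarrow> real^3) \<Rightarrow> real^3 \<Rightarrow> real^3" where
  "curl v x = vector
     [partial_deriv 2 v x $ 3 - partial_deriv 3 v x $ 2,
      partial_deriv 3 v x $ 1 - partial_deriv 1 v x $ 3,
      partial_deriv 1 v x $ 2 - partial_deriv 2 v x $ 1]"

text \<open>\<open>advect v f\<close> is \<open>(v \<cdot> \<nabla>) f\<close>.\<close>

definition advect :: "(real^3 \<Rightarrow> real^3) \<Rightarrow> (real^3 \<Rightarrow> 'b::real_normed_vector) \<Rightarrow> real^3 \<Rightarrow> 'b" where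
  "advect v f x = (\<Sum>j\<in>UNIV. (v x $ j) *\<^sub>R partial_deriv j f x)"

text \<open>On \<open>I \<times> UNIV\<close> with an interval \<open>I\<close> containing one of its end points, the time derivative is
  one-sided at that end point.\<close>

definition C1_on :: "'a::real_normed_vector set \<Rightarrow> ('a \<Rightarrow> 'b::real_normed_vector) \<Rightarrow> bool" where
  "C1_on S f \<longleftrightarrow> (\<exists>f'. (\<forall>z\<in>S. (f has_derivative blinfun_apply (f' z)) (at z within S)) \<and>
     continuous_on S f')"

section \<open>Function spaces\<close>

definition C1_vanishing :: "(real^3 \<Rightarrow> 'b::real_normed_vector) \<Rightarrow> bool" where
  "C1_vanishing f \<longleftrightarrow> C1_on UNIV f \<and> (f \<longlongrightarrow> 0) at_infinity \<and> (grad f \<longlongrightarrow> 0) at_infinity"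

definition Lp :: "real \<Rightarrow> (real^3 \<Rightarrow> 'b::real_normed_vector) \<Rightarrow> bool" where
  "Lp r f \<longleftrightarrow> f \<in> borel_measurable lborel \<and> (\<integral>\<^sup>+x. ennreal (norm (f x) powr r) \<partial>lborel) < \<infinity>"

definition L1_norm :: "(real^3 \<Rightarrow> 'b::real_normed_vector) \<Rightarrow> ennreal" where
  "L1_norm f = (\<integral>\<^sup>+x. ennreal (norm (f x)) \<partial>lborel)"

definition Linf_norm :: "(real^3 \<Rightarrow> 'b::real_normed_vector) \<Rightarrow> ennreal" where
  "Linf_norm f = esssup lborel (\<lambda>x. ennreal (norm (f x)))"

text \<open>The Fourier transform of a real-valued \<open>L\<^sup>2\<close> function is Plancherel's limit in the mean of the
  transforms of its truncations to balls, which are integrable.\<close>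

definition truncated_fourier :: "real \<Rightarrow> (real^3 \<Rightarrow> real) \<Rightarrow> real^3 \<Rightarrow> complex" where
  "truncated_fourier R f \<xi> = of_real ((2 * pi) powr (- 3/2)) *
     (LINT x:cball 0 R|lborel. of_real (f x) * cis (- (x \<bullet> \<xi>)))"

definition is_fourier_L2 :: "(real^3 \<Rightarrow> real) \<Rightarrow> (real^3 \<Rightarrow> complex) \<Rightarrow> bool" where
  "is_fourier_L2 f g \<longleftrightarrow> Lp 2 g \<and>
     ((\<lambda>R. \<integral>\<^sup>+\<xi>. ennreal ((norm (truncated_fourier R f \<xi> - g \<xi>))\<^sup>2) \<partial>lborel) \<longlongrightarrow> 0) at_top"

text \<open>For \<open>f\<close> in \<open>L\<^sup>2\<close> the transform exists by Plancherel's theorem and is unique up to null sets.\<close>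

definition fourier_L2 :: "(real^3 \<Rightarrow> real) \<Rightarrow> real^3 \<Rightarrow> complex" where
  "fourier_L2 f = (SOME g. is_fourier_L2 f g)"

text \<open>The Sobolev space \<open>H^s\<close> for real \<open>s \<ge> 0\<close>: those \<open>f\<close> in \<open>L\<^sup>2\<close> for which the density below is
  integrable. Vector and matrix valued functions are treated componentwise. The norm is meaningful
  only on members of the space.\<close>

definition sobolev_density :: "real \<Rightarrow> (real^3 \<Rightarrow> real) \<Rightarrow> real^3 \<Rightarrow> real" where
  "sobolev_density s f \<xi> = (1 + (norm \<xi>)\<^sup>2) powr s * (norm (fourier_L2 f \<xi>))\<^sup>2"

definition sobolev :: "real \<Rightarrow> (real^3 \<Rightarrow> 'b::euclidean_space) set" where
  "sobolev s = {f. Lp 2 f \<and>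
     (\<forall>b\<in>Basis. integrable lborel (sobolev_density s (\<lambda>x. f x \<bullet> b)))}"

definition sobolev_norm :: "real \<Rightarrow> (real^3 \<Rightarrow> 'b::euclidean_space) \<Rightarrow> real" where
  "sobolev_norm s f =
     sqrt (\<Sum>b\<in>Basis. \<integral>\<xi>. sobolev_density s (\<lambda>x. f x \<bullet> b) \<xi> \<partial>lborel)"

definition continuous_sobolev ::
  "real set \<Rightarrow> real \<Rightarrow> (real \<Rightarrow> real^3 \<Rightarrow> 'b::euclidean_space) \<Rightarrow> bool" where
  "continuous_sobolev I s f \<longleftrightarrow> (\<forall>t\<in>I. f t \<in> sobolev s) \<and>
     (\<forall>t\<in>I. ((\<lambda>\<tau>. sobolev_norm s (\<lambda>x. f \<tau> x - f t x)) \<longlongrightarrow> 0) (at t within I))"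

section \<open>The ideal viscoelastic system\<close>

text \<open>Classical solutions on the time interval \<open>I\<close>, which contains \<open>0\<close>: \<open>u\<close> and \<open>F\<close> are \<open>C\<^sup>1\<close> in
  \<open>(t, x)\<close> and the equations hold pointwise for some pressure. No further condition on the pressure
  is imposed; joint continuity of its gradient follows from the first equation.\<close>

definition viscoelastic_solution ::
  "real set \<Rightarrow> (real^3 \<Rightarrow> real^3) \<Rightarrow> (real^3 \<Rightarrow> real^3^3) \<Rightarrow>
   (real \<Rightarrow> real^3 \<Rightarrow> real^3) \<Rightarrow> (real \<Rightarrow> real^3 \<Rightarrow> real^3^3) \<Rightarrow> bool" where
  "viscoelastic_solution I u0 F0 u F \<longleftrightarrow>
     C1_on (I \<times> UNIV) (\<lambda>(t, x). u t x) \<and> C1_on (I \<times> UNIV) (\<lambda>(t, x). F t x) \<and>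
     (\<exists>p :: real \<Rightarrow> real^3 \<Rightarrow> real. \<forall>t\<in>I. p t differentiable_on UNIV \<and>
       (\<forall>x. vector_derivative (\<lambda>s. u s x) (at t within I) + advect (u t) (u t) x =
          - grad (p t) x +
          (\<Sum>k\<in>UNIV. advect (\<lambda>y. column k (F t y)) (\<lambda>y. column k (F t y)) x))) \<and>
     (\<forall>t\<in>I. \<forall>x. \<forall>k.
        vector_derivative (\<lambda>s. column k (F s x)) (at t within I) +
          advect (u t) (\<lambda>y. column k (F t y)) x =
        advect (\<lambda>y. column k (F t y)) (u t) x) \<and>
     (\<forall>t\<in>I. \<forall>x. divergence (u t) x = 0 \<and> (\<forall>k. divergence (\<lambda>y. column k (F t y)) x = 0)) \<and>
     (\<forall>x. u 0 x = u0 x \<and> F 0 x = F0 x)"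

text \<open>\<open>rescaled s f\<close> is \<open>x \<mapsto> s^(-1/2) f (x / s^(1/2))\<close>, used with \<open>s = T - t\<close>; the profile without
  the prefactor is \<open>dilated s f\<close>.\<close>

definition dilated :: "real \<Rightarrow> (real^3 \<Rightarrow> 'b) \<Rightarrow> real^3 \<Rightarrow> 'b" where
  "dilated s f x = f (x /\<^sub>R sqrt s)"

definition rescaled :: "real \<Rightarrow> (real^3 \<Rightarrow> 'b::real_vector) \<Rightarrow> real^3 \<Rightarrow> 'b" where
  "rescaled s f x = dilated s f x /\<^sub>R sqrt s"

end

theory Submission
  imports Defs "HOL-Probability.Probability" "HOL-Real_Asymp.Real_Asymp"
begin

text \<open>Blowup along the given self-similar profile is incompatible with conservation of energy.

Put \<open>w(t) = u(t) - (T - t)^(-1/2) U(\<cdot> / (T - t)^(1/2))\<close>. By hypothesis the \<open>L\<^sup>1\<close> norm of \<open>w(t)\<close> is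
of order \<open>T - t\<close> and, near \<open>T\<close>, its Lipschitz constant is of order \<open>1 / (T - t)\<close>. Interpolating
between the two bounds makes the supremum of \<open>w(t)\<close> of order \<open>(T - t)^(-1/2)\<close> and so the squared
\<open>L\<^sup>2\<close> norm of order \<open>(T - t)^(1/2)\<close>. In particular the rescaled profile, which is the difference
of \<open>u(t)\<close> and \<open>w(t)\<close>, lies in \<open>L\<^sup>2\<close>, and scaling in three dimensions gives it the
squared norm \<open>(T - t)^(1/2) \<parallel>U\<parallel>\<^sup>2\<close>. Hence \<open>u(t)\<close>, and in the same way \<open>F(t)\<close>, tends to zero in \<open>L\<^sup>2\<close> as
\<open>t\<close> tends to \<open>T\<close> (lemma \<open>self_similar_energy_decay\<close>). Since \<open>\<parallel>u\<parallel>\<^sup>2 + \<parallel>F\<parallel>\<^sup>2\<close> is conserved (theorem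
\<open>viscoelastic_energy_conserved\<close>), it is zero: the solution vanishes on \<open>[0, T)\<close> and continues
as the zero solution. With \<open>u = 0\<close> and \<open>F = 0\<close> the scale-invariant gradient condition says that the
gradients of \<open>U\<close> and \<open>E\<close> vanish, and decay at infinity makes the profiles themselves zero.

The substance is the conservation of energy for a pressure about which nothing is assumed at
infinity. Three facts carry it. First, \<open>H\<^sup>m\<close> with \<open>m > 5/2\<close> embeds into the bounded Lipschitz
functions (lemma \<open>sobolev_embedding\<close>); this rests on Fourier inversion and Plancherel's
inequality for the limit-in-the-mean transform, both obtained by testing against Gaussians. It makes the
nonlinear terms square integrable, locally uniformly in time. Second, a gradient in \<open>L\<^sup>2\<close> is orthogonal to every
solenoidal field in \<open>L\<^sup>2\<close> (lemma \<open>gradient_orthogonal_solenoidal\<close>). Third, the pressure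
gradient is in \<open>L\<^sup>2\<close>: the momentum equation integrated in time exhibits a gradient in \<open>L\<^sup>2\<close>, the
orthogonality then shows that \<open>u\<close> is Lipschitz in time with values in \<open>L\<^sup>2\<close>, and so \<open>u\<^sub>t\<close> is in
\<open>L\<^sup>2\<close> by Fatou's lemma. The remaining terms of the energy balance form the divergence of an
integrable field and integrate to zero.\<close>

section \<open>Square integrable functions\<close>

lemma integrable_translate:
  fixes f :: "'a::euclidean_space \<Rightarrow> 'b::{banach, second_countable_topology}"
  assumes "integrable lborel f"
  shows "integrable lborel (\<lambda>x. f (x + a))"
proof -
  have "integrable (distr lborel borel ((+) a)) f" by (subst lborel_distr_plus) (fact assms)
  then have "integrable lborel (\<lambda>x. f (a + x))"
    by (subst (asm) integrable_distr_eq) (use assms in auto)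
  then show ?thesis by (simp add: add.commute)
qed

lemma integral_translate:
  fixes f :: "'a::euclidean_space \<Rightarrow> 'b::{banach, second_countable_topology}"
  assumes [measurable]: "f \<in> borel_measurable borel"
  shows "(\<integral>x. f (x + a) \<partial>lborel) = (\<integral>x. f x \<partial>lborel)"
proof -
  have "(\<integral>x. f x \<partial>lborel) = (\<integral>x. f x \<partial>distr lborel borel ((+) a))"
    by (simp add: lborel_distr_plus)
  also have "\<dots> = (\<integral>x. f (a + x) \<partial>lborel)"
    by (rule integral_distr) auto
  finally show ?thesis by (simp add: add.commute)
qed

lemma nn_integral_affine:
  fixes f :: "'a::euclidean_space \<Rightarrow> ennreal"
  assumes [measurable]: "f \<in> borel_measurable borel" and c: "c \<noteq> 0"
  shows "(\<integral>\<^sup>+x. f x \<partial>lborel) = ennreal (\<bar>c\<bar>^DIM('a)) * (\<integral>\<^sup>+x. f (t + c *\<^sub>R x) \<partial>lborel)"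
  by (subst lborel_affine[OF c, of t])
     (simp add: nn_integral_density nn_integral_distr nn_integral_cmult)

lemma integrable_affine:
  fixes f :: "'a::euclidean_space \<Rightarrow> 'b::{banach, second_countable_topology}"
  assumes f: "integrable lborel f" and c: "c \<noteq> 0"
  shows "integrable lborel (\<lambda>x. f (t + c *\<^sub>R x))"
proof -
  have [measurable]: "f \<in> borel_measurable borel" using f by auto
  have "(\<integral>\<^sup>+x. ennreal (norm (f x)) \<partial>lborel) < \<infinity>"
    using f by (simp add: integrable_iff_bounded)
  then show ?thesis
    using c by (subst (asm) nn_integral_affine[where c = c and t = t])
      (auto simp: integrable_iff_bounded ennreal_mult_less_top)
qed

lemma integral_affine:
  fixes f :: "'a::euclidean_space \<Rightarrow> 'b::{banach, second_countable_topology}"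
  assumes [measurable]: "f \<in> borel_measurable borel" and c: "c \<noteq> 0"
  shows "(\<integral>x. f x \<partial>lborel) = \<bar>c\<bar>^DIM('a) *\<^sub>R (\<integral>x. f (t + c *\<^sub>R x) \<partial>lborel)"
  by (subst lborel_affine[OF c, of t])
     (simp add: integral_density integral_distr)

text \<open>Square integrability and the squared norm as Bochner integrals; for maps on \<open>\<real>\<^sup>3\<close> the predicate
  agrees with \<open>Lp 2\<close> by \<open>Lp_2_iff_L2\<close>.\<close>

definition L2 :: "('a::euclidean_space \<Rightarrow> 'b::real_normed_vector) \<Rightarrow> bool" where
  "L2 f \<longleftrightarrow> f \<in> borel_measurable borel \<and> integrable lborel (\<lambda>x. (norm (f x))\<^sup>2)"

definition L2sq :: "('a::euclidean_space \<Rightarrow> 'b::real_normed_vector) \<Rightarrow> real" where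
  "L2sq f = (\<integral>x. (norm (f x))\<^sup>2 \<partial>lborel)"

lemma L2sq_nonneg [simp]: "0 \<le> L2sq f"
  by (simp add: L2sq_def)

lemma L2_measurable: "L2 f \<Longrightarrow> f \<in> borel_measurable borel"
  and L2_integrable: "L2 f \<Longrightarrow> integrable lborel (\<lambda>x. (norm (f x))\<^sup>2)"
  by (simp_all add: L2_def)

lemma L2_nn: "L2 f \<Longrightarrow> (\<integral>\<^sup>+x. ennreal ((norm (f x))\<^sup>2) \<partial>lborel) = ennreal (L2sq f)"
  unfolding L2_def L2sq_def by (intro nn_integral_eq_integral) auto

lemma L2_iff_nn:
  fixes f :: "'a::euclidean_space \<Rightarrow> 'b::{banach, second_countable_topology}"
  shows "L2 f \<longleftrightarrow> f \<in> borel_measurable borel \<and> (\<integral>\<^sup>+x. ennreal ((norm (f x))\<^sup>2) \<partial>lborel) < \<infinity>"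
  unfolding L2_def by (auto simp: integrable_iff_bounded)

lemma Lp_2_iff_L2:
  fixes f :: "real^3 \<Rightarrow> 'b::{banach, second_countable_topology}"
  shows "Lp 2 f \<longleftrightarrow> L2 f"
proof -
  have "norm (f x) powr 2 = (norm (f x))\<^sup>2" for x
    by (cases "f x = 0") (auto simp: powr_numeral)
  then show ?thesis unfolding Lp_def L2_iff_nn by simp
qed

lemma L2_bound:
  fixes f :: "'a::euclidean_space \<Rightarrow> 'b::{banach, second_countable_topology}"
  assumes "f \<in> borel_measurable borel" "integrable lborel g" "\<And>x. (norm (f x))\<^sup>2 \<le> g x"
  shows "L2 f" "L2sq f \<le> (\<integral>x. g x \<partial>lborel)"
proof -
  have [measurable]: "f \<in> borel_measurable borel" by fact
  have i: "integrable lborel (\<lambda>x. (norm (f x))\<^sup>2)"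
    by (rule Bochner_Integration.integrable_bound[OF assms(2)])
       (use assms(3) in \<open>auto intro: order_trans[OF _ abs_ge_self]\<close>)
  then show "L2 f" unfolding L2_def by (simp add: assms(1))
  show "L2sq f \<le> (\<integral>x. g x \<partial>lborel)" unfolding L2sq_def
    by (intro integral_mono i assms)
qed

lemma L2_mono:
  fixes f :: "'a::euclidean_space \<Rightarrow> 'b::{banach, second_countable_topology}"
    and g :: "'a::euclidean_space \<Rightarrow> 'c::real_normed_vector"
  assumes "L2 g" "f \<in> borel_measurable borel" "\<And>x. norm (f x) \<le> c * norm (g x)"
  shows "L2 f" "L2sq f \<le> c\<^sup>2 * L2sq g"
proof -
  have le: "(norm (f x))\<^sup>2 \<le> c\<^sup>2 * (norm (g x))\<^sup>2" for x
    using power_mono[OF assms(3)[of x], of 2] by (simp add: power_mult_distrib)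
  have i: "integrable lborel (\<lambda>x. c\<^sup>2 * (norm (g x))\<^sup>2)" using L2_integrable[OF assms(1)] by simp
  show "L2 f" "L2sq f \<le> c\<^sup>2 * L2sq g" using L2_bound[OF assms(2) i le] by (auto simp: L2sq_def)
qed

lemma norm_add_sq_le: "(norm (a + b))\<^sup>2 \<le> 2 * (norm a)\<^sup>2 + 2 * (norm (b::'b::real_normed_vector))\<^sup>2"
proof -
  have "(norm (a + b))\<^sup>2 \<le> (norm a + norm b)\<^sup>2" by (simp add: norm_triangle_ineq power_mono)
  also have "\<dots> \<le> 2 * (norm a)\<^sup>2 + 2 * (norm b)\<^sup>2"
    using zero_le_power2[of "norm a - norm b"] by (simp add: power2_sum power2_diff)
  finally show ?thesis .
qed

lemma L2_add:
  fixes f :: "'a::euclidean_space \<Rightarrow> 'b::{banach, second_countable_topology}"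
  assumes "L2 f" "L2 g"
  shows "L2 (\<lambda>x. f x + g x)" "L2sq (\<lambda>x. f x + g x) \<le> 2 * L2sq f + 2 * L2sq g"
proof -
  have [measurable]: "f \<in> borel_measurable borel" "g \<in> borel_measurable borel"
    using assms by (auto simp: L2_def)
  have m: "(\<lambda>x. f x + g x) \<in> borel_measurable borel" by measurable
  have i: "integrable lborel (\<lambda>x. 2 * (norm (f x))\<^sup>2 + 2 * (norm (g x))\<^sup>2)"
    using assms by (auto simp: L2_def)
  show "L2 (\<lambda>x. f x + g x)" "L2sq (\<lambda>x. f x + g x) \<le> 2 * L2sq f + 2 * L2sq g"
    using L2_bound[OF m i norm_add_sq_le] assms by (auto simp: L2sq_def L2_def)
qed

lemma L2_uminus:
  fixes f :: "'a::euclidean_space \<Rightarrow> 'b::{banach, second_countable_topology}"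
  shows "L2 f \<Longrightarrow> L2 (\<lambda>x. - f x)" by (simp add: L2_def)

lemma L2sq_uminus: "L2sq (\<lambda>x. - f x) = L2sq f" by (simp add: L2sq_def)

lemma L2_diff:
  fixes f :: "'a::euclidean_space \<Rightarrow> 'b::{banach, second_countable_topology}"
  assumes "L2 f" "L2 g"
  shows "L2 (\<lambda>x. f x - g x)" "L2sq (\<lambda>x. f x - g x) \<le> 2 * L2sq f + 2 * L2sq g"
  using L2_add[OF assms(1) L2_uminus[OF assms(2)]] by (auto simp: L2sq_uminus)

lemma L2_sum:
  fixes f :: "'i \<Rightarrow> 'a::euclidean_space \<Rightarrow> 'b::{banach, second_countable_topology}"
  assumes "\<And>i. i \<in> I \<Longrightarrow> L2 (f i)"
  shows "L2 (\<lambda>x. \<Sum>i\<in>I. f i x)"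
  using assms
proof (induction I rule: infinite_finite_induct)
  case (insert i I)
  then show ?case using L2_add(1)[of "f i" "\<lambda>x. \<Sum>i\<in>I. f i x"] by simp
qed (simp_all add: L2_def)

lemma L2_bounded_mult:
  fixes f g :: "'a::euclidean_space \<Rightarrow> 'b::{banach, second_countable_topology, real_normed_algebra}"
  assumes "L2 f" "g \<in> borel_measurable borel" "\<And>x. norm (g x) \<le> c"
  shows "L2 (\<lambda>x. g x * f x)" "L2sq (\<lambda>x. g x * f x) \<le> c\<^sup>2 * L2sq f"
proof -
  have [measurable]: "f \<in> borel_measurable borel" "g \<in> borel_measurable borel"
    using assms by (auto simp: L2_def)
  have m: "(\<lambda>x. g x * f x) \<in> borel_measurable borel" by measurable
  have "norm (g x * f x) \<le> c * norm (f x)" for x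
    by (rule order_trans[OF norm_mult_ineq mult_right_mono[OF assms(3)]]) simp
  from L2_mono[OF assms(1) m this] 
  show "L2 (\<lambda>x. g x * f x)" "L2sq (\<lambda>x. g x * f x) \<le> c\<^sup>2 * L2sq f" by auto
qed

lemma L2_mult:
  fixes f g :: "'a::euclidean_space \<Rightarrow> 'b::{banach, second_countable_topology, real_normed_algebra}"
  assumes "L2 f" "L2 g"
  shows "integrable lborel (\<lambda>x. f x * g x)"
proof -
  have [measurable]: "f \<in> borel_measurable borel" "g \<in> borel_measurable borel"
    using assms by (auto simp: L2_def)
  have "integrable lborel (\<lambda>x. (norm (f x))\<^sup>2 + (norm (g x))\<^sup>2)"
    using assms by (auto simp: L2_def)
  then show ?thesis
  proof (rule Bochner_Integration.integrable_bound)
    show "AE x in lborel. norm (f x * g x) \<le> norm ((norm (f x))\<^sup>2 + (norm (g x))\<^sup>2)"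
    proof (intro AE_I2)
      fix x
      have "norm (f x * g x) \<le> norm (f x) * norm (g x)" by (rule norm_mult_ineq)
      also have "\<dots> \<le> (norm (f x))\<^sup>2 + (norm (g x))\<^sup>2"
        using zero_le_power2[of "norm (f x) - norm (g x)"] zero_le_power2[of "norm (f x) + norm (g x)"]
        unfolding power2_sum power2_diff by linarith
      finally show "norm (f x * g x) \<le> norm ((norm (f x))\<^sup>2 + (norm (g x))\<^sup>2)" by simp
    qed
  qed measurable
qed

lemma L2_Cauchy_Schwarz:
  fixes f g :: "'a::euclidean_space \<Rightarrow> 'b::{banach, second_countable_topology, real_normed_algebra}"
  assumes "L2 f" "L2 g"
  shows "(\<integral>x. norm (f x) * norm (g x) \<partial>lborel) \<le> sqrt (L2sq f) * sqrt (L2sq g)"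
    and "norm (\<integral>x. f x * g x \<partial>lborel) \<le> sqrt (L2sq f) * sqrt (L2sq g)"
proof -
  have [measurable]: "f \<in> borel_measurable borel" "g \<in> borel_measurable borel"
    using assms by (auto simp: L2_def)
  have nf: "L2 (\<lambda>x. norm (f x))" and ng: "L2 (\<lambda>x. norm (g x))" using assms by (auto simp: L2_def)
  have i: "integrable lborel (\<lambda>x. norm (f x) * norm (g x))" by (rule L2_mult[OF nf ng])
  have "ennreal ((\<integral>x. norm (f x) * norm (g x) \<partial>lborel)\<^sup>2)
      = (\<integral>\<^sup>+x. ennreal (norm (f x)) * ennreal (norm (g x)) \<partial>lborel)\<^sup>2"
    by (simp add: ennreal_mult'[symmetric] nn_integral_eq_integral[OF i] ennreal_power)
  also have "\<dots> \<le> (\<integral>\<^sup>+x. ennreal (norm (f x)) ^ 2 \<partial>lborel) * (\<integral>\<^sup>+x. ennreal (norm (g x)) ^ 2 \<partial>lborel)"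
    by (rule Cauchy_Schwarz_nn_integral) measurable
  also have "\<dots> = ennreal (L2sq f * L2sq g)"
    using L2_nn[OF assms(1)] L2_nn[OF assms(2)] by (simp add: ennreal_power ennreal_mult)
  finally have sq: "(\<integral>x. norm (f x) * norm (g x) \<partial>lborel)\<^sup>2 \<le> L2sq f * L2sq g"
    by (subst (asm) ennreal_le_iff) (auto intro: mult_nonneg_nonneg)
  from real_le_rsqrt[OF this]
  show 1: "(\<integral>x. norm (f x) * norm (g x) \<partial>lborel) \<le> sqrt (L2sq f) * sqrt (L2sq g)"
    by (simp add: real_sqrt_mult)
  have "norm (\<integral>x. f x * g x \<partial>lborel) \<le> (\<integral>x. norm (f x * g x) \<partial>lborel)" by simp
  also have "\<dots> \<le> (\<integral>x. norm (f x) * norm (g x) \<partial>lborel)"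
    by (intro integral_mono integrable_norm L2_mult assms i norm_mult_ineq)
  finally show "norm (\<integral>x. f x * g x \<partial>lborel) \<le> sqrt (L2sq f) * sqrt (L2sq g)" using 1 by simp
qed

section \<open>Gaussians and Bessel's inequality\<close>

lemma integral_prod_Basis:
  fixes f :: "'a::euclidean_space \<Rightarrow> real \<Rightarrow> 'b::{real_normed_field, banach, second_countable_topology}"
  assumes "\<And>b. b \<in> Basis \<Longrightarrow> integrable lborel (f b)"
  shows "integrable lborel (\<lambda>x::'a. \<Prod>b\<in>Basis. f b (x \<bullet> b))"
    and "integral\<^sup>L lborel (\<lambda>x::'a. \<Prod>b\<in>Basis. f b (x \<bullet> b)) = (\<Prod>b\<in>Basis. \<integral>x. f b x \<partial>lborel)"
proof -
  interpret product_sigma_finite "\<lambda>b::'a. lborel :: real measure"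
    by unfold_locales
  have m[measurable]: "\<And>b. b \<in> Basis \<Longrightarrow> f b \<in> borel_measurable borel" using assms by auto
  have T: "(\<lambda>g. \<Sum>b\<in>Basis. g b *\<^sub>R b) \<in> measurable (\<Pi>\<^sub>M b\<in>(Basis::'a set). (lborel::real measure)) (borel :: 'a measure)"
    by measurable
  have P: "(\<lambda>x::'a. \<Prod>b\<in>Basis. f b (x \<bullet> b)) \<in> borel_measurable borel" by measurable
  have eq: "(\<Prod>b\<in>Basis. f b ((\<Sum>c\<in>Basis. g c *\<^sub>R c) \<bullet> b)) = (\<Prod>b\<in>Basis. f b (g b))" for g :: "'a \<Rightarrow> real"
    by (intro prod.cong) (simp_all add: inner_sum_left inner_Basis if_distrib cong: if_cong)
  have "integrable (\<Pi>\<^sub>M b\<in>(Basis::'a set). lborel) (\<lambda>g. \<Prod>b\<in>Basis. f b (g b))"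
    by (rule product_integrable_prod) (use assms in auto)
  then show "integrable lborel (\<lambda>x::'a. \<Prod>b\<in>Basis. f b (x \<bullet> b))"
    by (subst lborel_eq) (simp add: integrable_distr_eq[OF T P] eq)
  show "integral\<^sup>L lborel (\<lambda>x::'a. \<Prod>b\<in>Basis. f b (x \<bullet> b)) = (\<Prod>b\<in>Basis. \<integral>x. f b x \<partial>lborel)"
    by (subst lborel_eq) (simp add: integral_distr[OF T P] eq product_integral_prod assms)
qed

lemma gauss_fourier_real:
  shows "integrable lborel (\<lambda>x::real. of_real (exp (- (x\<^sup>2 / 2))) * cis (t * x) :: complex)"
    and "(\<integral>x. of_real (exp (- (x\<^sup>2 / 2))) * cis (t * x) \<partial>lborel) = complex_of_real (sqrt (2 * pi) * exp (- (t\<^sup>2 / 2)))"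
proof -
  have d: "of_real (exp (- (x\<^sup>2 / 2))) * cis (t * x) =
    complex_of_real (sqrt (2 * pi)) * (std_normal_density x *\<^sub>R cis (t * x))" for x
    by (simp add: std_normal_density_def scaleR_conv_of_real)
  have [measurable]: "(\<lambda>x. cis (t * x)) \<in> borel_measurable borel"
    by (intro borel_measurable_continuous_onI continuous_intros)
  have i: "integrable lborel (\<lambda>x. std_normal_density x *\<^sub>R cis (t * x))"
    by (rule Bochner_Integration.integrable_bound[OF integrable_normal_density[of 1 0]])
       auto
  then show "integrable lborel (\<lambda>x::real. of_real (exp (- (x\<^sup>2 / 2))) * cis (t * x) :: complex)"
    unfolding d by (intro integrable_mult_right)
  have "(\<integral>x. std_normal_density x *\<^sub>R cis (t * x) \<partial>lborel) = char std_normal_distribution t"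
    unfolding char_def
    by (subst integral_density) (auto simp: cis_conv_exp intro!: borel_measurable_continuous_onI continuous_intros)
  then show "(\<integral>x. of_real (exp (- (x\<^sup>2 / 2))) * cis (t * x) \<partial>lborel) = complex_of_real (sqrt (2 * pi) * exp (- (t\<^sup>2 / 2)))"
    unfolding d integral_mult_right_zero by (simp add: char_std_normal_distribution)
qed

definition gauss :: "real \<Rightarrow> real^3 \<Rightarrow> real" where
  "gauss \<epsilon> x = exp (- (\<epsilon> * (norm x)\<^sup>2 / 2))"

lemma norm_sq_Basis: "(norm x)\<^sup>2 = (\<Sum>b\<in>Basis. (x \<bullet> b)\<^sup>2)" for x :: "'a::euclidean_space"
  unfolding power2_norm_eq_inner by (subst euclidean_inner) (simp add: power2_eq_square)

lemma cis_sum: "finite I \<Longrightarrow> cis (\<Sum>i\<in>I. f i) = (\<Prod>i\<in>I. cis (f i))"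
  by (induction I rule: finite_induct) (auto simp: cis_mult[symmetric])

lemma gauss_fourier_1:
  shows "integrable lborel (\<lambda>x. of_real (gauss 1 x) * cis (x \<bullet> z))"
    and "(\<integral>x. of_real (gauss 1 x) * cis (x \<bullet> z) \<partial>lborel) = complex_of_real ((sqrt (2 * pi))^3 * gauss 1 z)"
proof -
  have e: "gauss 1 x = (\<Prod>b\<in>Basis. exp (- ((x \<bullet> b)\<^sup>2 / 2)))" for x
    by (simp add: gauss_def norm_sq_Basis exp_sum[symmetric] sum_negf sum_divide_distrib[symmetric])
  have eq: "of_real (gauss 1 x) * cis (x \<bullet> z) =
     (\<Prod>b\<in>Basis. of_real (exp (- ((x \<bullet> b)\<^sup>2 / 2))) * cis ((z \<bullet> b) * (x \<bullet> b)))" for x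
    unfolding e by (subst euclidean_inner) (simp add: cis_sum prod.distrib mult.commute)
  show "integrable lborel (\<lambda>x. of_real (gauss 1 x) * cis (x \<bullet> z))" unfolding eq
    by (rule integral_prod_Basis(1)) (rule gauss_fourier_real)
  show "(\<integral>x. of_real (gauss 1 x) * cis (x \<bullet> z) \<partial>lborel) = complex_of_real ((sqrt (2 * pi))^3 * gauss 1 z)"
    unfolding eq
    by (subst integral_prod_Basis(2)[where f = "\<lambda>b y. of_real (exp (- (y\<^sup>2 / 2))) * cis ((z \<bullet> b) * y)"])
       (simp_all add: gauss_fourier_real prod.distrib e prod_constant)
qed

lemma borel_measurable_cis [measurable (raw)]:
  assumes "f \<in> borel_measurable M"
  shows "(\<lambda>x. cis (f x)) \<in> borel_measurable M"
  by (rule borel_measurable_continuous_on[OF _ assms]) (intro continuous_intros)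

lemma borel_measurable_cnj [measurable (raw)]:
  assumes "f \<in> borel_measurable M"
  shows "(\<lambda>x. cnj (f x)) \<in> borel_measurable M"
  by (rule borel_measurable_continuous_on[OF _ assms]) (intro continuous_intros)

lemma gauss_pos: "0 < gauss \<epsilon> x" by (simp add: gauss_def)
lemma gauss_le_1: "0 \<le> \<epsilon> \<Longrightarrow> gauss \<epsilon> x \<le> 1" by (simp add: gauss_def)
lemma gauss_measurable [measurable]: "gauss \<epsilon> \<in> borel_measurable borel"
  unfolding gauss_def by measurable
lemma gauss_minus: "gauss \<epsilon> (- x) = gauss \<epsilon> x" by (simp add: gauss_def)
lemma gauss_sq: "(gauss \<epsilon> x)\<^sup>2 = gauss (2 * \<epsilon>) x"
  by (simp add: gauss_def power2_eq_square exp_add[symmetric])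

text \<open>The Fourier transform of \<open>gauss \<epsilon>\<close>, which is \<open>(2 * pi)^3\<close> times the heat kernel at time \<open>\<epsilon> / 2\<close>: a
  kernel of mass \<open>(2 * pi)^3\<close> that concentrates at the origin as \<open>\<epsilon>\<close> tends to \<open>0\<close>.\<close>

definition heat :: "real \<Rightarrow> real^3 \<Rightarrow> real" where
  "heat \<epsilon> z = (sqrt (2 * pi / \<epsilon>))^3 * gauss (1 / \<epsilon>) z"

lemma gauss_fourier:
  assumes "\<epsilon> > 0"
  shows "integrable lborel (\<lambda>x. of_real (gauss \<epsilon> x) * cis (x \<bullet> z))"
    and "(\<integral>x. of_real (gauss \<epsilon> x) * cis (x \<bullet> z) \<partial>lborel) = complex_of_real (heat \<epsilon> z)"
proof -
  define c where "c = 1 / sqrt \<epsilon>"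
  have c: "c > 0" "c \<noteq> 0" "c\<^sup>2 = 1 / \<epsilon>" using assms by (auto simp: c_def power_divide)
  let ?f = "\<lambda>x. of_real (gauss \<epsilon> x) * cis (x \<bullet> z)"
  let ?g = "\<lambda>x. of_real (gauss 1 x) * cis (x \<bullet> (c *\<^sub>R z))"
  have [measurable]: "?f \<in> borel_measurable borel" by measurable
  have fg: "?f (0 + c *\<^sub>R x) = ?g x" for x
    using c assms by (simp add: gauss_def power_mult_distrib)
  have gf: "?g (0 + (1 / c) *\<^sub>R x) = ?f x" for x
    using c assms by (simp add: gauss_def power_mult_distrib power_divide)
  show "integrable lborel ?f"
    using integrable_affine[OF gauss_fourier_1(1)[of "c *\<^sub>R z"], of "1 / c" 0] c unfolding gf by simp
  have "(\<integral>x. ?f x \<partial>lborel) = \<bar>c\<bar> ^ 3 *\<^sub>R (\<integral>x. ?g x \<partial>lborel)"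
    using integral_affine[where c = c and t = 0 and f = ?f, OF _ c(2)] unfolding fg by simp
  also have "\<dots> = complex_of_real (\<bar>c\<bar>^3 * ((sqrt (2 * pi))^3 * gauss 1 (c *\<^sub>R z)))"
    unfolding gauss_fourier_1 by (simp add: scaleR_conv_of_real)
  also have "\<bar>c\<bar>^3 * ((sqrt (2 * pi))^3 * gauss 1 (c *\<^sub>R z)) = heat \<epsilon> z"
    using assms c by (simp add: heat_def gauss_def power_mult_distrib real_sqrt_divide power_divide c_def)
  finally show "(\<integral>x. ?f x \<partial>lborel) = complex_of_real (heat \<epsilon> z)" .
qed

lemma gauss_integral:
  assumes "\<epsilon> > 0"
  shows "integrable lborel (gauss \<epsilon>)" "(\<integral>x. gauss \<epsilon> x \<partial>lborel) = (sqrt (2 * pi / \<epsilon>))^3"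
proof -
  have "integrable lborel (\<lambda>x. complex_of_real (gauss \<epsilon> x))"
    using gauss_fourier(1)[OF assms, of 0] by simp
  from integrable_Re[OF this] show "integrable lborel (gauss \<epsilon>)" by simp
  have "(\<integral>x. complex_of_real (gauss \<epsilon> x) \<partial>lborel) = of_real (heat \<epsilon> 0)"
    using gauss_fourier(2)[OF assms, of 0] by simp
  then show "(\<integral>x. gauss \<epsilon> x \<partial>lborel) = (sqrt (2 * pi / \<epsilon>))^3"
    unfolding integral_complex_of_real of_real_eq_iff heat_def by (simp add: gauss_def[of _ 0])
qed

lemma L2_gauss: "\<epsilon> > 0 \<Longrightarrow> L2 (gauss \<epsilon>)"
  unfolding L2_def using gauss_integral(1)[of "2 * \<epsilon>"] by (simp add: gauss_sq)

lemma heat_pos: "\<epsilon> > 0 \<Longrightarrow> 0 < heat \<epsilon> x" by (simp add: heat_def gauss_pos)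
lemma heat_minus: "heat \<epsilon> (- x) = heat \<epsilon> x" by (simp add: heat_def gauss_minus)
lemma heat_diff_commute: "heat \<epsilon> (x - y) = heat \<epsilon> (y - x)"
  using heat_minus[of \<epsilon> "x - y"] by simp
lemma heat_measurable [measurable]: "heat \<epsilon> \<in> borel_measurable borel"
  unfolding heat_def by measurable

lemma heat_integral:
  assumes "\<epsilon> > 0"
  shows "integrable lborel (heat \<epsilon>)" "(\<integral>x. heat \<epsilon> x \<partial>lborel) = (2 * pi)^3"
proof -
  show "integrable lborel (heat \<epsilon>)"
    unfolding heat_def using gauss_integral(1)[of "1 / \<epsilon>"] assms by simp
  have "(\<integral>x. heat \<epsilon> x \<partial>lborel) = (sqrt (2 * pi / \<epsilon>))^3 * (sqrt (2 * pi * \<epsilon>))^3"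
    unfolding heat_def using gauss_integral(2)[of "1 / \<epsilon>"] assms by (simp del: real_sqrt_mult)
  also have "\<dots> = (sqrt (2 * pi / \<epsilon> * (2 * pi * \<epsilon>)))^3"
    unfolding real_sqrt_mult power_mult_distrib by simp
  also have "2 * pi / \<epsilon> * (2 * pi * \<epsilon>) = (2 * pi)\<^sup>2" using assms by (simp add: power2_eq_square)
  also have "sqrt ((2 * pi)\<^sup>2) = 2 * pi" by (subst real_sqrt_abs) simp
  finally show "(\<integral>x. heat \<epsilon> x \<partial>lborel) = (2 * pi)^3" .
qed

lemma heat_shift:
  assumes "\<epsilon> > 0"
  shows "integrable lborel (\<lambda>x. heat \<epsilon> (x - y))" "(\<integral>x. heat \<epsilon> (x - y) \<partial>lborel) = (2 * pi)^3"
    "(\<integral>\<^sup>+x. ennreal (heat \<epsilon> (x - y)) \<partial>lborel) = ennreal ((2 * pi)^3)"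
proof -
  show i: "integrable lborel (\<lambda>x. heat \<epsilon> (x - y))"
    using integrable_translate[OF heat_integral(1)[OF assms], of "- y"] by simp
  show e: "(\<integral>x. heat \<epsilon> (x - y) \<partial>lborel) = (2 * pi)^3"
    using integral_translate[OF heat_measurable, of \<epsilon> "- y"] heat_integral(2)[OF assms] by simp
  show "(\<integral>\<^sup>+x. ennreal (heat \<epsilon> (x - y)) \<partial>lborel) = ennreal ((2 * pi)^3)"
    using nn_integral_eq_integral[OF i] heat_pos[OF assms] by (simp add: e less_imp_le)
qed

lemma L2_heat_shift:
  assumes "\<epsilon> > 0" shows "L2 (\<lambda>x. heat \<epsilon> (x - y))"
proof -
  have "L2 (heat \<epsilon>)" unfolding heat_def
    using L2_bounded_mult(1)[OF L2_gauss[of "1 / \<epsilon>"], of "\<lambda>_. (sqrt (2 * pi / \<epsilon>))^3" "norm ((sqrt (2 * pi / \<epsilon>))^3)"] assms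
    by simp
  then show ?thesis
    using integrable_translate[OF L2_integrable, of "heat \<epsilon>" "- y"] by (simp add: L2_def)
qed

text \<open>Fubini's theorem moves the transform from one factor to the other. The sign of the phase is kept as
  a parameter because both the transform and its inverse are needed.\<close>

lemma multiplication_formula:
  fixes f \<phi> :: "real^3 \<Rightarrow> complex"
  assumes f: "integrable lborel f" and \<phi>: "integrable lborel \<phi>"
  shows "(\<integral>\<xi>. \<phi> \<xi> * (\<integral>x. f x * cis (\<sigma> * (x \<bullet> \<xi>)) \<partial>lborel) \<partial>lborel)
       = (\<integral>x. f x * (\<integral>\<xi>. \<phi> \<xi> * cis (\<sigma> * (x \<bullet> \<xi>)) \<partial>lborel) \<partial>lborel)"
proof -
  have [measurable]: "f \<in> borel_measurable borel" "\<phi> \<in> borel_measurable borel"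
    using assms by auto
  let ?h = "\<lambda>\<xi> x. \<phi> \<xi> * (f x * cis (\<sigma> * (x \<bullet> \<xi>)))"
  have fi: "integrable lborel (\<lambda>x. f x * cis (\<sigma> * (x \<bullet> \<xi>)))" for \<xi>
    by (rule Bochner_Integration.integrable_bound[OF f]) (auto simp: norm_mult)
  have "integrable (lborel \<Otimes>\<^sub>M lborel) (\<lambda>(\<xi>, x). ?h \<xi> x)"
  proof (rule lborel_pair.Fubini_integrable)
    show "(\<lambda>(\<xi>, x). ?h \<xi> x) \<in> borel_measurable (lborel \<Otimes>\<^sub>M lborel)" by measurable
    show "integrable lborel (\<lambda>\<xi>. \<integral>x. norm (case (\<xi>, x) of (\<xi>, x) \<Rightarrow> ?h \<xi> x) \<partial>lborel)"
      using integrable_norm[OF \<phi>] by (simp add: norm_mult)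
    show "AE \<xi> in lborel. integrable lborel (\<lambda>x. case (\<xi>, x) of (\<xi>, x) \<Rightarrow> ?h \<xi> x)"
      using fi by auto
  qed
  from lborel_pair.Fubini_integral[OF this]
  have "(\<integral>x. (\<integral>\<xi>. ?h \<xi> x \<partial>lborel) \<partial>lborel) = (\<integral>\<xi>. (\<integral>x. ?h \<xi> x \<partial>lborel) \<partial>lborel)" .
  moreover have "(\<integral>\<xi>. ?h \<xi> x \<partial>lborel) = f x * (\<integral>\<xi>. \<phi> \<xi> * cis (\<sigma> * (x \<bullet> \<xi>)) \<partial>lborel)" for x
    by (subst integral_mult_right_zero[symmetric]) (simp add: mult.left_commute)
  ultimately show ?thesis by (simp only: integral_mult_right_zero)
qed

definition fourier_const :: real where "fourier_const = (2 * pi) powr (- 3/2)"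

lemma fourier_const_pos: "fourier_const > 0" by (simp add: fourier_const_def)

lemma fourier_const_sq: "fourier_const\<^sup>2 * (2 * pi)^3 = 1"
proof -
  have "fourier_const\<^sup>2 = (2 * pi) powr (- 3)"
    by (simp add: fourier_const_def power2_eq_square powr_add[symmetric])
  also have "\<dots> = inverse ((2 * pi) powr 3)" by (rule powr_minus)
  also have "(2 * pi) powr 3 = (2 * pi) ^ 3" using powr_realpow[of "2 * pi" 3] by simp
  finally show ?thesis by (simp add: field_simps)
qed

definition fourier :: "(real^3 \<Rightarrow> real) \<Rightarrow> real^3 \<Rightarrow> complex" where
  "fourier h \<xi> = of_real fourier_const * (\<integral>x. of_real (h x) * cis (- (x \<bullet> \<xi>)) \<partial>lborel)"

lemma fourier_measurable [measurable]:
  assumes [measurable]: "h \<in> borel_measurable borel"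
  shows "fourier h \<in> borel_measurable borel"
  unfolding fourier_def by measurable

lemma fourier_integrand:
  assumes "integrable lborel h"
  shows "integrable lborel (\<lambda>x. complex_of_real (h x) * cis (- (x \<bullet> \<xi>)))"
proof -
  have [measurable]: "h \<in> borel_measurable borel" using assms by auto
  show ?thesis
  by (rule Bochner_Integration.integrable_bound[OF assms]) (auto simp: norm_mult)
qed

lemma norm_fourier_le:
  assumes "integrable lborel h"
  shows "norm (fourier h \<xi>) \<le> fourier_const * (\<integral>x. \<bar>h x\<bar> \<partial>lborel)"
proof -
  have "norm (\<integral>x. complex_of_real (h x) * cis (- (x \<bullet> \<xi>)) \<partial>lborel)
      \<le> (\<integral>x. norm (complex_of_real (h x) * cis (- (x \<bullet> \<xi>))) \<partial>lborel)" by simp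
  then show ?thesis using fourier_const_pos by (simp add: fourier_def norm_mult)
qed

lemma fourier_diff:
  assumes "integrable lborel h" "integrable lborel k"
  shows "fourier (\<lambda>x. h x - k x) \<xi> = fourier h \<xi> - fourier k \<xi>"
  unfolding fourier_def
  by (simp add: left_diff_distrib fourier_integrand assms Bochner_Integration.integral_diff right_diff_distrib)

lemma cnj_fourier: "cnj (fourier h \<xi>) = of_real fourier_const * (\<integral>x. of_real (h x) * cis (x \<bullet> \<xi>) \<partial>lborel)"
proof -
  have "cnj (\<integral>x. complex_of_real (h x) * cis (- (x \<bullet> \<xi>)) \<partial>lborel)
      = (\<integral>x. cnj (complex_of_real (h x) * cis (- (x \<bullet> \<xi>))) \<partial>lborel)"
    by (rule Bochner_Integration.integral_cnj[symmetric])
  then show ?thesis unfolding fourier_def by (simp add: cis_cnj)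
qed

text \<open>Testing against a Gaussian turns the square of the transform into a convolution of \<open>h\<close> with the heat
  kernel, paired with \<open>h\<close>; the inequality \<open>2 a b \<le> a\<^sup>2 + b\<^sup>2\<close> and the mass of the kernel bound it.\<close>

lemma bessel_gauss:
  assumes h: "integrable lborel h" "L2 h" and e: "\<epsilon> > 0"
  shows "(\<integral>\<xi>. gauss \<epsilon> \<xi> * (norm (fourier h \<xi>))\<^sup>2 \<partial>lborel) \<le> L2sq h"
proof -
  have [measurable]: "h \<in> borel_measurable borel" using h by auto
  let ?hc = "\<lambda>x. complex_of_real (h x)"
  let ?H = "\<lambda>x. \<integral>y. h y * heat \<epsilon> (y - x) \<partial>lborel"
  have hc: "integrable lborel ?hc" using h(1) by simp
  have gi: "integrable lborel (\<lambda>\<xi>. of_real (gauss \<epsilon> \<xi>) * cnj (fourier h \<xi>))"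
    by (rule Bochner_Integration.integrable_bound[where f = "\<lambda>\<xi>. (fourier_const * (\<integral>x. \<bar>h x\<bar> \<partial>lborel)) * gauss \<epsilon> \<xi>"])
       (use gauss_integral[OF e] norm_fourier_le[OF h(1)] fourier_const_pos gauss_pos[of \<epsilon>] in
         \<open>auto simp: norm_mult abs_mult mult.commute less_imp_le intro!: mult_mono\<close>)
  have inner: "(\<integral>\<xi>. of_real (gauss \<epsilon> \<xi>) * cnj (fourier h \<xi>) * cis (- 1 * (x \<bullet> \<xi>)) \<partial>lborel) = of_real (fourier_const * ?H x)" for x
  proof -
    have p: "integrable lborel (\<lambda>\<xi>. of_real (gauss \<epsilon> \<xi>) * cis (- (x \<bullet> \<xi>)))"
      using gauss_fourier(1)[OF e, of "- x"] by (simp add: inner_commute)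
    have "(\<integral>\<xi>. of_real (gauss \<epsilon> \<xi>) * cnj (fourier h \<xi>) * cis (- 1 * (x \<bullet> \<xi>)) \<partial>lborel)
        = of_real fourier_const * (\<integral>\<xi>. of_real (gauss \<epsilon> \<xi>) * cis (- (x \<bullet> \<xi>)) * (\<integral>y. ?hc y * cis (1 * (y \<bullet> \<xi>)) \<partial>lborel) \<partial>lborel)"
      unfolding cnj_fourier by (subst integral_mult_right_zero[symmetric]) (simp add: ac_simps)
    also have "\<dots> = of_real fourier_const * (\<integral>y. ?hc y * (\<integral>\<xi>. of_real (gauss \<epsilon> \<xi>) * cis (- (x \<bullet> \<xi>)) * cis (1 * (y \<bullet> \<xi>)) \<partial>lborel) \<partial>lborel)"
      by (subst multiplication_formula[OF hc p]) simp
    also have "(\<lambda>y. \<integral>\<xi>. of_real (gauss \<epsilon> \<xi>) * cis (- (x \<bullet> \<xi>)) * cis (1 * (y \<bullet> \<xi>)) \<partial>lborel) = (\<lambda>y. of_real (heat \<epsilon> (y - x)))"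
    proof
      fix y
      have "cis (- (x \<bullet> \<xi>)) * cis (1 * (y \<bullet> \<xi>)) = cis (\<xi> \<bullet> (y - x))" for \<xi>
        by (simp add: cis_mult inner_diff_right inner_commute)
      then show "(\<integral>\<xi>. of_real (gauss \<epsilon> \<xi>) * cis (- (x \<bullet> \<xi>)) * cis (1 * (y \<bullet> \<xi>)) \<partial>lborel) = of_real (heat \<epsilon> (y - x))"
        by (simp add: mult.assoc gauss_fourier[OF e])
    qed
    finally show ?thesis by (simp flip: of_real_mult)
  qed
  have "complex_of_real (\<integral>\<xi>. gauss \<epsilon> \<xi> * (norm (fourier h \<xi>))\<^sup>2 \<partial>lborel)
      = (\<integral>\<xi>. of_real (gauss \<epsilon> \<xi>) * cnj (fourier h \<xi>) * fourier h \<xi> \<partial>lborel)"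
    unfolding integral_complex_of_real[symmetric]
    by (intro Bochner_Integration.integral_cong refl)
       (simp add: complex_norm_square[symmetric] mult.commute mult.assoc del: of_real_power)
  also have "\<dots> = of_real fourier_const * (\<integral>\<xi>. of_real (gauss \<epsilon> \<xi>) * cnj (fourier h \<xi>) * (\<integral>x. ?hc x * cis (- 1 * (x \<bullet> \<xi>)) \<partial>lborel) \<partial>lborel)"
    by (subst (2) fourier_def) (subst integral_mult_right_zero[symmetric], simp add: ac_simps)
  also have "\<dots> = of_real fourier_const * (\<integral>x. ?hc x * of_real (fourier_const * ?H x) \<partial>lborel)"
    by (subst multiplication_formula[OF hc gi]) (simp only: inner)
  also have "\<dots> = of_real (fourier_const\<^sup>2 * (\<integral>x. h x * ?H x \<partial>lborel))"
    by (simp add: power2_eq_square mult.left_commute flip: of_real_mult)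
  finally have eq: "(\<integral>\<xi>. gauss \<epsilon> \<xi> * (norm (fourier h \<xi>))\<^sup>2 \<partial>lborel) = fourier_const\<^sup>2 * (\<integral>x. h x * ?H x \<partial>lborel)"
    unfolding of_real_eq_iff .
  have hi: "integrable lborel (\<lambda>y. h y * heat \<epsilon> (y - x))" for x
    by (rule L2_mult[OF h(2) L2_heat_shift[OF e]])
  have heat_m1: "(\<lambda>y. ennreal (heat \<epsilon> (y - x))) \<in> borel_measurable lborel"
    "(\<lambda>y. ennreal (heat \<epsilon> (x - y))) \<in> borel_measurable lborel" for x by measurable
  have nn_heat: "(\<integral>\<^sup>+y. ennreal (heat \<epsilon> (y - x)) \<partial>lborel) = ennreal ((2 * pi)^3)"
    "(\<integral>\<^sup>+y. ennreal (heat \<epsilon> (x - y)) \<partial>lborel) = ennreal ((2 * pi)^3)" for x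
    using heat_shift(3)[OF e] by (simp_all add: heat_diff_commute[of \<epsilon> x])
  have nn1: "(\<integral>\<^sup>+y. ennreal (a\<^sup>2 / 2 * heat \<epsilon> (y - x)) \<partial>lborel) = ennreal (a\<^sup>2 / 2 * (2 * pi)^3)" for a x
    by (simp only: ennreal_mult' zero_le_power2 divide_nonneg_nonneg zero_le_numeral nn_integral_cmult
        nn_heat heat_m1)
  have nn2: "(\<integral>\<^sup>+x. ennreal (a\<^sup>2 / 2 * heat \<epsilon> (y - x)) \<partial>lborel) = ennreal (a\<^sup>2 / 2 * (2 * pi)^3)" for a y
    by (simp only: ennreal_mult' zero_le_power2 divide_nonneg_nonneg zero_le_numeral nn_integral_cmult
        nn_heat heat_m1)
  have nn3: "(\<integral>\<^sup>+x. ennreal ((h x)\<^sup>2 / 2 * (2 * pi)^3) \<partial>lborel) = ennreal (L2sq h / 2 * (2 * pi)^3)"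
    using h(2) by (subst nn_integral_eq_integral) (auto simp: L2_def L2sq_def)
  have [simp]: "0 \<le> heat \<epsilon> x" for x using heat_pos[OF e, of x] by simp
  have "ennreal (\<integral>x. h x * ?H x \<partial>lborel) \<le> (\<integral>\<^sup>+x. ennreal (norm (h x * ?H x)) \<partial>lborel)"
  proof (cases "integrable lborel (\<lambda>x. h x * ?H x)")
    case True
    then show ?thesis
      by (intro order_trans[OF _ integral_norm_bound_ennreal[OF True]]) (simp add: ennreal_leI)
  qed (simp add: not_integrable_integral_eq)
  also have "\<dots> \<le> (\<integral>\<^sup>+x. (\<integral>\<^sup>+y. ennreal (((h x)\<^sup>2 / 2) * heat \<epsilon> (y - x)) + ennreal (((h y)\<^sup>2 / 2) * heat \<epsilon> (y - x)) \<partial>lborel) \<partial>lborel)"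
  proof (rule nn_integral_mono)
    fix x
    have "ennreal (norm (h x * ?H x)) = ennreal \<bar>h x\<bar> * ennreal (norm (?H x))"
      by (simp add: abs_mult ennreal_mult)
    also have "\<dots> \<le> ennreal \<bar>h x\<bar> * (\<integral>\<^sup>+y. ennreal (norm (h y * heat \<epsilon> (y - x))) \<partial>lborel)"
      by (intro mult_left_mono integral_norm_bound_ennreal hi) simp
    also have "\<dots> = (\<integral>\<^sup>+y. ennreal (\<bar>h x\<bar> * \<bar>h y\<bar> * heat \<epsilon> (y - x)) \<partial>lborel)"
      by (subst nn_integral_cmult[symmetric]) (auto simp: ennreal_mult abs_mult mult.assoc)
    also have "\<dots> \<le> (\<integral>\<^sup>+y. ennreal (((h x)\<^sup>2 / 2) * heat \<epsilon> (y - x)) + ennreal (((h y)\<^sup>2 / 2) * heat \<epsilon> (y - x)) \<partial>lborel)"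
    proof (rule nn_integral_mono)
      fix y
      have "\<bar>h x\<bar> * \<bar>h y\<bar> \<le> (h x)\<^sup>2 / 2 + (h y)\<^sup>2 / 2"
        using zero_le_power2[of "\<bar>h x\<bar> - \<bar>h y\<bar>"] unfolding power2_diff by simp
      from mult_right_mono[OF this, of "heat \<epsilon> (y - x)"]
      show "ennreal (\<bar>h x\<bar> * \<bar>h y\<bar> * heat \<epsilon> (y - x)) \<le> ennreal (((h x)\<^sup>2 / 2) * heat \<epsilon> (y - x)) + ennreal (((h y)\<^sup>2 / 2) * heat \<epsilon> (y - x))"
        by (simp add: ennreal_plus[symmetric] distrib_right ennreal_leI del: ennreal_plus)
    qed
    finally show "ennreal (norm (h x * ?H x)) \<le> (\<integral>\<^sup>+y. ennreal (((h x)\<^sup>2 / 2) * heat \<epsilon> (y - x)) + ennreal (((h y)\<^sup>2 / 2) * heat \<epsilon> (y - x)) \<partial>lborel)" .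
  qed
  also have "\<dots> = (\<integral>\<^sup>+x. (\<integral>\<^sup>+y. ennreal (((h x)\<^sup>2 / 2) * heat \<epsilon> (y - x)) \<partial>lborel) \<partial>lborel)
      + (\<integral>\<^sup>+x. (\<integral>\<^sup>+y. ennreal (((h y)\<^sup>2 / 2) * heat \<epsilon> (y - x)) \<partial>lborel) \<partial>lborel)"
    by (simp add: nn_integral_add)
  also have "(\<integral>\<^sup>+x. (\<integral>\<^sup>+y. ennreal (((h y)\<^sup>2 / 2) * heat \<epsilon> (y - x)) \<partial>lborel) \<partial>lborel)
     = (\<integral>\<^sup>+y. (\<integral>\<^sup>+x. ennreal (((h y)\<^sup>2 / 2) * heat \<epsilon> (y - x)) \<partial>lborel) \<partial>lborel)"
    by (rule lborel_pair.Fubini') measurable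
  also have "(\<integral>\<^sup>+x. (\<integral>\<^sup>+y. ennreal (((h x)\<^sup>2 / 2) * heat \<epsilon> (y - x)) \<partial>lborel) \<partial>lborel)
     = ennreal (L2sq h / 2 * (2 * pi)^3)"
    by (simp only: nn1 nn3)
  also have "(\<integral>\<^sup>+y. (\<integral>\<^sup>+x. ennreal (((h y)\<^sup>2 / 2) * heat \<epsilon> (y - x)) \<partial>lborel) \<partial>lborel)
     = ennreal (L2sq h / 2 * (2 * pi)^3)"
    by (simp only: nn2 nn3)
  finally have "ennreal (\<integral>x. h x * ?H x \<partial>lborel) \<le> ennreal (L2sq h * (2 * pi)^3)"
    by (simp flip: ennreal_mult ennreal_plus)
  then have le: "(\<integral>x. h x * ?H x \<partial>lborel) \<le> L2sq h * (2 * pi)^3"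
    by (subst (asm) ennreal_le_iff) simp_all
  have "fourier_const\<^sup>2 * (\<integral>x. h x * ?H x \<partial>lborel) \<le> fourier_const\<^sup>2 * (L2sq h * (2 * pi)^3)"
    by (rule mult_left_mono[OF le]) simp
  also have "\<dots> = L2sq h" using fourier_const_sq by (simp add: mult.left_commute)
  finally show ?thesis unfolding eq .
qed

text \<open>As \<open>\<epsilon>\<close> tends to \<open>0\<close> the Gaussian weight tends to \<open>1\<close>, and Fatou's lemma removes it.\<close>

lemma bessel:
  assumes h: "integrable lborel h" "L2 h"
  shows "L2 (fourier h)" "L2sq (fourier h) \<le> L2sq h"
proof -
  have [measurable]: "h \<in> borel_measurable borel" using h by auto
  let ?e = "\<lambda>n. 1 / real (Suc n)"
  let ?u = "\<lambda>n \<xi>. ennreal (gauss (?e n) \<xi> * (norm (fourier h \<xi>))\<^sup>2)"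
  have le: "(\<integral>\<^sup>+\<xi>. ?u n \<xi> \<partial>lborel) \<le> ennreal (L2sq h)" for n
  proof -
    have i: "integrable lborel (\<lambda>\<xi>. gauss (?e n) \<xi> * (norm (fourier h \<xi>))\<^sup>2)"
      by (rule Bochner_Integration.integrable_bound[where f = "\<lambda>\<xi>. (fourier_const * (\<integral>x. \<bar>h x\<bar> \<partial>lborel))\<^sup>2 * gauss (?e n) \<xi>"])
         (use gauss_integral[of "?e n"] power_mono[OF norm_fourier_le[OF h(1)], of _ 2] gauss_pos[of "?e n"] in
           \<open>auto simp: abs_mult mult.commute less_imp_le intro!: mult_left_mono\<close>)
    have "(\<integral>\<^sup>+\<xi>. ?u n \<xi> \<partial>lborel) = ennreal (\<integral>\<xi>. gauss (?e n) \<xi> * (norm (fourier h \<xi>))\<^sup>2 \<partial>lborel)"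
      using gauss_pos[of "?e n"] by (intro nn_integral_eq_integral i) (auto simp: less_imp_le)
    also have "\<dots> \<le> ennreal (L2sq h)" by (intro ennreal_leI bessel_gauss h) simp
    finally show ?thesis .
  qed
  have lim: "(\<lambda>n. ?u n \<xi>) \<longlonglongrightarrow> ennreal ((norm (fourier h \<xi>))\<^sup>2)" for \<xi>
  proof (rule tendsto_ennrealI)
    have "(\<lambda>n. gauss (?e n) \<xi>) \<longlonglongrightarrow> exp (- (0 * (norm \<xi>)\<^sup>2 / 2))"
      unfolding gauss_def by (intro tendsto_intros LIMSEQ_Suc[OF lim_1_over_n]) simp
    from tendsto_mult_right[OF this, of "(norm (fourier h \<xi>))\<^sup>2"]
    show "(\<lambda>n. gauss (?e n) \<xi> * (norm (fourier h \<xi>))\<^sup>2) \<longlonglongrightarrow> (norm (fourier h \<xi>))\<^sup>2" by simp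
  qed
  have "(\<integral>\<^sup>+\<xi>. ennreal ((norm (fourier h \<xi>))\<^sup>2) \<partial>lborel) = (\<integral>\<^sup>+\<xi>. liminf (\<lambda>n. ?u n \<xi>) \<partial>lborel)"
    by (intro nn_integral_cong lim_imp_Liminf[symmetric] lim) simp
  also have "\<dots> \<le> liminf (\<lambda>n. \<integral>\<^sup>+\<xi>. ?u n \<xi> \<partial>lborel)"
    by (rule nn_integral_liminf) measurable
  also have "\<dots> \<le> ennreal (L2sq h)"
    by (rule order_trans[OF Liminf_mono[OF always_eventually[OF allI[OF le]]]]) (simp add: Liminf_const)
  finally have *: "(\<integral>\<^sup>+\<xi>. ennreal ((norm (fourier h \<xi>))\<^sup>2) \<partial>lborel) \<le> ennreal (L2sq h)" .
  then show L: "L2 (fourier h)" unfolding L2_iff_nn by (auto intro: le_less_trans)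
  from * show "L2sq (fourier h) \<le> L2sq h" unfolding L2_nn[OF L] by simp
qed

section \<open>Existence and linearity of the Fourier transform on \<open>L\<^sup>2\<close>\<close>

definition trunc :: "real \<Rightarrow> (real^3 \<Rightarrow> real) \<Rightarrow> real^3 \<Rightarrow> real" where
  "trunc R f x = indicator (cball 0 R) x * f x"

lemma trunc_measurable [measurable]:
  assumes [measurable]: "f \<in> borel_measurable borel"
  shows "trunc R f \<in> borel_measurable borel"
proof -
  have [measurable]: "cball 0 R \<in> sets (borel :: (real^3) measure)" by simp
  have "(\<lambda>x. indicator (cball 0 R) x * f x) \<in> borel_measurable borel" by measurable
  then show ?thesis by (simp add: trunc_def[abs_def])
qed

lemma L2_trunc:
  assumes "L2 f" shows "L2 (trunc R f)" "integrable lborel (trunc R f)"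
proof -
  have [measurable]: "f \<in> borel_measurable borel" using assms by (simp add: L2_def)
  show "L2 (trunc R f)"
    by (rule L2_mono[OF assms, where c = 1]) (auto simp: trunc_def indicator_def)
  have "integrable lborel (\<lambda>x::real^3. indicator (cball 0 R) x * (1::real))"
    using borel_integrable_compact[of "cball 0 R :: (real^3) set" "\<lambda>_. 1::real"] by simp
  then have "L2 (\<lambda>x::real^3. indicator (cball 0 R) x * (1::real))"
    by (rule L2_bound(1)[rotated]) (auto simp: indicator_def)
  from L2_mult[OF this assms] show "integrable lborel (trunc R f)"
    by (simp add: trunc_def[abs_def])
qed

lemma truncated_fourier_eq: "truncated_fourier R f = fourier (trunc R f)"
  unfolding truncated_fourier_def[abs_def] fourier_def[abs_def] set_lebesgue_integral_def fourier_const_def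
  by (simp add: trunc_def scaleR_conv_of_real mult.assoc of_real_indicator)

lemma trunc_tendsto: "((\<lambda>R. trunc R f x) \<longlongrightarrow> f x) at_top"
proof (rule tendsto_eventually)
  show "\<forall>\<^sub>F R in at_top. trunc R f x = f x"
    using eventually_ge_at_top[of "norm x"] by eventually_elim (simp add: trunc_def)
qed

lemma abs_trunc_le: "\<bar>trunc R f x\<bar> \<le> \<bar>f x\<bar>"
  by (simp add: trunc_def indicator_def)

text \<open>The mass that is lost by truncation; it controls the distance between the transforms of any two
  truncations beyond the radius \<open>R\<close>.\<close>

definition tail :: "(real^3 \<Rightarrow> real) \<Rightarrow> real \<Rightarrow> real" where
  "tail f R = L2sq (\<lambda>x. f x - trunc R f x)"

lemma tail_tendsto:
  assumes f: "L2 f" shows "(tail f \<longlongrightarrow> 0) at_top"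
proof -
  have [measurable]: "f \<in> borel_measurable borel" using f by (simp add: L2_def)
  have "((\<lambda>R. \<integral>x. (norm (f x - trunc R f x))\<^sup>2 \<partial>lborel) \<longlongrightarrow> integral\<^sup>L lborel (\<lambda>x::real^3. 0::real)) at_top"
  proof (rule integral_dominated_convergence_at_top[where w = "\<lambda>x. (norm (f x))\<^sup>2"])
    show "integrable lborel (\<lambda>x. (norm (f x))\<^sup>2)" using f by (simp add: L2_def)
    show "AE x in lborel. ((\<lambda>R. (norm (f x - trunc R f x))\<^sup>2) \<longlongrightarrow> 0) at_top"
    proof (rule AE_I2)
      fix x
      have "((\<lambda>R. (norm (f x - trunc R f x))\<^sup>2) \<longlongrightarrow> (norm (f x - f x))\<^sup>2) at_top"
        by (intro tendsto_intros trunc_tendsto)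
      then show "((\<lambda>R. (norm (f x - trunc R f x))\<^sup>2) \<longlongrightarrow> 0) at_top" by simp
    qed
    show "\<forall>\<^sub>F R in at_top. AE x in lborel. norm ((norm (f x - trunc R f x))\<^sup>2) \<le> (norm (f x))\<^sup>2"
      by (intro always_eventually allI AE_I2) (auto simp: trunc_def indicator_def)
  qed measurable
  then show ?thesis by (simp add: tail_def[abs_def] L2sq_def)
qed

lemma fourier_trunc_diff:
  assumes f: "L2 f" and R: "N \<le> R" "N \<le> R'"
  shows "L2 (\<lambda>\<xi>. fourier (trunc R f) \<xi> - fourier (trunc R' f) \<xi>)"
    and "L2sq (\<lambda>\<xi>. fourier (trunc R f) \<xi> - fourier (trunc R' f) \<xi>) \<le> tail f N"
proof -
  have [measurable]: "f \<in> borel_measurable borel" using f by (simp add: L2_def)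
  let ?h = "\<lambda>x. trunc R f x - trunc R' f x"
  have eq: "(\<lambda>\<xi>. fourier (trunc R f) \<xi> - fourier (trunc R' f) \<xi>) = fourier ?h"
    by (rule ext) (simp add: fourier_diff L2_trunc f)
  have i: "integrable lborel ?h" using L2_trunc[OF f] by simp
  have t: "L2 (\<lambda>x. f x - trunc N f x)" by (intro L2_diff L2_trunc f)
  have m: "?h \<in> borel_measurable borel" by measurable
  have le: "norm (?h x) \<le> 1 * norm (f x - trunc N f x)" for x
    using R by (auto simp: trunc_def indicator_def)
  note h = L2_mono[OF t m le]
  show "L2 (\<lambda>\<xi>. fourier (trunc R f) \<xi> - fourier (trunc R' f) \<xi>)" unfolding eq by (rule bessel[OF i h(1)])
  show "L2sq (\<lambda>\<xi>. fourier (trunc R f) \<xi> - fourier (trunc R' f) \<xi>) \<le> tail f N"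
    unfolding eq tail_def using bessel(2)[OF i h(1)] h(2) by simp
qed

text \<open>By Bessel's inequality the transforms of the truncations form a Cauchy sequence in \<open>L\<^sup>2\<close>. Weighted
  with a fixed Gaussian they are Cauchy in \<open>L\<^sup>1\<close>, which yields a subsequence that converges almost
  everywhere; Fatou's lemma shows that its pointwise limit is also the limit in the mean.\<close>

lemma is_fourier_L2_exists:
  assumes f: "L2 f" shows "\<exists>g. is_fourier_L2 f g"
proof -
  have [measurable]: "f \<in> borel_measurable borel" using f by (simp add: L2_def)
  let ?g = "\<lambda>n::nat. fourier (trunc (real n) f)"
  have L2g: "L2 (?g n)" for n using L2_trunc[OF f] by (intro bessel)
  obtain r where r: "strict_mono r" "AE \<xi> in lborel. Cauchy (\<lambda>i. of_real (gauss 1 \<xi>) * ?g (r i) \<xi>)"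
  proof (rule cauchy_L1_AE_cauchy_subseq[of lborel "\<lambda>n \<xi>. of_real (gauss 1 \<xi>) * ?g n \<xi>"])
    have G: "L2 (\<lambda>\<xi>. complex_of_real (gauss 1 \<xi>))" using L2_gauss[of 1] by (simp add: L2_def)
    show "integrable lborel (\<lambda>\<xi>. of_real (gauss 1 \<xi>) * ?g n \<xi>)" for n by (rule L2_mult[OF G L2g])
    fix e :: real assume e: "e > 0"
    define k where "k = sqrt (L2sq (\<lambda>\<xi>. complex_of_real (gauss 1 \<xi>)))"
    have k: "k \<ge> 0" by (simp add: k_def)
    have "((\<lambda>R. k * sqrt (tail f R)) \<longlongrightarrow> k * sqrt 0) at_top" by (intro tendsto_intros tail_tendsto f)
    then have "\<forall>\<^sub>F R in at_top. k * sqrt (tail f R) < e" using e by (auto simp: order_tendsto_iff)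
    then obtain R0 where R0: "\<And>R. R \<ge> R0 \<Longrightarrow> k * sqrt (tail f R) < e"
      by (auto simp: eventually_at_top_linorder)
    have "(LINT \<xi>|lborel. norm (of_real (gauss 1 \<xi>) * ?g i \<xi> - of_real (gauss 1 \<xi>) * ?g j \<xi>)) < e"
      if "i \<ge> nat \<lceil>R0\<rceil>" "j \<ge> nat \<lceil>R0\<rceil>" for i j
    proof -
      let ?N = "real (nat \<lceil>R0\<rceil>)"
      have N: "?N \<ge> R0" "?N \<le> real i" "?N \<le> real j" using that by (simp_all add: le_nat_iff real_nat_ceiling_ge)
      have "norm (of_real (gauss 1 \<xi>) * ?g i \<xi> - of_real (gauss 1 \<xi>) * ?g j \<xi>) =
          norm (complex_of_real (gauss 1 \<xi>)) * norm (?g i \<xi> - ?g j \<xi>)" for \<xi>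
        by (simp add: right_diff_distrib[symmetric] norm_mult)
      then have "(LINT \<xi>|lborel. norm (of_real (gauss 1 \<xi>) * ?g i \<xi> - of_real (gauss 1 \<xi>) * ?g j \<xi>))
          \<le> k * sqrt (L2sq (\<lambda>\<xi>. ?g i \<xi> - ?g j \<xi>))"
        unfolding k_def using L2_Cauchy_Schwarz(1)[OF G L2_diff(1)[OF L2g[of i] L2g[of j]]] by simp
      also have "\<dots> \<le> k * sqrt (tail f ?N)"
        using fourier_trunc_diff(2)[OF f N(2,3)] k by (intro mult_left_mono real_sqrt_le_mono)
      also have "\<dots> < e" by (rule R0[OF N(1)])
      finally show ?thesis .
    qed
    then show "\<exists>N. \<forall>i\<ge>N. \<forall>j\<ge>N. (LINT \<xi>|lborel. norm (of_real (gauss 1 \<xi>) * ?g i \<xi> - of_real (gauss 1 \<xi>) * ?g j \<xi>)) < e"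
      by blast
  qed
  define g where "g \<xi> = lim (\<lambda>i. ?g (r i) \<xi>)" for \<xi>
  have gm[measurable]: "g \<in> borel_measurable borel"
    unfolding g_def by (rule borel_measurable_lim_metric) measurable
  have lim: "AE \<xi> in lborel. (\<lambda>i. ?g (r i) \<xi>) \<longlonglongrightarrow> g \<xi>"
    using r(2)
  proof eventually_elim
    case (elim \<xi>)
    have g0: "gauss 1 \<xi> \<noteq> 0" using gauss_pos[of 1 \<xi>] by simp
    from elim have "convergent (\<lambda>i. of_real (gauss 1 \<xi>) * ?g (r i) \<xi>)" by (simp add: Cauchy_convergent_iff)
    then obtain l where "(\<lambda>i. of_real (gauss 1 \<xi>) * ?g (r i) \<xi>) \<longlonglongrightarrow> l" by (auto simp: convergent_def)
    from tendsto_mult_left[OF this, of "inverse (of_real (gauss 1 \<xi>))"]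
    have "(\<lambda>i. ?g (r i) \<xi>) \<longlonglongrightarrow> inverse (of_real (gauss 1 \<xi>)) * l" using g0 by (simp add: mult.assoc[symmetric])
    then show ?case unfolding g_def by (simp add: limI)
  qed
  have bound: "(\<integral>\<^sup>+\<xi>. ennreal ((norm (fourier (trunc R f) \<xi> - g \<xi>))\<^sup>2) \<partial>lborel) \<le> ennreal (tail f R)" for R
  proof -
    let ?u = "\<lambda>i \<xi>. ennreal ((norm (fourier (trunc R f) \<xi> - ?g (r i) \<xi>))\<^sup>2)"
    have "(\<integral>\<^sup>+\<xi>. ennreal ((norm (fourier (trunc R f) \<xi> - g \<xi>))\<^sup>2) \<partial>lborel) = (\<integral>\<^sup>+\<xi>. liminf (\<lambda>i. ?u i \<xi>) \<partial>lborel)"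
    proof (intro nn_integral_cong_AE, use lim in eventually_elim)
      case (elim \<xi>)
      have "(\<lambda>i. ?u i \<xi>) \<longlonglongrightarrow> ennreal ((norm (fourier (trunc R f) \<xi> - g \<xi>))\<^sup>2)"
        by (intro tendsto_ennrealI tendsto_intros elim)
      from lim_imp_Liminf[OF trivial_limit_sequentially this] show ?case by simp
    qed
    also have "\<dots> \<le> liminf (\<lambda>i. \<integral>\<^sup>+\<xi>. ?u i \<xi> \<partial>lborel)"
      by (rule nn_integral_liminf) measurable
    also have "\<dots> \<le> liminf (\<lambda>i::nat. ennreal (tail f R))"
    proof (rule Liminf_mono)
      show "\<forall>\<^sub>F i in sequentially. (\<integral>\<^sup>+\<xi>. ?u i \<xi> \<partial>lborel) \<le> ennreal (tail f R)"
        using eventually_ge_at_top[of "nat \<lceil>R\<rceil>"]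
      proof eventually_elim
        case (elim i)
        have "R \<le> real i" using elim by (simp add: le_nat_iff nat_ceiling_le_eq)
        also have "\<dots> \<le> real (r i)" using seq_suble[OF r(1), of i] by simp
        finally have R: "R \<le> real (r i)" .
        show ?case using fourier_trunc_diff[OF f order_refl R] by (simp add: L2_nn ennreal_leI)
      qed
    qed
    also have "\<dots> = ennreal (tail f R)" by (simp add: Liminf_const)
    finally show ?thesis .
  qed
  have "L2 (\<lambda>\<xi>. fourier (trunc 0 f) \<xi> - g \<xi>)"
    unfolding L2_iff_nn using le_less_trans[OF bound[of 0]] by simp
  then have "L2 g"
    using L2_diff(1)[OF bessel(1)[OF L2_trunc(2,1)[OF f, of 0]], of "\<lambda>\<xi>. fourier (trunc 0 f) \<xi> - g \<xi>"] by simp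
  moreover have "((\<lambda>R. \<integral>\<^sup>+\<xi>. ennreal ((norm (fourier (trunc R f) \<xi> - g \<xi>))\<^sup>2) \<partial>lborel) \<longlongrightarrow> 0) at_top"
  proof (rule tendsto_sandwich[where f = "\<lambda>_. 0" and h = "\<lambda>R. ennreal (tail f R)"])
    show "((\<lambda>R. ennreal (tail f R)) \<longlongrightarrow> 0) at_top"
      using tendsto_ennrealI[OF tail_tendsto[OF f]] by simp
  qed (auto intro!: always_eventually bound)
  ultimately show ?thesis
    unfolding is_fourier_L2_def truncated_fourier_eq Lp_2_iff_L2 by blast
qed

lemma is_fourier_fourier_L2: "L2 f \<Longrightarrow> is_fourier_L2 f (fourier_L2 f)"
  unfolding fourier_L2_def by (rule someI_ex[OF is_fourier_L2_exists])

lemma is_fourier_L2_D: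
  assumes f: "L2 f" and g: "is_fourier_L2 f g"
  shows "L2 g" "((\<lambda>R. L2sq (\<lambda>\<xi>. fourier (trunc R f) \<xi> - g \<xi>)) \<longlongrightarrow> 0) at_top"
proof -
  show g2: "L2 g" using g by (simp add: is_fourier_L2_def Lp_2_iff_L2)
  have d: "L2 (\<lambda>\<xi>. fourier (trunc R f) \<xi> - g \<xi>)" for R
    using L2_trunc[OF f] by (intro L2_diff bessel g2)
  have "((\<lambda>R. ennreal (L2sq (\<lambda>\<xi>. fourier (trunc R f) \<xi> - g \<xi>))) \<longlongrightarrow> ennreal 0) at_top"
    using g by (simp add: is_fourier_L2_def truncated_fourier_eq L2_nn[OF d])
  then show "((\<lambda>R. L2sq (\<lambda>\<xi>. fourier (trunc R f) \<xi> - g \<xi>)) \<longlongrightarrow> 0) at_top"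
    by (subst (asm) tendsto_ennreal_iff) auto
qed

lemma L2sq_0_AE:
  fixes f :: "'a::euclidean_space \<Rightarrow> 'b::{banach, second_countable_topology}"
  assumes "L2 f" "L2sq f \<le> 0" shows "AE x in lborel. f x = 0"
proof -
  have [measurable]: "f \<in> borel_measurable borel" using assms by (simp add: L2_def)
  have "(\<integral>\<^sup>+x. ennreal ((norm (f x))\<^sup>2) \<partial>lborel) = 0"
    using L2_nn[OF assms(1)] assms(2) by (simp add: ennreal_neg)
  then have "AE x in lborel. ennreal ((norm (f x))\<^sup>2) = 0"
    by (subst (asm) nn_integral_0_iff_AE) auto
  then show ?thesis by eventually_elim (auto simp: ennreal_eq_0_iff)
qed

text \<open>The transform is an arbitrary choice among the limits in the mean, so linearity can hold only almost
  everywhere; it follows from the linearity of the approximations and the uniqueness of limits.\<close>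

lemma fourier_L2_diff_AE:
  assumes f: "L2 f" and h: "L2 h"
  shows "AE \<xi> in lborel. fourier_L2 (\<lambda>x. f x - h x) \<xi> = fourier_L2 f \<xi> - fourier_L2 h \<xi>"
proof -
  let ?d = "\<lambda>x. f x - h x"
  have d: "L2 ?d" by (intro L2_diff f h)
  note F = is_fourier_L2_D[OF f is_fourier_fourier_L2[OF f]]
  note H = is_fourier_L2_D[OF h is_fourier_fourier_L2[OF h]]
  note D = is_fourier_L2_D[OF d is_fourier_fourier_L2[OF d]]
  let ?e = "\<lambda>\<xi>. fourier_L2 ?d \<xi> - (fourier_L2 f \<xi> - fourier_L2 h \<xi>)"
  have e: "L2 ?e" by (intro L2_diff F H D)
  have td: "trunc R ?d = (\<lambda>x. trunc R f x - trunc R h x)" for R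
    by (auto simp: trunc_def right_diff_distrib)
  have ft_d: "fourier (trunc R ?d) \<xi> = fourier (trunc R f) \<xi> - fourier (trunc R h) \<xi>" for R \<xi>
    unfolding td by (intro fourier_diff L2_trunc f h)
  have le: "L2sq ?e \<le> 4 * L2sq (\<lambda>\<xi>. fourier (trunc R f) \<xi> - fourier_L2 f \<xi>)
      + 4 * L2sq (\<lambda>\<xi>. fourier (trunc R h) \<xi> - fourier_L2 h \<xi>)
      + 2 * L2sq (\<lambda>\<xi>. fourier (trunc R ?d) \<xi> - fourier_L2 ?d \<xi>)" for R
  proof -
    have a: "L2 (\<lambda>\<xi>. fourier (trunc R f) \<xi> - fourier_L2 f \<xi>)"
      and b: "L2 (\<lambda>\<xi>. fourier (trunc R h) \<xi> - fourier_L2 h \<xi>)"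
      and c: "L2 (\<lambda>\<xi>. fourier (trunc R ?d) \<xi> - fourier_L2 ?d \<xi>)"
      by (intro L2_diff bessel L2_trunc f h d F H D)+
    have "?e = (\<lambda>\<xi>. ((fourier (trunc R f) \<xi> - fourier_L2 f \<xi>) - (fourier (trunc R h) \<xi> - fourier_L2 h \<xi>))
        - (fourier (trunc R ?d) \<xi> - fourier_L2 ?d \<xi>))"
      by (auto simp: ft_d)
    then show ?thesis using L2_diff(2)[OF L2_diff(1)[OF a b] c] L2_diff(2)[OF a b] by simp
  qed
  have "((\<lambda>R. 4 * L2sq (\<lambda>\<xi>. fourier (trunc R f) \<xi> - fourier_L2 f \<xi>)
      + 4 * L2sq (\<lambda>\<xi>. fourier (trunc R h) \<xi> - fourier_L2 h \<xi>)
      + 2 * L2sq (\<lambda>\<xi>. fourier (trunc R ?d) \<xi> - fourier_L2 ?d \<xi>)) \<longlongrightarrow> 4 * 0 + 4 * 0 + 2 * 0) at_top"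
    by (intro tendsto_add tendsto_mult tendsto_const F H D)
  from tendsto_lowerbound[OF this always_eventually[OF allI[OF le]]]
  have "L2sq ?e \<le> 4 * 0 + 4 * 0 + 2 * 0" by simp
  then have "AE \<xi> in lborel. ?e \<xi> = 0" by (intro L2sq_0_AE e) simp
  then show ?thesis by eventually_elim simp
qed

section \<open>Fourier inversion and Plancherel's inequality\<close>

text \<open>Since \<open>f\<close> may be unbounded, continuity is used only near \<open>y\<close>. Away from \<open>y\<close> the kernel is dominated
  by a fixed Gaussian times a factor that tends to zero, and a square integrable function can be
  integrated against that Gaussian.\<close>

lemma heat_approximate_identity:
  assumes f: "L2 f" and c: "isCont f y"
  shows "(\<lambda>n. \<integral>x. f x * heat (1 / real (Suc n)) (x - y) \<partial>lborel) \<longlonglongrightarrow> (2 * pi)^3 * f y"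
proof (rule LIMSEQ_I)
  have [measurable]: "f \<in> borel_measurable borel" using f by (simp add: L2_def)
  let ?e = "\<lambda>n. 1 / real (Suc n)"
  fix r :: real assume r: "r > 0"
  define e where "e = r / (2 * (2 * pi)^3)"
  have e: "e > 0" "e * (2 * pi)^3 = r / 2" using r by (simp_all add: e_def)
  obtain d where d: "d > 0" "\<And>x. dist x y < d \<Longrightarrow> \<bar>f x - f y\<bar> < e"
    using c e(1) unfolding continuous_at_eps_delta dist_real_def by blast
  \<comment> \<open>half of the Gaussian exponent pays for the decay in \<open>n\<close>, the other half keeps the integrability in \<open>x\<close>\<close>
  define \<kappa> where "\<kappa> n = (sqrt (2 * pi / ?e n))^3 * exp (- (d\<^sup>2 / (4 * ?e n)))" for n
  have \<kappa>_eq: "\<kappa> n = (sqrt (2 * pi))^3 * ((sqrt (real (Suc n)))^3 * exp (- (d\<^sup>2 / 4 * real (Suc n))))" for n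
    by (simp add: \<kappa>_def real_sqrt_mult power_mult_distrib)
  have "(\<lambda>n. (sqrt (real n))^3 * exp (- (d\<^sup>2 / 4 * real n))) \<longlonglongrightarrow> 0"
  proof -
    have "d\<^sup>2 / 4 > 0" using d by simp
    then show ?thesis by real_asymp
  qed
  then have "(\<lambda>n. (sqrt (real (Suc n)))^3 * exp (- (d\<^sup>2 / 4 * real (Suc n)))) \<longlonglongrightarrow> 0"
    by (rule LIMSEQ_Suc)
  from tendsto_mult_left[OF this, of "(sqrt (2 * pi))^3"] have \<kappa>0: "\<kappa> \<longlonglongrightarrow> 0"
    unfolding \<kappa>_eq by simp
  define k where "k x = (\<bar>f x\<bar> + \<bar>f y\<bar>) * gauss (1/2) (x - y)" for x
  have ki: "integrable lborel k"
  proof -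
    have g: "L2 (\<lambda>x. gauss (1/2) (x - y))" 
      using L2_gauss[of "1/2"] integrable_translate[OF L2_integrable, of "gauss (1/2)" "- y"] by (simp add: L2_def)
    have a: "L2 (\<lambda>x. \<bar>f x\<bar>)" using f by (simp add: L2_def)
    have "integrable lborel (\<lambda>x. gauss (1/2) (x - y))"
      using integrable_translate[OF gauss_integral(1)[of "1/2"], of "- y"] by simp
    then show ?thesis unfolding k_def[abs_def] distrib_right
      by (intro Bochner_Integration.integrable_add L2_mult[OF a g]) simp
  qed
  define B where "B = (\<integral>x. k x \<partial>lborel)"
  have k0: "0 \<le> k x" for x by (simp add: k_def gauss_pos less_imp_le)
  have B0: "0 \<le> B" unfolding B_def by (simp add: k0)
  have "(\<lambda>n. \<kappa> n * B) \<longlonglongrightarrow> 0 * B" by (intro tendsto_intros \<kappa>0)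
  then have "\<forall>\<^sub>F n in sequentially. \<kappa> n * B < r / 2" using r
    by (intro order_tendstoD(2)) auto
  then obtain N where N: "\<And>n. n \<ge> N \<Longrightarrow> \<kappa> n * B < r / 2" by (auto simp: eventually_sequentially)
  have "norm ((\<integral>x. f x * heat (?e n) (x - y) \<partial>lborel) - (2 * pi)^3 * f y) < r" if "n \<ge> N" for n
  proof -
    have en: "?e n > 0" "?e n \<le> 1" by simp_all
    have hp: "0 \<le> heat (?e n) z" for z using heat_pos[OF en(1), of z] by simp
    have i1: "integrable lborel (\<lambda>x. f x * heat (?e n) (x - y))" by (rule L2_mult[OF f L2_heat_shift[OF en(1)]])
    have i2: "integrable lborel (\<lambda>x. f y * heat (?e n) (x - y))" using heat_shift(1)[OF en(1), of y] by simp
    have "(2 * pi)^3 * f y = (\<integral>x. f y * heat (?e n) (x - y) \<partial>lborel)"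
      using heat_shift(2)[OF en(1), of y] by simp
    then have "(\<integral>x. f x * heat (?e n) (x - y) \<partial>lborel) - (2 * pi)^3 * f y
       = (\<integral>x. f x * heat (?e n) (x - y) - f y * heat (?e n) (x - y) \<partial>lborel)"
      by (simp only: Bochner_Integration.integral_diff[OF i1 i2])
    also have "norm \<dots> \<le> (\<integral>x. e * heat (?e n) (x - y) + \<kappa> n * k x \<partial>lborel)"
    proof (rule order_trans[OF integral_norm_bound])
      show "(\<integral>x. norm (f x * heat (?e n) (x - y) - f y * heat (?e n) (x - y)) \<partial>lborel)
          \<le> (\<integral>x. e * heat (?e n) (x - y) + \<kappa> n * k x \<partial>lborel)"
      proof (rule integral_mono)
        show "integrable lborel (\<lambda>x. norm (f x * heat (?e n) (x - y) - f y * heat (?e n) (x - y)))"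
          using i1 i2 by simp
        show "integrable lborel (\<lambda>x. e * heat (?e n) (x - y) + \<kappa> n * k x)"
          using heat_shift(1)[OF en(1), of y] ki by simp
        fix x
        have n: "norm (f x * heat (?e n) (x - y) - f y * heat (?e n) (x - y)) = \<bar>f x - f y\<bar> * heat (?e n) (x - y)"
          by (simp only: left_diff_distrib[symmetric] real_norm_def abs_mult abs_of_nonneg[OF hp])
        have \<kappa>n: "\<kappa> n \<ge> 0" unfolding \<kappa>_def by simp
        show "norm (f x * heat (?e n) (x - y) - f y * heat (?e n) (x - y)) \<le> e * heat (?e n) (x - y) + \<kappa> n * k x"
        proof (cases "dist x y < d")
          case True
          have "\<bar>f x - f y\<bar> * heat (?e n) (x - y) \<le> e * heat (?e n) (x - y)"
            by (rule mult_right_mono[OF less_imp_le[OF d(2)[OF True]] hp])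
          then show ?thesis unfolding n using mult_nonneg_nonneg[OF \<kappa>n k0[of x]] by linarith
        next
          case False
          then have dx: "d\<^sup>2 \<le> (norm (x - y))\<^sup>2" using d(1) by (simp add: dist_norm power_mono)
          let ?s = "(norm (x - y))\<^sup>2" and ?m = "1 / ?e n"
          have alg: "- (M * t / 2) \<le> - (D / 4 * M) + - (1/2 * t / 2)"
            if "D * M \<le> t * M" "t * 1 \<le> t * M" for M t D :: real
            using that by (simp add: algebra_simps)
          have m1: "1 \<le> ?m" by simp
          have "d\<^sup>2 * ?m \<le> ?s * ?m" by (rule mult_right_mono[OF dx]) simp
          moreover have "?s * 1 \<le> ?s * ?m" by (rule mult_left_mono[OF m1]) simp
          ultimately have "- (?m * ?s / 2) \<le> - (d\<^sup>2 / 4 * ?m) + - (1/2 * ?s / 2)" by (rule alg)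
          then have "gauss ?m (x - y) \<le> exp (- (d\<^sup>2 / 4 * ?m)) * gauss (1/2) (x - y)"
            unfolding gauss_def exp_add[symmetric] by simp
          then have "heat (?e n) (x - y) \<le> \<kappa> n * gauss (1/2) (x - y)"
            unfolding heat_def \<kappa>_def by (simp add: mult.assoc mult_left_mono)
          then have "\<bar>f x - f y\<bar> * heat (?e n) (x - y) \<le> (\<bar>f x\<bar> + \<bar>f y\<bar>) * (\<kappa> n * gauss (1/2) (x - y))"
            by (intro mult_mono abs_triangle_ineq4 hp) auto
          also have "\<dots> = \<kappa> n * k x" by (simp add: k_def)
          finally show ?thesis
            unfolding n using mult_nonneg_nonneg[OF less_imp_le[OF e(1)] hp[of "x - y"]] by linarith
        qed
      qed
    qed
    also have "\<dots> = e * (2 * pi)^3 + \<kappa> n * B"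
      using heat_shift(1,2)[OF en(1), of y] ki by (simp add: B_def)
    also have "\<dots> < r" using e(2) N[OF that] by simp
    finally show ?thesis .
  qed
  then show "\<exists>N. \<forall>n\<ge>N. norm ((\<integral>x. f x * heat (?e n) (x - y) \<partial>lborel) - (2 * pi)^3 * f y) < r" by blast
qed

text \<open>The formula is the multiplication formula for the truncations, passed to the limit in the mean.\<close>

lemma fourier_gauss_test:
  assumes f: "L2 f" and g: "is_fourier_L2 f g" and e: "\<epsilon> > 0"
  shows "(\<integral>\<xi>. of_real (gauss \<epsilon> \<xi>) * cis (y \<bullet> \<xi>) * g \<xi> \<partial>lborel)
       = of_real (fourier_const * (\<integral>x. f x * heat \<epsilon> (x - y) \<partial>lborel))"
proof -
  have [measurable]: "f \<in> borel_measurable borel" using f by (simp add: L2_def)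
  note G = is_fourier_L2_D[OF f g]
  have [measurable]: "g \<in> borel_measurable borel" using G by (simp add: L2_def)
  let ?\<phi> = "\<lambda>\<xi>. of_real (gauss \<epsilon> \<xi>) * cis (y \<bullet> \<xi>)"
  have \<phi>: "L2 ?\<phi>"
    by (rule L2_mono(1)[OF L2_gauss[OF e], where c = 1]) (auto simp: norm_mult)
  have \<phi>1: "integrable lborel ?\<phi>" using gauss_fourier(1)[OF e, of y] by (simp add: inner_commute)
  have FT: "L2 (fourier (trunc R f))" for R by (intro bessel L2_trunc f)
  have A: "(\<integral>\<xi>. ?\<phi> \<xi> * fourier (trunc R f) \<xi> \<partial>lborel) = of_real (fourier_const * (\<integral>x. trunc R f x * heat \<epsilon> (x - y) \<partial>lborel))" for R
  proof -
    have i: "integrable lborel (\<lambda>x. complex_of_real (trunc R f x))" using L2_trunc(2)[OF f] by simp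
    have h: "(\<integral>\<xi>. ?\<phi> \<xi> * cis (- 1 * (x \<bullet> \<xi>)) \<partial>lborel) = of_real (heat \<epsilon> (x - y))" for x
    proof -
      have "cis (y \<bullet> \<xi>) * cis (- 1 * (x \<bullet> \<xi>)) = cis (\<xi> \<bullet> (y - x))" for \<xi>
        by (simp add: cis_mult inner_diff_right inner_commute)
      then show ?thesis by (simp add: mult.assoc gauss_fourier[OF e] heat_diff_commute[of _ x])
    qed
    have "(\<integral>\<xi>. ?\<phi> \<xi> * fourier (trunc R f) \<xi> \<partial>lborel)
        = of_real fourier_const * (\<integral>\<xi>. ?\<phi> \<xi> * (\<integral>x. of_real (trunc R f x) * cis (- 1 * (x \<bullet> \<xi>)) \<partial>lborel) \<partial>lborel)"
      unfolding fourier_def by (subst integral_mult_right_zero[symmetric]) (simp add: ac_simps)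
    also have "\<dots> = of_real fourier_const * (\<integral>x. of_real (trunc R f x) * of_real (heat \<epsilon> (x - y)) \<partial>lborel)"
      by (subst multiplication_formula[OF i \<phi>1]) (simp only: h)
    finally show ?thesis by (simp flip: of_real_mult)
  qed
  have "((\<lambda>R. \<integral>\<xi>. ?\<phi> \<xi> * fourier (trunc R f) \<xi> \<partial>lborel) \<longlongrightarrow> (\<integral>\<xi>. ?\<phi> \<xi> * g \<xi> \<partial>lborel)) at_top"
  proof (subst tendsto_dist_iff, rule tendsto_sandwich[where f = "\<lambda>_. 0"])
    let ?b = "\<lambda>R. sqrt (L2sq ?\<phi>) * sqrt (L2sq (\<lambda>\<xi>. fourier (trunc R f) \<xi> - g \<xi>))"
    show "\<forall>\<^sub>F R in at_top. dist (\<integral>\<xi>. ?\<phi> \<xi> * fourier (trunc R f) \<xi> \<partial>lborel) (\<integral>\<xi>. ?\<phi> \<xi> * g \<xi> \<partial>lborel) \<le> ?b R"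
    proof (intro always_eventually allI)
      fix R
      have "(\<integral>\<xi>. ?\<phi> \<xi> * fourier (trunc R f) \<xi> \<partial>lborel) - (\<integral>\<xi>. ?\<phi> \<xi> * g \<xi> \<partial>lborel)
          = (\<integral>\<xi>. ?\<phi> \<xi> * (fourier (trunc R f) \<xi> - g \<xi>) \<partial>lborel)"
        using Bochner_Integration.integral_diff[OF L2_mult[OF \<phi> FT] L2_mult[OF \<phi> G(1)]]
        by (simp add: right_diff_distrib)
      then show "dist (\<integral>\<xi>. ?\<phi> \<xi> * fourier (trunc R f) \<xi> \<partial>lborel) (\<integral>\<xi>. ?\<phi> \<xi> * g \<xi> \<partial>lborel) \<le> ?b R"
        using L2_Cauchy_Schwarz(2)[OF \<phi> L2_diff(1)[OF FT G(1)]] by (simp add: dist_norm)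
    qed
    have "(?b \<longlongrightarrow> sqrt (L2sq ?\<phi>) * sqrt 0) at_top" by (intro tendsto_intros G)
    then show "(?b \<longlongrightarrow> 0) at_top" by simp
  qed auto
  moreover have "((\<lambda>R. complex_of_real (fourier_const * (\<integral>x. trunc R f x * heat \<epsilon> (x - y) \<partial>lborel)))
      \<longlongrightarrow> of_real (fourier_const * (\<integral>x. f x * heat \<epsilon> (x - y) \<partial>lborel))) at_top"
  proof (intro tendsto_intros integral_dominated_convergence_at_top[where w = "\<lambda>x. \<bar>f x * heat \<epsilon> (x - y)\<bar>"])
    show "integrable lborel (\<lambda>x. \<bar>f x * heat \<epsilon> (x - y)\<bar>)"
      using L2_mult[OF f L2_heat_shift[OF e]] by (rule integrable_abs)
    show "AE x in lborel. ((\<lambda>R. trunc R f x * heat \<epsilon> (x - y)) \<longlongrightarrow> f x * heat \<epsilon> (x - y)) at_top"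
      by (intro AE_I2 tendsto_intros trunc_tendsto)
    show "\<forall>\<^sub>F R in at_top. AE x in lborel. norm (trunc R f x * heat \<epsilon> (x - y)) \<le> \<bar>f x * heat \<epsilon> (x - y)\<bar>"
      using abs_trunc_le by (intro always_eventually allI AE_I2) (auto simp: abs_mult intro!: mult_right_mono)
  qed measurable
  ultimately show ?thesis unfolding A by (intro tendsto_unique[OF trivial_limit_at_top_linorder])
qed

text \<open>Let the Gaussian in \<open>fourier_gauss_test\<close> tend to \<open>1\<close>: on one side dominated convergence applies because
  the transform is integrable, on the other side the heat kernel recovers the value at \<open>y\<close>.\<close>

lemma fourier_inversion:
  assumes f: "L2 f" and c: "isCont f y" and g: "is_fourier_L2 f g" and gi: "integrable lborel g"
  shows "of_real (f y) = of_real fourier_const * (\<integral>\<xi>. g \<xi> * cis (y \<bullet> \<xi>) \<partial>lborel)"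
proof -
  have [measurable]: "g \<in> borel_measurable borel" using gi by simp
  let ?e = "\<lambda>n. 1 / real (Suc n)"
  have "(\<lambda>n. \<integral>\<xi>. of_real (gauss (?e n) \<xi>) * cis (y \<bullet> \<xi>) * g \<xi> \<partial>lborel) \<longlonglongrightarrow> (\<integral>\<xi>. 1 * cis (y \<bullet> \<xi>) * g \<xi> \<partial>lborel)"
  proof (rule integral_dominated_convergence[where w = "\<lambda>\<xi>. norm (g \<xi>)"])
    show "AE \<xi> in lborel. (\<lambda>n. of_real (gauss (?e n) \<xi>) * cis (y \<bullet> \<xi>) * g \<xi>) \<longlonglongrightarrow> 1 * cis (y \<bullet> \<xi>) * g \<xi>"
    proof (rule AE_I2, intro tendsto_mult tendsto_const)
      fix \<xi> :: "real^3"
      have "(\<lambda>n. gauss (?e n) \<xi>) \<longlonglongrightarrow> exp (- (0 * (norm \<xi>)\<^sup>2 / 2))"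
        unfolding gauss_def by (intro tendsto_intros LIMSEQ_Suc[OF lim_1_over_n]) simp
      from tendsto_of_real[OF this] show "(\<lambda>n. complex_of_real (gauss (?e n) \<xi>)) \<longlonglongrightarrow> 1" by simp
    qed
    show "AE \<xi> in lborel. norm (of_real (gauss (?e n) \<xi>) * cis (y \<bullet> \<xi>) * g \<xi>) \<le> norm (g \<xi>)" for n
      using gauss_pos[of "?e n"] gauss_le_1[of "?e n"] 
      by (intro AE_I2) (auto simp: norm_mult less_imp_le intro!: mult_left_le_one_le)
  qed (use gi in simp_all)
  moreover have "(\<lambda>n. complex_of_real (fourier_const * (\<integral>x. f x * heat (?e n) (x - y) \<partial>lborel))) \<longlonglongrightarrow> of_real (fourier_const * ((2 * pi)^3 * f y))"
    by (intro tendsto_of_real tendsto_mult tendsto_const heat_approximate_identity f c)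
  ultimately have "(\<integral>\<xi>. 1 * cis (y \<bullet> \<xi>) * g \<xi> \<partial>lborel) = of_real (fourier_const * ((2 * pi)^3 * f y))"
    using fourier_gauss_test[OF f g, of "?e _" y] by (intro LIMSEQ_unique) simp_all
  then have "of_real fourier_const * (\<integral>\<xi>. g \<xi> * cis (y \<bullet> \<xi>) \<partial>lborel) = of_real (fourier_const * (fourier_const * ((2 * pi)^3 * f y)))"
    by (simp add: mult.commute)
  also have "fourier_const * (fourier_const * ((2 * pi)^3 * f y)) = fourier_const\<^sup>2 * (2 * pi)^3 * f y" by (simp add: power2_eq_square)
  finally show ?thesis unfolding fourier_const_sq by simp
qed

text \<open>Once the inversion formula holds, Plancherel's inequality follows by pairing \<open>f\<close> with its own
  truncations.\<close>

lemma plancherel_le: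
  assumes f: "L2 f" and c: "continuous_on UNIV f" and g: "is_fourier_L2 f g" and gi: "integrable lborel g"
  shows "L2sq f \<le> L2sq g"
proof -
  have [measurable]: "f \<in> borel_measurable borel" using f by (simp add: L2_def)
  note G = is_fourier_L2_D[OF f g]
  have [measurable]: "g \<in> borel_measurable borel" using gi by simp
  have le: "L2sq (trunc R f) \<le> L2sq g" for R
  proof -
    let ?t = "trunc R f"
    have ti: "integrable lborel (\<lambda>x. complex_of_real (?t x))" using L2_trunc(2)[OF f] by simp
    have FT: "L2 (fourier ?t)" by (intro bessel L2_trunc f)
    then have CF: "L2 (\<lambda>\<xi>. cnj (fourier ?t \<xi>))" unfolding L2_def by auto
    have inv: "of_real (f x) = of_real fourier_const * (\<integral>\<xi>. g \<xi> * cis (1 * (x \<bullet> \<xi>)) \<partial>lborel)" for x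
      using fourier_inversion[OF f _ g gi, of x] c by (simp add: continuous_on_eq_continuous_at)
    have "complex_of_real (L2sq ?t) = of_real (\<integral>x. ?t x * f x \<partial>lborel)"
      unfolding L2sq_def of_real_eq_iff
      by (intro Bochner_Integration.integral_cong) (auto simp: trunc_def indicator_def power2_eq_square)
    also have "\<dots> = (\<integral>x. of_real (?t x) * of_real (f x) \<partial>lborel)"
      by (simp flip: of_real_mult)
    also have "\<dots> = of_real fourier_const * (\<integral>x. of_real (?t x) * (\<integral>\<xi>. g \<xi> * cis (1 * (x \<bullet> \<xi>)) \<partial>lborel) \<partial>lborel)"
      unfolding inv by (subst integral_mult_right_zero[symmetric]) (simp add: ac_simps)
    also have "\<dots> = of_real fourier_const * (\<integral>\<xi>. g \<xi> * (\<integral>x. of_real (?t x) * cis (1 * (x \<bullet> \<xi>)) \<partial>lborel) \<partial>lborel)"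
      by (subst multiplication_formula[OF ti gi, symmetric]) simp
    also have "\<dots> = (\<integral>\<xi>. g \<xi> * cnj (fourier ?t \<xi>) \<partial>lborel)"
      unfolding cnj_fourier by (subst integral_mult_right_zero[symmetric]) (simp add: ac_simps)
    finally have "norm (complex_of_real (L2sq ?t)) = norm (\<integral>\<xi>. g \<xi> * cnj (fourier ?t \<xi>) \<partial>lborel)" by simp
    also have "\<dots> \<le> sqrt (L2sq g) * sqrt (L2sq (\<lambda>\<xi>. cnj (fourier ?t \<xi>)))"
      by (rule L2_Cauchy_Schwarz(2)[OF G(1) CF])
    also have "\<dots> \<le> sqrt (L2sq g) * sqrt (L2sq ?t)"
      using bessel(2)[OF L2_trunc(2,1)[OF f, of R]] by (intro mult_left_mono) (simp_all add: L2sq_def)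
    finally have "sqrt (L2sq ?t) * sqrt (L2sq ?t) \<le> sqrt (L2sq g) * sqrt (L2sq ?t)" by simp
    then have *: "L2sq ?t > 0 \<Longrightarrow> sqrt (L2sq ?t) \<le> sqrt (L2sq g)"
      by (rule mult_right_le_imp_le) simp
    show ?thesis
    proof (cases "L2sq ?t > 0")
      case True
      from *[OF this] show ?thesis by (rule real_sqrt_le_iff[THEN iffD1])
    next
      case False
      then have "L2sq ?t \<le> 0" by (rule leI)
      then show ?thesis by (rule order_trans) (rule L2sq_nonneg)
    qed
  qed
  have "((\<lambda>R. \<integral>x. (norm (trunc R f x))\<^sup>2 \<partial>lborel) \<longlongrightarrow> (\<integral>x. (norm (f x))\<^sup>2 \<partial>lborel)) at_top"
  proof (rule integral_dominated_convergence_at_top[where w = "\<lambda>x. (norm (f x))\<^sup>2"])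
    show "integrable lborel (\<lambda>x. (norm (f x))\<^sup>2)" using f by (simp add: L2_def)
    show "AE x in lborel. ((\<lambda>R. (norm (trunc R f x))\<^sup>2) \<longlongrightarrow> (norm (f x))\<^sup>2) at_top"
      by (intro AE_I2 tendsto_intros trunc_tendsto)
    show "\<forall>\<^sub>F R in at_top. AE x in lborel. norm ((norm (trunc R f x))\<^sup>2) \<le> (norm (f x))\<^sup>2"
      by (intro always_eventually allI AE_I2) (auto simp: trunc_def indicator_def)
  qed measurable
  from tendsto_upperbound[OF this[folded L2sq_def] always_eventually[OF allI[OF le]]]
  show ?thesis by simp
qed

section \<open>Sobolev embedding\<close>

text \<open>At infinity the function is compared with \<open>x powr (- 2 * a)\<close>, whose primitive decays since \<open>2 * a > 1\<close>.\<close>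

lemma integrable_bessel_weight_real:
  fixes a :: real
  assumes a: "a > 1/2"
  shows "integrable lborel (\<lambda>x::real. (1 + x\<^sup>2) powr (- a))"
proof -
  let ?h = "\<lambda>x::real. x powr (- 2 * a)"
  define k where "k x = indicator {0..} x * (1 + x\<^sup>2) powr (- a)" for x :: real
  have [measurable]: "k \<in> borel_measurable borel" unfolding k_def by measurable
  have "(\<integral>\<^sup>+x. ennreal (?h x) * indicator {1..} x \<partial>lborel) = ennreal (0 - 1 powr (1 - 2 * a) / (1 - 2 * a))"
  proof (rule nn_integral_FTC_atLeast[where F = "\<lambda>x. x powr (1 - 2 * a) / (1 - 2 * a)"])
    fix x :: real assume "1 \<le> x"
    then show "((\<lambda>x. x powr (1 - 2 * a) / (1 - 2 * a)) has_real_derivative ?h x) (at x)"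
      using a by (auto intro!: derivative_eq_intros)
    show "0 \<le> ?h x" by simp
  next
    have "((\<lambda>x. x powr (1 - 2 * a)) \<longlongrightarrow> 0) at_top"
      using a by (intro tendsto_neg_powr filterlim_ident) simp
    from tendsto_divide[OF this tendsto_const[of "1 - 2 * a"]] a
    show "((\<lambda>x. x powr (1 - 2 * a) / (1 - 2 * a)) \<longlongrightarrow> 0) at_top" by simp
  qed measurable
  then have fin: "(\<integral>\<^sup>+x. ennreal (?h x) * indicator {1..} x \<partial>lborel) < \<infinity>" by simp
  have "(\<integral>\<^sup>+x. ennreal (norm (k x)) \<partial>lborel) \<le> (\<integral>\<^sup>+x. indicator {0..1} x + ennreal (?h x) * indicator {1..} x \<partial>lborel)"
  proof (rule nn_integral_mono)
    fix x :: real
    have 1: "(1 + x\<^sup>2) powr (- a) \<le> 1"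
      using powr_mono2'[of "-a" 1 "1 + x\<^sup>2"] a by simp
    have 2: "(1 + x\<^sup>2) powr (- a) \<le> ?h x" if "x \<ge> 1"
    proof -
      have "(1 + x\<^sup>2) powr (- a) \<le> (x\<^sup>2) powr (- a)"
        using that a by (intro powr_mono2') auto
      also have "(x\<^sup>2) powr (- a) = ?h x"
        using powr_powr[of x 2 "- a"] that by (simp add: powr_numeral)
      finally show ?thesis .
    qed
    consider "x < 0" | "0 \<le> x" "x < 1" | "1 \<le> x" by linarith
    then show "ennreal (norm (k x)) \<le> indicator {0..1} x + ennreal (?h x) * indicator {1..} x"
    proof cases
      case 2 then show ?thesis using 1 by (simp add: k_def ennreal_le_1)
    next
      case 3 then show ?thesis using 2 by (simp add: k_def add_increasing ennreal_leI)
    qed (simp add: k_def)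
  qed
  also have "\<dots> = (\<integral>\<^sup>+x. indicator {0..1} (x::real) \<partial>lborel) + (\<integral>\<^sup>+x. ennreal (?h x) * indicator {1..} x \<partial>lborel)"
    by (rule nn_integral_add) measurable
  also have "\<dots> < \<infinity>" using fin by simp
  finally have ki: "integrable lborel k" by (simp add: integrable_iff_bounded)
  have km: "integrable lborel (\<lambda>x. k (- x))"
    using lborel_integrable_real_affine[OF ki, of "-1" 0] by simp
  show ?thesis
  proof (rule Bochner_Integration.integrable_bound[OF Bochner_Integration.integrable_add[OF ki km]])
    show "AE x in lborel. norm ((1 + x\<^sup>2) powr (- a)) \<le> norm (k x + k (- x))"
      by (rule AE_I2) (auto simp: k_def indicator_def)
  qed measurable
qed

text \<open>In three dimensions the weight is dominated by a product of one-dimensional ones: \<open>1 + |\<xi>|\<^sup>2\<close> is at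
  least each \<open>1 + \<xi>\<^sub>j\<^sup>2\<close> and hence at least their geometric mean.\<close>

lemma integrable_bessel_weight:
  assumes s: "s > 3/2"
  shows "integrable lborel (\<lambda>\<xi>::real^3. (1 + (norm \<xi>)\<^sup>2) powr (- s))"
proof (rule Bochner_Integration.integrable_bound)
  show "integrable lborel (\<lambda>\<xi>::real^3. \<Prod>b\<in>Basis. (1 + (\<xi> \<bullet> b)\<^sup>2) powr (- (s / 3)))"
    by (rule integral_prod_Basis(1)[where f = "\<lambda>_ x. (1 + x\<^sup>2) powr (- (s / 3))"])
       (use integrable_bessel_weight_real[of "s / 3"] s in simp)
  show "AE \<xi>::real^3 in lborel. norm ((1 + (norm \<xi>)\<^sup>2) powr (- s)) \<le> norm (\<Prod>b\<in>Basis. (1 + (\<xi> \<bullet> b)\<^sup>2) powr (- (s / 3)))"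
  proof (rule AE_I2)
    fix \<xi> :: "real^3"
    have p: "1 + (norm \<xi>)\<^sup>2 > 0" by (simp add: add_pos_nonneg)
    have "(1 + (norm \<xi>)\<^sup>2) powr (- s) = ((1 + (norm \<xi>)\<^sup>2) powr (- (s / 3))) ^ card (Basis :: (real^3) set)"
      using p by (simp add: powr_power)
    also have "\<dots> = (\<Prod>b\<in>(Basis::(real^3) set). (1 + (norm \<xi>)\<^sup>2) powr (- (s / 3)))" by simp
    also have "\<dots> \<le> (\<Prod>b\<in>Basis. (1 + (\<xi> \<bullet> b)\<^sup>2) powr (- (s / 3)))"
    proof (intro prod_mono conjI)
      fix b :: "real^3" assume "b \<in> Basis"
      then have "(\<xi> \<bullet> b)\<^sup>2 \<le> (norm \<xi>)\<^sup>2" using Basis_le_norm[of b \<xi>] by (metis abs_le_square_iff abs_norm_cancel)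
      then show "(1 + (norm \<xi>)\<^sup>2) powr (- (s / 3)) \<le> (1 + (\<xi> \<bullet> b)\<^sup>2) powr (- (s / 3))"
        using s by (intro powr_mono2') (auto simp: add_pos_nonneg)
    qed simp
    finally show "norm ((1 + (norm \<xi>)\<^sup>2) powr (- s)) \<le> norm (\<Prod>b\<in>Basis. (1 + (\<xi> \<bullet> b)\<^sup>2) powr (- (s / 3)))"
      by (simp add: prod_nonneg)
  qed
qed measurable

lemma norm_cis_diff_le: "norm (cis a - cis b) \<le> \<bar>a - b\<bar>"
proof -
  have "cis a - cis b = cis b * (cis (a - b) - 1)" by (simp add: right_diff_distrib cis_mult)
  then have "norm (cis a - cis b) = norm (cis (a - b) - 1)" by (simp add: norm_mult)
  also have "\<dots> \<le> \<bar>a - b\<bar>" using iexp_approx1[of "a - b" 0] by (simp add: cis_conv_exp)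
  finally show ?thesis .
qed

text \<open>By the inversion formula the integral of \<open>(1 + |\<xi>|\<^sup>2)^(1/2)\<close> times the modulus of the transform bounds
  both the supremum and the Lipschitz constant. By Cauchy-Schwarz this integral is at most the Sobolev
  norm times the square root of the integral of \<open>(1 + |\<xi>|\<^sup>2)^(1 - m)\<close>, which is finite because
  \<open>m - 1 > 3/2\<close>.\<close>

lemma sobolev_embedding_scalar:
  fixes f :: "real^3 \<Rightarrow> real"
  defines "C \<equiv> \<lambda>m. fourier_const * sqrt (integral\<^sup>L lborel (\<lambda>\<xi>::real^3. (1 + (norm \<xi>)\<^sup>2) powr (- (m - 1))))"
  assumes m: "m > 5/2" and f: "L2 f" and c: "continuous_on UNIV f"
    and i: "integrable lborel (sobolev_density m f)"
  defines "N \<equiv> \<integral>\<xi>. sobolev_density m f \<xi> \<partial>lborel"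
  shows "L2sq f \<le> N" "\<bar>f x\<bar> \<le> C m * sqrt N" "\<bar>f x - f y\<bar> \<le> C m * sqrt N * norm (x - y)"
proof -
  let ?g = "fourier_L2 f"
  have F: "is_fourier_L2 f ?g" by (rule is_fourier_fourier_L2[OF f])
  have g: "L2 ?g" by (rule is_fourier_L2_D[OF f F])
  then have [measurable]: "?g \<in> borel_measurable borel" by (simp add: L2_def)
  let ?w = "\<lambda>\<xi>::real^3. 1 + (norm \<xi>)\<^sup>2"
  have w: "?w \<xi> > 0" "?w \<xi> \<ge> 1" for \<xi> by (simp_all add: add_pos_nonneg)
  define a where "a \<xi> = ?w \<xi> powr (m / 2) * norm (?g \<xi>)" for \<xi>
  define b where "b \<xi> = ?w \<xi> powr (- (m - 1) / 2)" for \<xi> :: "real^3"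
  have [measurable]: "a \<in> borel_measurable borel" "b \<in> borel_measurable borel"
    unfolding a_def b_def by measurable
  have a2: "(norm (a \<xi>))\<^sup>2 = sobolev_density m f \<xi>" for \<xi>
    using w(1)[of \<xi>] by (simp add: a_def sobolev_density_def power_mult_distrib powr_power)
  have b2: "(norm (b \<xi>))\<^sup>2 = ?w \<xi> powr (- (m - 1))" for \<xi>
    using w(1)[of \<xi>] by (simp add: b_def powr_power diff_divide_distrib)
  have La: "L2 a" "L2sq a = N" unfolding L2_def L2sq_def a2 N_def using i by auto
  have Lb: "L2 b" "fourier_const * sqrt (L2sq b) = C m"
    unfolding L2_def L2sq_def b2 C_def using integrable_bessel_weight[of "m - 1"] m by auto
  have ab: "a \<xi> * b \<xi> = ?w \<xi> powr (1/2) * norm (?g \<xi>)" for \<xi>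
  proof -
    have "?w \<xi> powr (m / 2) * ?w \<xi> powr (- (m - 1) / 2) = ?w \<xi> powr (m / 2 + - (m - 1) / 2)"
      using w by (simp add: powr_add)
    also have "m / 2 + - (m - 1) / 2 = 1/2" by (simp add: field_simps)
    finally show ?thesis by (simp add: a_def b_def mult.commute mult.left_commute)
  qed
  have abi: "integrable lborel (\<lambda>\<xi>. a \<xi> * b \<xi>)" by (rule L2_mult[OF La(1) Lb(1)])
  have abI: "fourier_const * (\<integral>\<xi>. a \<xi> * b \<xi> \<partial>lborel) \<le> C m * sqrt N"
  proof -
    have "(\<integral>\<xi>. a \<xi> * b \<xi> \<partial>lborel) \<le> sqrt N * sqrt (L2sq b)"
      using L2_Cauchy_Schwarz(2)[OF La(1) Lb(1)] La(2) by simp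
    then have "fourier_const * (\<integral>\<xi>. a \<xi> * b \<xi> \<partial>lborel) \<le> fourier_const * (sqrt N * sqrt (L2sq b))"
      using fourier_const_pos by (intro mult_left_mono) auto
    also have "\<dots> = (fourier_const * sqrt (L2sq b)) * sqrt N" by simp
    finally show ?thesis unfolding Lb(2) .
  qed
  have w1: "1 \<le> ?w \<xi> powr (1/2)" for \<xi> using w(2) by (simp add: ge_one_powr_ge_zero)
  have w2: "norm \<xi> \<le> ?w \<xi> powr (1/2)" for \<xi>
    using w(1)[of \<xi>] by (simp add: powr_half_sqrt real_le_rsqrt)
  have g1: "norm (?g \<xi>) \<le> a \<xi> * b \<xi>" and g2: "norm (?g \<xi>) * norm \<xi> \<le> a \<xi> * b \<xi>" for \<xi>
    unfolding ab using mult_right_mono[OF w1, of "norm (?g \<xi>)"] mult_right_mono[OF w2, of "norm (?g \<xi>)"]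
    by (simp_all add: mult.commute)
  have gi: "integrable lborel ?g"
    by (rule Bochner_Integration.integrable_bound[OF abi]) (use g1 in \<open>auto intro: order_trans[OF _ abs_ge_self]\<close>)
  have inv: "complex_of_real (f x) = of_real fourier_const * (\<integral>\<xi>. ?g \<xi> * cis (x \<bullet> \<xi>) \<partial>lborel)" for x
    using c by (intro fourier_inversion f F gi) (simp add: continuous_on_eq_continuous_at)
  have gci: "integrable lborel (\<lambda>\<xi>. ?g \<xi> * cis (x \<bullet> \<xi>))" for x
    by (rule Bochner_Integration.integrable_bound[OF gi]) (auto simp: norm_mult)
  have est: "norm (\<integral>\<xi>. h \<xi> \<partial>lborel) \<le> K * (\<integral>\<xi>. a \<xi> * b \<xi> \<partial>lborel)"
    if "integrable lborel h" "\<And>\<xi>. norm (h \<xi>) \<le> K * (a \<xi> * b \<xi>)" for h :: "real^3 \<Rightarrow> complex" and K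
  proof -
    have "norm (\<integral>\<xi>. h \<xi> \<partial>lborel) \<le> (\<integral>\<xi>. norm (h \<xi>) \<partial>lborel)" by simp
    also have "\<dots> \<le> (\<integral>\<xi>. K * (a \<xi> * b \<xi>) \<partial>lborel)" using that abi by (intro integral_mono) auto
    finally show ?thesis by simp
  qed
  have "\<bar>f x\<bar> = norm (complex_of_real (f x))" by simp
  also have "\<dots> = fourier_const * norm (\<integral>\<xi>. ?g \<xi> * cis (x \<bullet> \<xi>) \<partial>lborel)" unfolding inv using fourier_const_pos by (simp add: norm_mult)
  also have "\<dots> \<le> fourier_const * (1 * (\<integral>\<xi>. a \<xi> * b \<xi> \<partial>lborel))"
    using fourier_const_pos g1 by (intro mult_left_mono est gci) (auto simp: norm_mult)
  finally show "\<bar>f x\<bar> \<le> C m * sqrt N" using abI by simp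
  have "\<bar>f x - f y\<bar> = norm (complex_of_real (f x) - complex_of_real (f y))" by (simp flip: of_real_diff)
  also have "\<dots> = fourier_const * norm (\<integral>\<xi>. ?g \<xi> * cis (x \<bullet> \<xi>) - ?g \<xi> * cis (y \<bullet> \<xi>) \<partial>lborel)"
    unfolding inv unfolding Bochner_Integration.integral_diff[OF gci gci]
    unfolding right_diff_distrib[symmetric] using fourier_const_pos by (simp add: norm_mult)
  also have "\<dots> \<le> fourier_const * (norm (x - y) * (\<integral>\<xi>. a \<xi> * b \<xi> \<partial>lborel))"
  proof (intro mult_left_mono est Bochner_Integration.integrable_diff gci)
    fix \<xi>
    have "norm (cis (x \<bullet> \<xi>) - cis (y \<bullet> \<xi>)) \<le> norm (x - y) * norm \<xi>"
      using norm_cis_diff_le[of "x \<bullet> \<xi>" "y \<bullet> \<xi>"] Cauchy_Schwarz_ineq2[of "x - y" \<xi>]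
      by (simp add: inner_diff_left)
    then have "norm (?g \<xi>) * norm (cis (x \<bullet> \<xi>) - cis (y \<bullet> \<xi>)) \<le> norm (?g \<xi>) * (norm (x - y) * norm \<xi>)"
      by (rule mult_left_mono) simp
    also have "\<dots> \<le> norm (x - y) * (a \<xi> * b \<xi>)"
      using mult_left_mono[OF g2[of \<xi>], of "norm (x - y)"] by (simp add: ac_simps)
    finally show "norm (?g \<xi> * cis (x \<bullet> \<xi>) - ?g \<xi> * cis (y \<bullet> \<xi>)) \<le> norm (x - y) * (a \<xi> * b \<xi>)"
      by (simp add: right_diff_distrib[symmetric] norm_mult)
  qed (use fourier_const_pos in simp)
  also have "\<dots> = fourier_const * (\<integral>\<xi>. a \<xi> * b \<xi> \<partial>lborel) * norm (x - y)" by simp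
  finally show "\<bar>f x - f y\<bar> \<le> C m * sqrt N * norm (x - y)"
    using mult_right_mono[OF abI, of "norm (x - y)"] by simp
  have "L2sq f \<le> L2sq ?g" by (rule plancherel_le[OF f c F gi])
  also have "\<dots> \<le> 1\<^sup>2 * L2sq a"
  proof (rule L2_mono(2)[OF La(1)])
    fix \<xi>
    have "1 \<le> ?w \<xi> powr (m / 2)" using w(2) m by (simp add: ge_one_powr_ge_zero)
    from mult_right_mono[OF this, of "norm (?g \<xi>)"]
    show "norm (?g \<xi>) \<le> 1 * norm (a \<xi>)" by (simp add: a_def abs_mult)
  qed measurable
  finally show "L2sq f \<le> N" using La(2) by simp
qed


lemma L2_component:
  fixes f :: "real^3 \<Rightarrow> 'b::euclidean_space"
  assumes "L2 f" "b \<in> Basis" shows "L2 (\<lambda>x. f x \<bullet> b)"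
proof -
  have [measurable]: "f \<in> borel_measurable borel" using assms by (simp add: L2_def)
  show ?thesis by (rule L2_mono(1)[OF assms(1), where c = 1]) (use Basis_le_norm[OF assms(2)] in auto)
qed

lemma L2sq_components:
  fixes f :: "real^3 \<Rightarrow> 'b::euclidean_space"
  assumes "L2 f" shows "L2sq f = (\<Sum>b\<in>Basis. L2sq (\<lambda>x. f x \<bullet> b))"
  unfolding L2sq_def norm_sq_Basis[of "f _"]
  using L2_component[OF assms] by (subst Bochner_Integration.integral_sum) (auto simp: L2_def)

text \<open>The norms that drive the energy argument: square integrability, boundedness and Lipschitz
  continuity, all controlled by one constant.\<close>

definition L2_Lip_bound :: "real \<Rightarrow> (real^3 \<Rightarrow> 'b::euclidean_space) \<Rightarrow> bool" where
  "L2_Lip_bound K f \<longleftrightarrow> L2 f \<and> L2sq f \<le> K\<^sup>2 \<and> (\<forall>x. norm (f x) \<le> K) \<and>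
     (\<forall>x y. norm (f x - f y) \<le> K * norm (x - y))"

lemma sobolev_L2: "f \<in> sobolev m \<Longrightarrow> L2 f"
  by (simp add: sobolev_def Lp_2_iff_L2)

lemma sobolev_embedding:
  assumes m: "m > 5/2"
  obtains C where "C \<ge> 1" "\<And>f :: real^3 \<Rightarrow> 'b::euclidean_space. f \<in> sobolev m \<Longrightarrow> continuous_on UNIV f \<Longrightarrow>
    L2_Lip_bound (C * sobolev_norm m f) f"
proof
  define C where "C = fourier_const * sqrt (integral\<^sup>L lborel (\<lambda>\<xi>::real^3. (1 + (norm \<xi>)\<^sup>2) powr (- (m - 1))))"
  have C: "C \<ge> 0" unfolding C_def using fourier_const_pos by simp
  show "max 1 C \<ge> 1" by simp
  fix f :: "real^3 \<Rightarrow> 'b" assume f: "f \<in> sobolev m" and c: "continuous_on UNIV f"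
  define N where "N b = (\<integral>\<xi>. sobolev_density m (\<lambda>x. f x \<bullet> b) \<xi> \<partial>lborel)" for b
  have N0: "N b \<ge> 0" for b unfolding N_def by (simp add: sobolev_density_def)
  have S2: "(sobolev_norm m f)\<^sup>2 = (\<Sum>b\<in>Basis. N b)"
    unfolding sobolev_norm_def N_def[symmetric] by (simp add: N0 sum_nonneg)
  have S0: "sobolev_norm m f \<ge> 0"
    unfolding sobolev_norm_def N_def[symmetric] by (simp add: N0 sum_nonneg)
  have L: "L2 f" by (rule sobolev_L2[OF f])
  note E = sobolev_embedding_scalar[OF m L2_component[OF L] continuous_on_inner[OF c continuous_on_const], folded C_def N_def]
  have i: "integrable lborel (sobolev_density m (\<lambda>x. f x \<bullet> b))" if "b \<in> Basis" for b
    using f that by (simp add: sobolev_def)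
  have "L2sq f \<le> (\<Sum>b\<in>Basis. N b)"
    unfolding L2sq_components[OF L] by (intro sum_mono E(1) i)
  also have "\<dots> = (1 * sobolev_norm m f)\<^sup>2" by (simp add: S2)
  also have "\<dots> \<le> (max 1 C * sobolev_norm m f)\<^sup>2"
    using S0 by (intro power_mono mult_right_mono) auto
  finally have 1: "L2sq f \<le> (max 1 C * sobolev_norm m f)\<^sup>2" .
  have sq: "norm v \<le> max 1 C * sobolev_norm m f * r"
    if "r \<ge> 0" "\<And>b. b \<in> Basis \<Longrightarrow> \<bar>v \<bullet> b\<bar> \<le> C * sqrt (N b) * r" for v :: 'b and r
  proof -
    have "(norm v)\<^sup>2 \<le> (\<Sum>b\<in>Basis. (C * r)\<^sup>2 * N b)"
      unfolding norm_sq_Basis[of v]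
    proof (rule sum_mono)
      fix b :: 'b assume "b \<in> Basis"
      from power_mono[OF that(2)[OF this], of 2]
      show "(v \<bullet> b)\<^sup>2 \<le> (C * r)\<^sup>2 * N b" by (simp add: power_mult_distrib N0 ac_simps)
    qed
    also have "\<dots> = (C * sobolev_norm m f * r)\<^sup>2"
      unfolding sum_distrib_left[symmetric] S2[symmetric] by (simp add: power_mult_distrib ac_simps)
    finally have "norm v \<le> C * sobolev_norm m f * r"
      by (rule power2_le_imp_le) (use C S0 that(1) in simp)
    also have "\<dots> \<le> max 1 C * sobolev_norm m f * r"
      using S0 that(1) by (intro mult_right_mono) auto
    finally show ?thesis .
  qed
  show "L2_Lip_bound (max 1 C * sobolev_norm m f) f"
    unfolding L2_Lip_bound_def
  proof (intro conjI allI L 1)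
    fix x y
    show "norm (f x) \<le> max 1 C * sobolev_norm m f"
      using sq[of 1 "f x"] E(2)[OF _ i] by simp
    show "norm (f x - f y) \<le> max 1 C * sobolev_norm m f * norm (x - y)"
      using sq[of "norm (x - y)" "f x - f y"] E(3)[OF _ i] by (simp add: inner_diff_left)
  qed
qed

lemma sobolev_diff:
  fixes f h :: "real^3 \<Rightarrow> 'b::euclidean_space"
  assumes f: "f \<in> sobolev m" and h: "h \<in> sobolev m"
  shows "(\<lambda>x. f x - h x) \<in> sobolev m"
proof -
  have Lf: "L2 f" and Lh: "L2 h" using f h by (auto intro: sobolev_L2)
  show ?thesis unfolding sobolev_def Lp_2_iff_L2
  proof (intro CollectI conjI ballI L2_diff Lf Lh)
    fix b :: 'b assume b: "b \<in> Basis"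
    let ?f = "\<lambda>x. f x \<bullet> b" and ?h = "\<lambda>x. h x \<bullet> b"
    have L: "L2 ?f" "L2 ?h" "L2 (\<lambda>x. ?f x - ?h x)" using L2_component[OF Lf b] L2_component[OF Lh b]
      by (auto intro: L2_diff)
    have [measurable]: "fourier_L2 (\<lambda>x. ?f x - ?h x) \<in> borel_measurable borel"
      using is_fourier_L2_D(1)[OF L(3) is_fourier_fourier_L2[OF L(3)]] by (simp add: L2_def)
    have i: "integrable lborel (sobolev_density m ?f)" "integrable lborel (sobolev_density m ?h)"
      using f h b by (auto simp: sobolev_def)
    have "integrable lborel (sobolev_density m (\<lambda>x. ?f x - ?h x))"
    proof (rule Bochner_Integration.integrable_bound)
      show "integrable lborel (\<lambda>\<xi>. 2 * sobolev_density m ?f \<xi> + 2 * sobolev_density m ?h \<xi>)"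
        using i by simp
      show "sobolev_density m (\<lambda>x. ?f x - ?h x) \<in> borel_measurable lborel"
        unfolding sobolev_density_def by measurable
      show "AE \<xi> in lborel. norm (sobolev_density m (\<lambda>x. ?f x - ?h x) \<xi>)
          \<le> norm (2 * sobolev_density m ?f \<xi> + 2 * sobolev_density m ?h \<xi>)"
        using fourier_L2_diff_AE[OF L(1,2)]
      proof eventually_elim
        case (elim \<xi>)
        have "(norm (fourier_L2 ?f \<xi> - fourier_L2 ?h \<xi>))\<^sup>2 \<le> 2 * (norm (fourier_L2 ?f \<xi>))\<^sup>2 + 2 * (norm (fourier_L2 ?h \<xi>))\<^sup>2"
          using norm_add_sq_le[of "fourier_L2 ?f \<xi>" "- fourier_L2 ?h \<xi>"] by simp
        from mult_left_mono[OF this, of "(1 + (norm \<xi>)\<^sup>2) powr m"]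
        show ?case unfolding sobolev_density_def elim by (simp add: algebra_simps)
      qed
    qed
    then show "integrable lborel (sobolev_density m (\<lambda>x. (f x - h x) \<bullet> b))"
      by (simp add: inner_diff_left)
  qed
qed

lemma L2_Lip_bound_mono:
  assumes "L2_Lip_bound K f" "K \<le> K'" shows "L2_Lip_bound K' f"
proof -
  have K: "0 \<le> K" using assms(1) norm_ge_zero order_trans unfolding L2_Lip_bound_def by blast
  have "K\<^sup>2 \<le> K'\<^sup>2" using assms(2) K by (intro power_mono)
  moreover have "K * norm (x - y) \<le> K' * norm (x - y)" for x y :: "real^3"
    using assms(2) by (rule mult_right_mono) simp
  ultimately show ?thesis
    using assms unfolding L2_Lip_bound_def by (blast intro: order_trans)
qed

lemma L2_Lip_bound_add:
  assumes f: "L2_Lip_bound K f" and h: "L2_Lip_bound K' h"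
  shows "L2_Lip_bound (2 * K + 2 * K') (\<lambda>x. f x + h x)"
proof -
  have K: "0 \<le> K" "0 \<le> K'"
    using f h norm_ge_zero order_trans unfolding L2_Lip_bound_def by blast+
  have "L2sq (\<lambda>x. f x + h x) \<le> 2 * K\<^sup>2 + 2 * K'\<^sup>2"
    using L2_add(2)[of f h] f h unfolding L2_Lip_bound_def by force
  also have "\<dots> \<le> (2 * K + 2 * K')\<^sup>2" using K by (simp add: power2_sum power_mult_distrib)
  finally have 1: "L2sq (\<lambda>x. f x + h x) \<le> (2 * K + 2 * K')\<^sup>2" .
  have 2: "norm (f x + h x) \<le> 2 * K + 2 * K'" for x
  proof -
    have "norm (f x + h x) \<le> K + K'" using f h unfolding L2_Lip_bound_def by (blast intro: norm_triangle_mono)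
    then show ?thesis using K by simp
  qed
  have 3: "norm (f x + h x - (f y + h y)) \<le> (2 * K + 2 * K') * norm (x - y)" for x y
  proof -
    have "norm (f x + h x - (f y + h y)) = norm ((f x - f y) + (h x - h y))" by (simp add: algebra_simps)
    also have "\<dots> \<le> K * norm (x - y) + K' * norm (x - y)"
      using f h unfolding L2_Lip_bound_def by (blast intro: norm_triangle_mono)
    also have "\<dots> \<le> (2 * K + 2 * K') * norm (x - y)" using K by (simp add: algebra_simps)
    finally show ?thesis .
  qed
  show ?thesis using f h 1 2 3 unfolding L2_Lip_bound_def by (auto intro: L2_add)
qed

text \<open>Near each time the function \<open>u \<tau>\<close> differs from its value at that time by a function of Sobolev norm below \<open>1\<close>; the
  compactness of \<open>[0, b]\<close> makes the resulting local bounds uniform.\<close>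

lemma continuous_sobolev_bounded:
  fixes u :: "real \<Rightarrow> real^3 \<Rightarrow> 'b::euclidean_space"
  assumes m: "m > 5/2" and u: "continuous_sobolev {0..<T} m u"
    and c: "\<And>t. t \<in> {0..<T} \<Longrightarrow> continuous_on UNIV (u t)" and b: "b < T"
  obtains K where "\<And>t. t \<in> {0..b} \<Longrightarrow> L2_Lip_bound K (u t)"
proof -
  obtain C where C: "C \<ge> 1" and emb: "\<And>f :: real^3 \<Rightarrow> 'b. f \<in> sobolev m \<Longrightarrow> continuous_on UNIV f \<Longrightarrow>
      L2_Lip_bound (C * sobolev_norm m f) f"
    by (rule sobolev_embedding[OF m, where 'b = 'b]) blast
  have us: "u t \<in> sobolev m" if "t \<in> {0..<T}" for t using u that by (auto simp: continuous_sobolev_def)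
  have "\<exists>d>0. \<exists>K. \<forall>\<tau>\<in>{0..b}. dist \<tau> t < d \<longrightarrow> L2_Lip_bound K (u \<tau>)" if t: "t \<in> {0..b}" for t
  proof -
    have tT: "t \<in> {0..<T}" using t b by auto
    have "((\<lambda>\<tau>. sobolev_norm m (\<lambda>x. u \<tau> x - u t x)) \<longlongrightarrow> 0) (at t within {0..<T})"
      using u tT by (auto simp: continuous_sobolev_def)
    then have "\<forall>\<^sub>F \<tau> in at t within {0..<T}. sobolev_norm m (\<lambda>x. u \<tau> x - u t x) < 1"
      by (rule order_tendstoD(2)) simp
    then obtain d where d: "d > 0"
      and d1: "\<And>\<tau>. \<tau> \<in> {0..<T} \<Longrightarrow> \<tau> \<noteq> t \<Longrightarrow> dist \<tau> t < d \<Longrightarrow> sobolev_norm m (\<lambda>x. u \<tau> x - u t x) < 1"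
      unfolding eventually_at by auto
    let ?K = "2 * (C * sobolev_norm m (u t)) + 2 * C"
    have B: "L2_Lip_bound (C * sobolev_norm m (u t)) (u t)" by (intro emb us c tT)
    then have S0: "0 \<le> C * sobolev_norm m (u t)"
      using norm_ge_zero order_trans unfolding L2_Lip_bound_def by blast
    have "L2_Lip_bound ?K (u \<tau>)" if \<tau>: "\<tau> \<in> {0..b}" "dist \<tau> t < d" for \<tau>
    proof (cases "\<tau> = t")
      case True
      then show ?thesis using L2_Lip_bound_mono[OF B, of ?K] S0 C by simp
    next
      case False
      have \<tau>T: "\<tau> \<in> {0..<T}" using \<tau> b by auto
      have "L2_Lip_bound (C * sobolev_norm m (\<lambda>x. u \<tau> x - u t x)) (\<lambda>x. u \<tau> x - u t x)"
        by (intro emb sobolev_diff us \<tau>T tT continuous_on_diff c)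
      then have "L2_Lip_bound C (\<lambda>x. u \<tau> x - u t x)"
        by (rule L2_Lip_bound_mono) (use d1[OF \<tau>T False \<tau>(2)] C in \<open>simp add: mult_left_le\<close>)
      from L2_Lip_bound_add[OF B this] show ?thesis by simp
    qed
    with d show ?thesis by blast
  qed
  then obtain d K where dK: "\<And>t. t \<in> {0..b} \<Longrightarrow> d t > 0"
    "\<And>t \<tau>. t \<in> {0..b} \<Longrightarrow> \<tau> \<in> {0..b} \<Longrightarrow> dist \<tau> t < d t \<Longrightarrow> L2_Lip_bound (K t) (u \<tau>)"
    by metis
  obtain D where D: "D \<subseteq> {0..b}" "finite D" "{0..b} \<subseteq> (\<Union>t\<in>D. ball t (d t))"
  proof (rule compactE_image[of "{0..b}" "{0..b}" "\<lambda>t. ball t (d t)"])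
    show "{0..b} \<subseteq> (\<Union>t\<in>{0..b}. ball t (d t))" using dK(1) by force
  qed auto
  have "L2_Lip_bound (\<Sum>t\<in>D. \<bar>K t\<bar>) (u \<tau>)" if \<tau>: "\<tau> \<in> {0..b}" for \<tau>
  proof -
    obtain t where t: "t \<in> D" "dist \<tau> t < d t" using D(3) \<tau> by (auto simp: dist_commute)
    have "K t \<le> \<bar>K t\<bar>" by simp
    also have "\<dots> \<le> (\<Sum>t\<in>D. \<bar>K t\<bar>)" using D(2) t(1) by (intro member_le_sum) auto
    finally show ?thesis using dK(2)[of t \<tau>] D(1) t \<tau> by (blast intro: L2_Lip_bound_mono)
  qed
  then show ?thesis by (rule that)
qed

lemma fourier_L2_zero: "AE \<xi> in lborel. fourier_L2 (\<lambda>x. 0) \<xi> = 0"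
proof -
  have "L2 (\<lambda>x::real^3. 0::real)" by (simp add: L2_def)
  from fourier_L2_diff_AE[OF this this] show ?thesis by simp
qed

lemma sobolev_zero: "(\<lambda>x. 0) \<in> sobolev m" "sobolev_norm m (\<lambda>x. 0) = 0"
proof -
  have L: "L2 (\<lambda>x::real^3. 0::real)" by (simp add: L2_def)
  have [measurable]: "fourier_L2 (\<lambda>x. 0) \<in> borel_measurable borel"
    using is_fourier_L2_D(1)[OF L is_fourier_fourier_L2[OF L]] by (simp add: L2_def)
  have z: "AE \<xi> in lborel. sobolev_density m (\<lambda>x. 0) \<xi> = 0"
    using fourier_L2_zero by eventually_elim (simp add: sobolev_density_def)
  have [measurable]: "sobolev_density m (\<lambda>x. 0) \<in> borel_measurable lborel"
    unfolding sobolev_density_def by measurable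
  have "integrable lborel (sobolev_density m (\<lambda>x. 0)) = integrable lborel (\<lambda>x::real^3. 0::real)"
    using z by (intro integrable_cong_AE) auto
  then show "(\<lambda>x. 0) \<in> sobolev m"
    unfolding sobolev_def Lp_2_iff_L2 by (simp add: L2_def)
  have "(\<integral>\<xi>. sobolev_density m (\<lambda>x. 0) \<xi> \<partial>lborel) = integral\<^sup>L lborel (\<lambda>x::real^3. 0::real)"
    using z by (intro integral_cong_AE) auto
  then show "sobolev_norm m (\<lambda>x. 0) = 0" unfolding sobolev_norm_def by simp
qed

section \<open>The divergence theorem on the whole space\<close>

text \<open>Differentiability along one coordinate axis only: this is all that the divergence theorem below uses, and it
  gives the product rule without total derivatives.\<close>

definition has_pd :: "3 \<Rightarrow> (real^3 \<Rightarrow> real) \<Rightarrow> (real^3 \<Rightarrow> real) \<Rightarrow> bool" where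
  "has_pd j f D \<longleftrightarrow> (\<forall>x. ((\<lambda>s. f (x + s *\<^sub>R axis j 1)) has_real_derivative D x) (at 0))"

lemma has_pd_at:
  assumes "has_pd j f D"
  shows "((\<lambda>s. f (x + s *\<^sub>R axis j 1)) has_real_derivative D (x + s *\<^sub>R axis j 1)) (at s)"
proof -
  have "((\<lambda>r. f (x + s *\<^sub>R axis j 1 + r *\<^sub>R axis j 1)) has_real_derivative D (x + s *\<^sub>R axis j 1)) (at 0)"
    using assms unfolding has_pd_def by blast
  then have "((\<lambda>r. f (x + (r + s) *\<^sub>R axis j 1)) has_real_derivative D (x + s *\<^sub>R axis j 1)) (at 0)"
    by (simp add: scaleR_add_left add_ac)
  then show ?thesis
    using DERIV_shift[of "\<lambda>s. f (x + s *\<^sub>R axis j 1)" "D (x + s *\<^sub>R axis j 1)" 0 s] by simp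
qed

lemma has_pd_mult:
  assumes "has_pd j f D" "has_pd j g E"
  shows "has_pd j (\<lambda>x. f x * g x) (\<lambda>x. D x * g x + f x * E x)"
  unfolding has_pd_def
proof
  fix x
  have "((\<lambda>s. f (x + s *\<^sub>R axis j 1)) has_real_derivative D x) (at 0)"
    "((\<lambda>s. g (x + s *\<^sub>R axis j 1)) has_real_derivative E x) (at 0)" using assms by (auto simp: has_pd_def)
  from DERIV_mult[OF this]
  show "((\<lambda>s. f (x + s *\<^sub>R axis j 1) * g (x + s *\<^sub>R axis j 1)) has_real_derivative (D x * g x + f x * E x)) (at 0)"
    by (simp add: add.commute mult.commute)
qed

lemma has_pd_add:
  assumes "has_pd j f D" "has_pd j g E"
  shows "has_pd j (\<lambda>x. f x + g x) (\<lambda>x. D x + E x)"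
  using assms unfolding has_pd_def by (auto intro: DERIV_add)

lemma has_pd_diff:
  assumes "has_pd j f D" "has_pd j g E"
  shows "has_pd j (\<lambda>x. f x - g x) (\<lambda>x. D x - E x)"
  using assms unfolding has_pd_def by (auto intro: DERIV_diff)

lemma has_pd_cmult:
  assumes "has_pd j f D"
  shows "has_pd j (\<lambda>x. c * f x) (\<lambda>x. c * D x)"
  using assms unfolding has_pd_def by (auto intro: DERIV_cmult)

lemma has_pd_sum:
  assumes "\<And>i. i \<in> I \<Longrightarrow> has_pd j (f i) (D i)"
  shows "has_pd j (\<lambda>x. \<Sum>i\<in>I. f i x) (\<lambda>x. \<Sum>i\<in>I. D i x)"
  using assms unfolding has_pd_def by (auto intro: DERIV_sum)

lemma has_pd_translate:
  assumes "has_pd j f D" shows "has_pd j (\<lambda>x. f (x + a)) (\<lambda>x. D (x + a))"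
  unfolding has_pd_def
proof
  fix x
  have "((\<lambda>s. f (x + a + s *\<^sub>R axis j 1)) has_real_derivative D (x + a)) (at 0)"
    using assms unfolding has_pd_def by blast
  then show "((\<lambda>s. f (x + s *\<^sub>R axis j 1 + a)) has_real_derivative D (x + a)) (at 0)"
    by (simp add: add_ac)
qed

lemma integral_pd_line:
  assumes pd: "has_pd j f D" and D: "continuous_on UNIV D" and c: "0 \<le> c"
  shows "(\<integral>s. indicator {0..c} s * D (x + s *\<^sub>R axis j 1) \<partial>lborel) = f (x + c *\<^sub>R axis j 1) - f x"
proof -
  have cD: "continuous_on {0..c} (\<lambda>s. D (x + s *\<^sub>R axis j 1))"
    by (rule continuous_on_compose2[OF D]) (auto intro!: continuous_intros)
  have "(\<integral>s. indicator {0..c} s *\<^sub>R D (x + s *\<^sub>R axis j 1) \<partial>lborel)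
      = f (x + c *\<^sub>R axis j 1) - f (x + 0 *\<^sub>R axis j 1)"
    by (rule integral_FTC_Icc[OF c _ cD])
       (use has_pd_at[OF pd] in \<open>auto simp: has_real_derivative_iff_has_vector_derivative
          intro: has_vector_derivative_at_within\<close>)
  then show ?thesis by simp
qed

text \<open>The integral of a derivative vanishes by translation invariance of Lebesgue measure:
  \<open>f (x + e) - f x\<close> is the integral of the derivative over the unit segment from \<open>x\<close> to \<open>x + e\<close>.\<close>

lemma integral_pd_eq_0:
  assumes pd: "has_pd j f D" and D: "continuous_on UNIV D"
    and fi: "integrable lborel f" and Di: "integrable lborel D"
  shows "(\<integral>x. D x \<partial>lborel) = 0"
proof -
  have [measurable]: "D \<in> borel_measurable borel" "f \<in> borel_measurable borel" using fi Di by auto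
  let ?k = "\<lambda>s x. indicator {0..1} s * D (x + s *\<^sub>R axis j 1) :: real"
  have tr: "integrable lborel (\<lambda>x. D (x + a))" for a by (rule integrable_translate[OF Di])
  have trI: "(\<integral>x. D (x + a) \<partial>lborel) = (\<integral>x. D x \<partial>lborel)"
    "(\<integral>x. \<bar>D (x + a)\<bar> \<partial>lborel) = (\<integral>x. \<bar>D x\<bar> \<partial>lborel)"
    "(\<integral>x. f (x + a) \<partial>lborel) = (\<integral>x. f x \<partial>lborel)" for a
    using integral_translate[of D a] integral_translate[of "\<lambda>x. \<bar>D x\<bar>" a] integral_translate[of f a] by simp_all
  have ind: "integrable lborel (\<lambda>s::real. indicator {0..1} s * c)" for c :: real
    using borel_integrable_compact[of "{0..1::real}" "\<lambda>_. c"] by simp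
  have "integrable (lborel \<Otimes>\<^sub>M lborel) (\<lambda>(s, x). ?k s x)"
  proof (rule lborel_pair.Fubini_integrable)
    show "(\<lambda>(s, x). ?k s x) \<in> borel_measurable (lborel \<Otimes>\<^sub>M lborel)" by measurable
    show "integrable lborel (\<lambda>s. \<integral>x. norm (case (s, x) of (s, x) \<Rightarrow> ?k s x) \<partial>lborel)"
      using ind[of "\<integral>x. \<bar>D x\<bar> \<partial>lborel"] by (simp add: abs_mult trI)
    show "AE s in lborel. integrable lborel (\<lambda>x. case (s, x) of (s, x) \<Rightarrow> ?k s x)" using tr by simp
  qed
  from lborel_pair.Fubini_integral[OF this]
  have "(\<integral>x. (\<integral>s. ?k s x \<partial>lborel) \<partial>lborel) = (\<integral>s. (\<integral>x. ?k s x \<partial>lborel) \<partial>lborel)" .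
  also have "(\<integral>s. (\<integral>x. ?k s x \<partial>lborel) \<partial>lborel) = (\<integral>x. D x \<partial>lborel)"
    by (simp add: trI mult.commute)
  also have "(\<integral>x. (\<integral>s. ?k s x \<partial>lborel) \<partial>lborel) = (\<integral>x. f (x + axis j 1) - f x \<partial>lborel)"
    using integral_pd_line[OF pd D, of 1] by simp
  also have "\<dots> = 0"
    using integrable_translate[OF fi] fi by (simp add: Bochner_Integration.integral_diff trI)
  finally show ?thesis by simp
qed

text \<open>A continuously differentiable bump supported in the ball of radius \<open>R\<close> with gradient of size \<open>1 / R\<close>. The
  square makes the positive part differentiable.\<close>

definition cutoff :: "real \<Rightarrow> real^3 \<Rightarrow> real" where
  "cutoff R x = (max 0 (1 - (norm x)\<^sup>2 / R\<^sup>2))\<^sup>2"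

definition cutoff_pd :: "real \<Rightarrow> 3 \<Rightarrow> real^3 \<Rightarrow> real" where
  "cutoff_pd R j x = - (4 * (x $ j) / R\<^sup>2) * max 0 (1 - (norm x)\<^sup>2 / R\<^sup>2)"

lemma DERIV_pos_part_sq: "((\<lambda>y::real. (max 0 y)\<^sup>2) has_real_derivative 2 * max 0 y) (at y)"
proof -
  consider "y > 0" | "y < 0" | "y = 0" by linarith
  then show ?thesis
  proof cases
    case 1
    have d: "((\<lambda>y. y\<^sup>2) has_real_derivative 2 * y) (at y)" by (auto intro!: derivative_eq_intros)
    have "\<forall>\<^sub>F z in nhds y. z\<^sup>2 = (max 0 z)\<^sup>2"
      using eventually_nhds_in_open[of "{0<..}" y] 1 by (auto elim!: eventually_mono)
    from DERIV_cong_ev[THEN iffD1, OF refl this refl d] show ?thesis using 1 by simp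
  next
    case 2
    have d: "((\<lambda>y::real. 0::real) has_real_derivative 0) (at y)" by simp
    have "\<forall>\<^sub>F z in nhds y. 0 = (max 0 z)\<^sup>2"
      using eventually_nhds_in_open[of "{..<0}" y] 2 by (auto elim!: eventually_mono)
    from DERIV_cong_ev[THEN iffD1, OF refl this refl d] show ?thesis using 2 by simp
  next
    case 3
    have "((\<lambda>h. (max 0 h)\<^sup>2 / h) \<longlongrightarrow> 0) (at (0::real))"
    proof (rule Lim_null_comparison)
      show "\<forall>\<^sub>F h in at 0. norm ((max 0 h)\<^sup>2 / h) \<le> \<bar>h\<bar>" 
        by (intro always_eventually allI) (auto simp: max_def power2_eq_square)
      show "((\<lambda>h::real. \<bar>h\<bar>) \<longlongrightarrow> 0) (at 0)" by (intro tendsto_rabs_zero tendsto_ident_at)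
    qed
    then show ?thesis using 3 by (simp add: DERIV_def)
  qed
qed

lemma cutoff_facts:
  assumes R: "R > 0"
  shows "has_pd j (cutoff R) (cutoff_pd R j)"
    and "continuous_on UNIV (cutoff R)" "continuous_on UNIV (cutoff_pd R j)"
    and "0 \<le> cutoff R x" "cutoff R x \<le> 1"
    and "x \<notin> cball 0 R \<Longrightarrow> cutoff R x = 0" "x \<notin> cball 0 R \<Longrightarrow> cutoff_pd R j x = 0"
    and "\<bar>cutoff_pd R j x\<bar> \<le> 4 / R"
proof -
  show "has_pd j (cutoff R) (cutoff_pd R j)" unfolding has_pd_def
  proof
    fix x :: "real^3"
    let ?q = "\<lambda>s. 1 - (norm (x + s *\<^sub>R axis j 1))\<^sup>2 / R\<^sup>2"
    have q: "?q s = 1 - ((norm x)\<^sup>2 + 2 * s * (x $ j) + s\<^sup>2) / R\<^sup>2" for s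
      unfolding power2_norm_eq_inner
      by (simp add: inner_add_left inner_add_right inner_axis inner_axis' power2_eq_square algebra_simps)
    have "(?q has_real_derivative - (2 * (x $ j)) / R\<^sup>2) (at 0)"
      unfolding q using R by (auto intro!: derivative_eq_intros simp: field_simps power2_eq_square)
    from DERIV_chain2[where f = "\<lambda>y. (max 0 y)\<^sup>2" and g = ?q, OF DERIV_pos_part_sq this]
    show "((\<lambda>s. cutoff R (x + s *\<^sub>R axis j 1)) has_real_derivative cutoff_pd R j x) (at 0)"
      unfolding cutoff_def cutoff_pd_def by (simp add: ac_simps)
  qed
  show "continuous_on UNIV (cutoff R)" unfolding cutoff_def by (intro continuous_intros) (use R in auto)
  show "continuous_on UNIV (cutoff_pd R j)" unfolding cutoff_pd_def by (intro continuous_intros) (use R in auto)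
  show "0 \<le> cutoff R x" by (simp add: cutoff_def)
  have m: "0 \<le> max 0 (1 - (norm x)\<^sup>2 / R\<^sup>2)" "max 0 (1 - (norm x)\<^sup>2 / R\<^sup>2) \<le> 1" by auto
  show "cutoff R x \<le> 1" unfolding cutoff_def by (rule power_le_one[OF m])
  have out: "max 0 (1 - (norm x)\<^sup>2 / R\<^sup>2) = 0" if "x \<notin> cball 0 R"
  proof -
    have "R\<^sup>2 \<le> (norm x)\<^sup>2" using that R by (intro power_mono) auto
    then show ?thesis using R by simp
  qed
  show "x \<notin> cball 0 R \<Longrightarrow> cutoff R x = 0" "x \<notin> cball 0 R \<Longrightarrow> cutoff_pd R j x = 0"
    using out by (auto simp: cutoff_def cutoff_pd_def)
  show "\<bar>cutoff_pd R j x\<bar> \<le> 4 / R"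
  proof (cases "x \<in> cball 0 R")
    case True
    then have "\<bar>x $ j\<bar> \<le> R" using component_le_norm_cart[of x j] by simp
    have "\<bar>cutoff_pd R j x\<bar> = 4 * \<bar>x $ j\<bar> / R\<^sup>2 * max 0 (1 - (norm x)\<^sup>2 / R\<^sup>2)"
      unfolding cutoff_pd_def using m(1) by (simp add: abs_mult)
    also have "\<dots> \<le> 4 * R / R\<^sup>2 * 1"
      using \<open>\<bar>x $ j\<bar> \<le> R\<close> m R by (intro mult_mono divide_right_mono mult_left_mono) auto
    finally show ?thesis using R by (simp add: power2_eq_square)
  next
    case False
    then show ?thesis using out R by (simp add: cutoff_pd_def)
  qed
qed

lemma integrable_compact_support:
  fixes f :: "real^3 \<Rightarrow> real"
  assumes "continuous_on UNIV f" "\<And>x. x \<notin> cball 0 R \<Longrightarrow> f x = 0"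
  shows "integrable lborel f"
proof -
  have "integrable lborel (\<lambda>x. indicator (cball 0 R) x *\<^sub>R f x)"
    by (rule borel_integrable_compact) (use assms(1) continuous_on_subset in auto)
  also have "(\<lambda>x. indicator (cball 0 R) x *\<^sub>R f x) = f"
  proof
    show "indicator (cball 0 R) x *\<^sub>R f x = f x" for x by (cases "x \<in> cball 0 R") (auto simp: assms(2))
  qed
  finally show ?thesis .
qed

text \<open>Only the field and its divergence are integrable, not the single partial derivatives. After
  multiplication with the cutoff each partial derivative integrates to zero, and the terms
  in which the cutoff is differentiated are at most \<open>4 / R\<close> times the integral of the field.\<close>

lemma integral_divergence_eq_0:
  fixes X D :: "3 \<Rightarrow> real^3 \<Rightarrow> real"
  assumes pd: "\<And>j. has_pd j (X j) (D j)" and cX: "\<And>j. continuous_on UNIV (X j)"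
    and cD: "\<And>j. continuous_on UNIV (D j)" and iX: "\<And>j. integrable lborel (X j)"
    and iD: "integrable lborel (\<lambda>x. \<Sum>j\<in>UNIV. D j x)"
  shows "(\<integral>x. (\<Sum>j\<in>UNIV. D j x) \<partial>lborel) = 0"
proof -
  let ?D = "\<lambda>x. \<Sum>j\<in>UNIV. D j x"
  define S where "S = (\<Sum>j\<in>UNIV. \<integral>x. \<bar>X j x\<bar> \<partial>lborel)"
  have [measurable]: "?D \<in> borel_measurable borel" using iD by simp
  have bound: "\<bar>\<integral>x. cutoff R x * ?D x \<partial>lborel\<bar> \<le> 4 / R * S" if R: "R > 0" for R
  proof -
    note \<chi> = cutoff_facts[OF R]
    have [measurable]: "cutoff R \<in> borel_measurable borel" "\<And>j. cutoff_pd R j \<in> borel_measurable borel"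
      by (intro borel_measurable_continuous_onI \<chi>)+
    have i1: "integrable lborel (\<lambda>x. cutoff_pd R j x * X j x)" for j
      by (rule integrable_compact_support[of _ R]) (auto intro!: continuous_intros \<chi> cX simp: \<chi>)
    have i2: "integrable lborel (\<lambda>x. cutoff R x * D j x)" for j
      by (rule integrable_compact_support[of _ R]) (auto intro!: continuous_intros \<chi> cD simp: \<chi>)
    have i3: "integrable lborel (\<lambda>x. cutoff R x * X j x)" for j
      by (rule integrable_compact_support[of _ R]) (auto intro!: continuous_intros \<chi> cX simp: \<chi>)
    have z: "(\<integral>x. cutoff R x * D j x \<partial>lborel) = - (\<integral>x. cutoff_pd R j x * X j x \<partial>lborel)" for j
    proof -
      have "(\<integral>x. cutoff_pd R j x * X j x + cutoff R x * D j x \<partial>lborel) = 0"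
        by (rule integral_pd_eq_0[OF has_pd_mult[OF \<chi>(1) pd] _ i3])
           (auto intro!: continuous_intros \<chi> cX cD i1 i2)
      then show ?thesis using i1 i2 by simp
    qed
    have "(\<integral>x. cutoff R x * ?D x \<partial>lborel) = - (\<Sum>j\<in>UNIV. \<integral>x. cutoff_pd R j x * X j x \<partial>lborel)"
      unfolding sum_distrib_left by (subst Bochner_Integration.integral_sum[OF i2]) (simp add: z sum_negf)
    then have "\<bar>\<integral>x. cutoff R x * ?D x \<partial>lborel\<bar> \<le> (\<Sum>j\<in>UNIV. \<bar>\<integral>x. cutoff_pd R j x * X j x \<partial>lborel\<bar>)"
      by (simp add: sum_abs)
    also have "\<dots> \<le> (\<Sum>j\<in>UNIV. 4 / R * (\<integral>x. \<bar>X j x\<bar> \<partial>lborel))"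
    proof (rule sum_mono)
      fix j
      have "\<bar>\<integral>x. cutoff_pd R j x * X j x \<partial>lborel\<bar> \<le> (\<integral>x. \<bar>cutoff_pd R j x * X j x\<bar> \<partial>lborel)"
        by (rule integral_abs_bound)
      also have "\<dots> \<le> (\<integral>x. 4 / R * \<bar>X j x\<bar> \<partial>lborel)"
      proof (rule integral_mono)
        show "integrable lborel (\<lambda>x. \<bar>cutoff_pd R j x * X j x\<bar>)" by (rule integrable_abs[OF i1])
        show "integrable lborel (\<lambda>x. 4 / R * \<bar>X j x\<bar>)"
          by (intro integrable_mult_right integrable_abs iX)
        show "\<bar>cutoff_pd R j x * X j x\<bar> \<le> 4 / R * \<bar>X j x\<bar>" for x
          unfolding abs_mult by (rule mult_right_mono[OF \<chi>(8)]) simp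
      qed
      finally show "\<bar>\<integral>x. cutoff_pd R j x * X j x \<partial>lborel\<bar> \<le> 4 / R * (\<integral>x. \<bar>X j x\<bar> \<partial>lborel)" by simp
    qed
    finally show ?thesis by (simp add: S_def sum_distrib_left)
  qed
  have "((\<lambda>R. \<integral>x. cutoff R x * ?D x \<partial>lborel) \<longlongrightarrow> (\<integral>x. ?D x \<partial>lborel)) at_top"
  proof (rule integral_dominated_convergence_at_top[where w = "\<lambda>x. \<bar>?D x\<bar>"])
    show "integrable lborel (\<lambda>x. \<bar>?D x\<bar>)" by (rule integrable_abs[OF iD])
    show "AE x in lborel. ((\<lambda>R. cutoff R x * ?D x) \<longlongrightarrow> ?D x) at_top"
    proof (rule AE_I2)
      fix x :: "real^3"
      have "((\<lambda>R. cutoff R x) \<longlongrightarrow> (max 0 (1 - 0))\<^sup>2) at_top"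
        unfolding cutoff_def
        by (intro tendsto_intros tendsto_divide_0[OF tendsto_const] filterlim_at_top_imp_at_infinity
            filterlim_pow_at_top filterlim_ident) simp
      from tendsto_mult_right[OF this, of "?D x"] show "((\<lambda>R. cutoff R x * ?D x) \<longlongrightarrow> ?D x) at_top" by simp
    qed
    show "\<forall>\<^sub>F R in at_top. AE x in lborel. norm (cutoff R x * ?D x) \<le> \<bar>?D x\<bar>"
      using eventually_gt_at_top[of 0]
    proof eventually_elim
      case (elim R)
      show ?case using cutoff_facts(4,5)[OF elim] by (intro AE_I2) (auto simp: abs_mult mult_left_le_one_le)
    qed
    show "(\<lambda>x. cutoff R x * ?D x) \<in> borel_measurable lborel" for R
    proof -
      have [measurable]: "cutoff R \<in> borel_measurable borel" unfolding cutoff_def by measurable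
      show ?thesis by measurable
    qed
  qed measurable
  moreover have "((\<lambda>R. \<integral>x. cutoff R x * ?D x \<partial>lborel) \<longlongrightarrow> 0) at_top"
  proof (rule Lim_null_comparison)
    show "\<forall>\<^sub>F R in at_top. norm (\<integral>x. cutoff R x * ?D x \<partial>lborel) \<le> 4 / R * S"
      using eventually_gt_at_top[of 0] by eventually_elim (use bound in simp)
    have "((\<lambda>R::real. 4 / R * S) \<longlongrightarrow> 0 * S) at_top"
      by (intro tendsto_intros tendsto_divide_0[OF tendsto_const] filterlim_at_top_imp_at_infinity filterlim_ident)
    then show "((\<lambda>R::real. 4 / R * S) \<longlongrightarrow> 0) at_top" by simp
  qed
  ultimately show ?thesis by (rule tendsto_unique[OF trivial_limit_at_top_linorder])
qed

section \<open>Gradients and solenoidal fields\<close>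

lemma L2_translate:
  fixes f :: "'a::euclidean_space \<Rightarrow> 'b::{banach, second_countable_topology}"
  assumes "L2 f" shows "L2 (\<lambda>x. f (x + a))" "L2sq (\<lambda>x. f (x + a)) = L2sq f"
proof -
  have [measurable]: "f \<in> borel_measurable borel" using assms by (simp add: L2_def)
  show "L2 (\<lambda>x. f (x + a))"
    using integrable_translate[OF L2_integrable[OF assms], of a] by (simp add: L2_def)
  show "L2sq (\<lambda>x. f (x + a)) = L2sq f"
    unfolding L2sq_def using integral_translate[of "\<lambda>x. (norm (f x))\<^sup>2" a] by simp
qed

text \<open>Within radius \<open>n / 2\<close> the translate of \<open>g\<close> only sees values of \<open>g\<close> far from the origin, and beyond this
  radius \<open>f\<close> is small.\<close>

lemma weak_translation_limit:
  fixes f g :: "real^3 \<Rightarrow> real"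
  assumes f: "L2 f" and g: "L2 g" and v: "norm v = 1"
  shows "(\<lambda>n. \<integral>x. f x * g (x + real n *\<^sub>R v) \<partial>lborel) \<longlonglongrightarrow> 0"
proof (rule Lim_null_comparison)
  let ?b = "\<lambda>R. sqrt (L2sq f) * sqrt (tail g (R / 2 - 1)) + sqrt (tail f (R / 2)) * sqrt (L2sq g)"
  show "\<forall>\<^sub>F n in sequentially. norm (\<integral>x. f x * g (x + real n *\<^sub>R v) \<partial>lborel) \<le> ?b (real n)"
  proof (intro always_eventually allI)
    fix n :: nat
    let ?g = "\<lambda>x. g (x + real n *\<^sub>R v)" and ?R = "real n / 2"
    let ?h = "\<lambda>x. g x - trunc (?R - 1) g x"
    have t: "L2 (trunc ?R f)" "L2 (\<lambda>x. f x - trunc ?R f x)" "L2 ?h"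
      by (intro L2_diff L2_trunc f g)+
    note ht = L2_translate[OF t(3), of "real n *\<^sub>R v"]
    note gt = L2_translate[OF g, of "real n *\<^sub>R v"]
    have eq: "f x * ?g x = trunc ?R f x * ?h (x + real n *\<^sub>R v) + (f x - trunc ?R f x) * ?g x" for x
    proof (cases "x \<in> cball 0 ?R")
      case True
      have "real n = norm ((x + real n *\<^sub>R v) - x)" using v by simp
      also have "\<dots> \<le> norm (x + real n *\<^sub>R v) + norm x" by (rule norm_triangle_ineq4)
      finally have "x + real n *\<^sub>R v \<notin> cball 0 (?R - 1)" using True by simp
      then show ?thesis using True by (simp add: trunc_def)
    qed (simp add: trunc_def)
    have "norm (\<integral>x. f x * ?g x \<partial>lborel) = norm ((\<integral>x. trunc ?R f x * ?h (x + real n *\<^sub>R v) \<partial>lborel)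
        + (\<integral>x. (f x - trunc ?R f x) * ?g x \<partial>lborel))"
      by (subst eq, subst Bochner_Integration.integral_add[OF L2_mult[OF t(1) ht(1)] L2_mult[OF t(2) gt(1)]]) simp
    also have "\<dots> \<le> sqrt (L2sq (trunc ?R f)) * sqrt (L2sq ?h) + sqrt (tail f ?R) * sqrt (L2sq g)"
      using L2_Cauchy_Schwarz(2)[OF t(1) ht(1)] L2_Cauchy_Schwarz(2)[OF t(2) gt(1)]
      unfolding ht(2) gt(2) tail_def by (rule norm_triangle_mono)
    also have "\<dots> \<le> sqrt (L2sq f) * sqrt (L2sq ?h) + sqrt (tail f ?R) * sqrt (L2sq g)"
    proof -
      have "L2sq (trunc ?R f) \<le> 1\<^sup>2 * L2sq f"
        using t(1) by (intro L2_mono(2)[OF f]) (auto simp: L2_def abs_trunc_le)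
      then show ?thesis by (intro add_right_mono mult_right_mono) auto
    qed
    finally show "norm (\<integral>x. f x * ?g x \<partial>lborel) \<le> ?b (real n)" by (simp add: tail_def)
  qed
  have h1: "filterlim (\<lambda>n. real n / 2 - 1) at_top sequentially" by real_asymp
  have h2: "filterlim (\<lambda>n. real n / 2) at_top sequentially" by real_asymp
  have "(\<lambda>n. ?b (real n)) \<longlonglongrightarrow> sqrt (L2sq f) * sqrt 0 + sqrt 0 * sqrt (L2sq g)"
    by (intro tendsto_intros filterlim_compose[OF tail_tendsto[OF g] h1] filterlim_compose[OF tail_tendsto[OF f] h2])
  then show "(\<lambda>n. ?b (real n)) \<longlonglongrightarrow> 0" by simp
qed

lemma measurable_slice:
  fixes \<phi> :: "real \<Rightarrow> 'a::euclidean_space \<Rightarrow> real"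
  assumes c: "continuous_on ({a..b} \<times> UNIV) (\<lambda>(\<tau>, x). \<phi> \<tau> x)"
  shows "(\<lambda>(\<tau>, x). indicator {a..b} \<tau> * \<phi> \<tau> x) \<in> borel_measurable (lborel \<Otimes>\<^sub>M lborel)"
proof -
  have "(\<lambda>p. indicator ({a..b} \<times> UNIV) p *\<^sub>R (\<lambda>(\<tau>, x). \<phi> \<tau> x) p) \<in> borel_measurable borel"
    by (rule borel_measurable_continuous_on_indicator[OF _ c]) (simp add: borel_closed closed_Times)
  also have "(\<lambda>p. indicator ({a..b} \<times> UNIV) p *\<^sub>R (\<lambda>(\<tau>, x). \<phi> \<tau> x) p) = (\<lambda>(\<tau>, x). indicator {a..b} \<tau> * \<phi> \<tau> x)"
    by (auto simp: indicator_def)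
  finally show ?thesis by (simp add: lborel_prod)
qed

text \<open>Minkowski's integral inequality on an interval, in the quadratic form that the Cauchy-Schwarz
  inequality in time and Tonelli's theorem give.\<close>

lemma L2_time_integral:
  fixes \<phi> :: "real \<Rightarrow> real^3 \<Rightarrow> real"
  assumes ab: "a \<le> b" and c: "continuous_on ({a..b} \<times> UNIV) (\<lambda>(\<tau>, x). \<phi> \<tau> x)"
    and L: "\<And>\<tau>. \<tau> \<in> {a..b} \<Longrightarrow> L2 (\<phi> \<tau>)" and K: "\<And>\<tau>. \<tau> \<in> {a..b} \<Longrightarrow> L2sq (\<phi> \<tau>) \<le> K"
  defines "\<Phi> \<equiv> \<lambda>x. \<integral>\<tau>. indicator {a..b} \<tau> * \<phi> \<tau> x \<partial>lborel"
  shows "L2 \<Phi>" "L2sq \<Phi> \<le> (b - a)\<^sup>2 * K"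
proof -
  note [measurable] = measurable_slice[OF c]
  have m2[measurable]: "(\<lambda>(x, \<tau>). indicator {a..b} \<tau> * \<phi> \<tau> x) \<in> borel_measurable (lborel \<Otimes>\<^sub>M lborel)"
    using measurable_pair_swap[OF measurable_slice[OF c]] by simp
  have m3[measurable]: "\<Phi> \<in> borel_measurable borel"
    unfolding \<Phi>_def using lborel.borel_measurable_lebesgue_integral[OF m2] by simp
  have K0: "0 \<le> K" using order_trans[OF L2sq_nonneg K[of a]] ab by simp
  have pt: "(\<Phi> x)\<^sup>2 \<le> (b - a) * (\<integral>\<tau>. indicator {a..b} \<tau> * (\<phi> \<tau> x)\<^sup>2 \<partial>lborel)"
    and fin: "(\<integral>\<^sup>+\<tau>. ennreal (indicator {a..b} \<tau> * (\<phi> \<tau> x)\<^sup>2) \<partial>lborel) = ennreal (\<integral>\<tau>. indicator {a..b} \<tau> * (\<phi> \<tau> x)\<^sup>2 \<partial>lborel)" for x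
  proof -
    let ?f = "\<lambda>\<tau>::real. indicator {a..b} \<tau> :: real" and ?g = "\<lambda>\<tau>. indicator {a..b} \<tau> * \<phi> \<tau> x"
    have cx: "continuous_on {a..b} (\<lambda>\<tau>. \<phi> \<tau> x)"
      using continuous_on_compose2[OF c, of "{a..b}" "\<lambda>\<tau>. (\<tau>, x)"]
      by (simp add: continuous_on_Pair image_subset_iff)
    have sq: "(norm (?f \<tau>))\<^sup>2 = ?f \<tau>" "(norm (?g \<tau>))\<^sup>2 = ?f \<tau> * (\<phi> \<tau> x)\<^sup>2" "?f \<tau> * ?g \<tau> = ?g \<tau>" for \<tau>
      by (auto simp: indicator_def)
    have i: "integrable lborel (\<lambda>\<tau>. ?f \<tau> * (\<phi> \<tau> x)\<^sup>2)" "integrable lborel ?g"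
      using borel_integrable_compact[of "{a..b}" "\<lambda>\<tau>. (\<phi> \<tau> x)\<^sup>2"] borel_integrable_compact[of "{a..b}" "\<lambda>\<tau>. \<phi> \<tau> x"] cx
        continuous_on_power[OF cx, of 2] by simp_all
    have Lf: "L2 ?f" "L2sq ?f = b - a" unfolding L2_def L2sq_def sq using ab by auto
    have Lg: "L2 ?g" "L2sq ?g = (\<integral>\<tau>. ?f \<tau> * (\<phi> \<tau> x)\<^sup>2 \<partial>lborel)"
      unfolding L2_def L2sq_def sq using i by auto
    have "\<bar>\<Phi> x\<bar> \<le> sqrt (b - a) * sqrt (\<integral>\<tau>. ?f \<tau> * (\<phi> \<tau> x)\<^sup>2 \<partial>lborel)"
      using L2_Cauchy_Schwarz(2)[OF Lf(1) Lg(1)] unfolding sq Lf(2) Lg(2) \<Phi>_def by simp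
    from power_mono[OF this, of 2]
    show "(\<Phi> x)\<^sup>2 \<le> (b - a) * (\<integral>\<tau>. ?f \<tau> * (\<phi> \<tau> x)\<^sup>2 \<partial>lborel)"
      using ab by (simp add: power_mult_distrib)
    show "(\<integral>\<^sup>+\<tau>. ennreal (?f \<tau> * (\<phi> \<tau> x)\<^sup>2) \<partial>lborel) = ennreal (\<integral>\<tau>. ?f \<tau> * (\<phi> \<tau> x)\<^sup>2 \<partial>lborel)"
      by (intro nn_integral_eq_integral i) auto
  qed
  have ms: "(\<lambda>(\<tau>, x). ennreal (indicator {a..b} \<tau> * (\<phi> \<tau> x)\<^sup>2)) \<in> borel_measurable (lborel \<Otimes>\<^sub>M lborel)"
  proof -
    have "(\<lambda>p. ennreal (((\<lambda>(\<tau>, x). indicator {a..b} \<tau> * \<phi> \<tau> x) p)\<^sup>2)) \<in> borel_measurable (lborel \<Otimes>\<^sub>M lborel)" by measurable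
    also have "(\<lambda>p. ennreal (((\<lambda>(\<tau>, x). indicator {a..b} \<tau> * \<phi> \<tau> x) p)\<^sup>2)) = (\<lambda>(\<tau>, x). ennreal (indicator {a..b} \<tau> * (\<phi> \<tau> x)\<^sup>2))"
      by (auto simp: indicator_def)
    finally show ?thesis .
  qed
  have "(\<integral>\<^sup>+x. ennreal ((norm (\<Phi> x))\<^sup>2) \<partial>lborel)
      \<le> (\<integral>\<^sup>+x. ennreal (b - a) * (\<integral>\<^sup>+\<tau>. ennreal (indicator {a..b} \<tau> * (\<phi> \<tau> x)\<^sup>2) \<partial>lborel) \<partial>lborel)"
    using pt ab by (intro nn_integral_mono) (simp add: fin ennreal_mult[symmetric] ennreal_leI)
  also have "\<dots> = ennreal (b - a) * (\<integral>\<^sup>+x. (\<integral>\<^sup>+\<tau>. ennreal (indicator {a..b} \<tau> * (\<phi> \<tau> x)\<^sup>2) \<partial>lborel) \<partial>lborel)"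
    using lborel.borel_measurable_nn_integral[OF measurable_pair_swap[OF ms]] by (intro nn_integral_cmult) simp
  also have "(\<integral>\<^sup>+x. (\<integral>\<^sup>+\<tau>. ennreal (indicator {a..b} \<tau> * (\<phi> \<tau> x)\<^sup>2) \<partial>lborel) \<partial>lborel)
      = (\<integral>\<^sup>+\<tau>. (\<integral>\<^sup>+x. ennreal (indicator {a..b} \<tau> * (\<phi> \<tau> x)\<^sup>2) \<partial>lborel) \<partial>lborel)"
    by (rule lborel_pair.Fubini'[OF ms])
  also have "ennreal (b - a) * \<dots> \<le> ennreal (b - a) * (\<integral>\<^sup>+\<tau>. ennreal K * indicator {a..b} \<tau> \<partial>lborel)"
  proof (intro mult_left_mono nn_integral_mono)
    fix \<tau> :: real
    show "(\<integral>\<^sup>+x. ennreal (indicator {a..b} \<tau> * (\<phi> \<tau> x)\<^sup>2) \<partial>lborel) \<le> ennreal K * indicator {a..b} \<tau>"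
      using L2_nn[OF L, of \<tau>] K[of \<tau>] by (auto simp: indicator_def ennreal_leI)
  qed simp
  also have "(\<integral>\<^sup>+\<tau>. ennreal K * indicator {a..b} \<tau> \<partial>lborel) = ennreal K * ennreal (b - a)"
    using ab by (simp add: nn_integral_cmult_indicator)
  also have "ennreal (b - a) * (ennreal K * ennreal (b - a)) = ennreal ((b - a)\<^sup>2 * K)"
    using ab K0 by (simp add: ennreal_mult[symmetric] power2_eq_square mult.commute mult.left_commute)
  finally have *: "(\<integral>\<^sup>+x. ennreal ((norm (\<Phi> x))\<^sup>2) \<partial>lborel) \<le> ennreal ((b - a)\<^sup>2 * K)" .
  then show L\<Phi>: "L2 \<Phi>" unfolding L2_iff_nn using m3 by (auto intro: le_less_trans)
  from * show "L2sq \<Phi> \<le> (b - a)\<^sup>2 * K" unfolding L2_nn[OF L\<Phi>] using K0 by simp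
qed

text \<open>Square integrable gradients are orthogonal to square integrable solenoidal fields. The
  potential itself need not be square integrable, but its differences \<open>P (x + n e) - P x\<close> are, so the
  divergence theorem shows that the pairing does not change when the gradient is translated; and
  translating it to infinity makes the pairing vanish.\<close>

lemma gradient_orthogonal_solenoidal:
  fixes w W V :: "3 \<Rightarrow> real^3 \<Rightarrow> real" and P :: "real^3 \<Rightarrow> real"
  assumes w: "\<And>j. has_pd j (w j) (W j)" "\<And>j. continuous_on UNIV (w j)" "\<And>j. continuous_on UNIV (W j)"
      "\<And>j. L2 (w j)" "\<And>x. (\<Sum>j\<in>UNIV. W j x) = 0"
    and P: "\<And>j. has_pd j P (V j)" "continuous_on UNIV P" "\<And>j. continuous_on UNIV (V j)" "\<And>j. L2 (V j)"
  shows "(\<integral>x. (\<Sum>j\<in>UNIV. w j x * V j x) \<partial>lborel) = 0"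
proof -
  let ?e = "axis 1 1 :: real^3"
  define c where "c = (\<integral>x. (\<Sum>j\<in>UNIV. w j x * V j x) \<partial>lborel)"
  have tr: "continuous_on UNIV (\<lambda>x. f (x + a))" if "continuous_on UNIV f" for f :: "real^3 \<Rightarrow> real" and a
    by (rule continuous_on_compose2[OF that]) (auto intro!: continuous_intros)
  have eq: "(\<integral>x. (\<Sum>j\<in>UNIV. w j x * V j (x + real n *\<^sub>R ?e)) \<partial>lborel) = c" for n
  proof -
    let ?a = "real n *\<^sub>R ?e"
    define Q where "Q x = P (x + ?a) - P x" for x
    have Qpd: "has_pd j Q (\<lambda>x. V j (x + ?a) - V j x)" for j
      unfolding Q_def by (intro has_pd_diff has_pd_translate P)
    have Qc: "continuous_on UNIV Q" unfolding Q_def by (intro continuous_intros tr P)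
    have QL: "L2 Q"
    proof -
      have "L2 (\<lambda>x. \<integral>s. indicator {0..real n} s * V 1 (x + s *\<^sub>R ?e) \<partial>lborel)"
      proof (rule L2_time_integral(1))
        show "continuous_on ({0..real n} \<times> UNIV) (\<lambda>(s, x). V 1 (x + s *\<^sub>R ?e))"
          unfolding case_prod_beta by (rule continuous_on_compose2[OF P(3)]) (auto intro!: continuous_intros)
        show "L2sq (\<lambda>x. V 1 (x + s *\<^sub>R ?e)) \<le> L2sq (V 1)" for s by (simp add: L2_translate P)
      qed (auto intro: L2_translate P)
      then show ?thesis using integral_pd_line[OF P(1,3), of "real n" 1] by (simp add: Q_def[abs_def])
    qed
    have Vt: "L2 (\<lambda>x. V j (x + ?a))" for j by (intro L2_translate P)
    let ?D = "\<lambda>j x. (V j (x + ?a) - V j x) * w j x + Q x * W j x"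
    have sumD: "(\<Sum>j\<in>UNIV. ?D j x) = (\<Sum>j\<in>UNIV. w j x * V j (x + ?a)) - (\<Sum>j\<in>UNIV. w j x * V j x)" for x
      by (simp add: sum.distrib sum_distrib_left[symmetric] w(5))
         (simp add: algebra_simps sum_subtractf)
    have i: "integrable lborel (\<lambda>x. \<Sum>j\<in>UNIV. w j x * V j (x + ?a))" "integrable lborel (\<lambda>x. \<Sum>j\<in>UNIV. w j x * V j x)"
      by (intro Bochner_Integration.integrable_sum L2_mult w P Vt)+
    have "(\<integral>x. (\<Sum>j\<in>UNIV. ?D j x) \<partial>lborel) = 0"
    proof (rule integral_divergence_eq_0)
      show "has_pd j (\<lambda>x. Q x * w j x) (?D j)" for j by (intro has_pd_mult Qpd w)
      show "continuous_on UNIV (\<lambda>x. Q x * w j x)" "continuous_on UNIV (?D j)" for j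
        by (intro continuous_intros Qc tr P w)+
      show "integrable lborel (\<lambda>x. Q x * w j x)" for j by (intro L2_mult QL w)
      show "integrable lborel (\<lambda>x. \<Sum>j\<in>UNIV. ?D j x)" unfolding sumD using i by simp
    qed
    then show ?thesis unfolding sumD using i by (simp add: c_def)
  qed
  have "(\<lambda>n. \<integral>x. (\<Sum>j\<in>UNIV. w j x * V j (x + real n *\<^sub>R ?e)) \<partial>lborel) \<longlonglongrightarrow> (\<Sum>j\<in>(UNIV::3 set). 0)"
  proof -
    have "(\<integral>x. (\<Sum>j\<in>UNIV. w j x * V j (x + real n *\<^sub>R ?e)) \<partial>lborel)
        = (\<Sum>j\<in>UNIV. \<integral>x. w j x * V j (x + real n *\<^sub>R ?e) \<partial>lborel)" for n
      by (intro Bochner_Integration.integral_sum L2_mult w L2_translate P)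
    then show ?thesis
      by (simp only:) (intro tendsto_sum weak_translation_limit w P, simp)
  qed
  then have "(\<lambda>n::nat. c) \<longlonglongrightarrow> 0" unfolding eq by simp
  then show ?thesis unfolding c_def[symmetric] by (simp add: LIMSEQ_const_iff)
qed

lemma L2_sum_bound:
  fixes f :: "'i \<Rightarrow> 'a::euclidean_space \<Rightarrow> real"
  assumes "\<And>i. i \<in> I \<Longrightarrow> L2 (f i)" "\<And>i. i \<in> I \<Longrightarrow> L2sq (f i) \<le> B"
  shows "L2 (\<lambda>x. \<Sum>i\<in>I. f i x)" "L2sq (\<lambda>x. \<Sum>i\<in>I. f i x) \<le> (real (card I))\<^sup>2 * B"
proof -
  show L: "L2 (\<lambda>x. \<Sum>i\<in>I. f i x)" by (rule L2_sum) (rule assms)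
  have i: "integrable lborel (\<lambda>x. (\<Sum>i\<in>I. (f i x)\<^sup>2) * real (card I))"
    using L2_integrable[OF assms(1)] by (intro integrable_mult_left Bochner_Integration.integrable_sum) simp
  have "L2sq (\<lambda>x. \<Sum>i\<in>I. f i x) \<le> (\<integral>x. (\<Sum>i\<in>I. (f i x)\<^sup>2) * real (card I) \<partial>lborel)"
    by (rule L2_bound(2)[OF L2_measurable[OF L] i]) (use sum_squared_le_sum_of_squares in simp)
  also have "\<dots> = (\<Sum>i\<in>I. L2sq (f i)) * real (card I)"
    using L2_integrable[OF assms(1)] unfolding L2sq_def
    by (simp add: Bochner_Integration.integral_sum)
  also have "\<dots> \<le> (\<Sum>i\<in>I. B) * real (card I)"
    by (intro mult_right_mono sum_mono assms(2)) simp_all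
  finally show "L2sq (\<lambda>x. \<Sum>i\<in>I. f i x) \<le> (real (card I))\<^sup>2 * B" by (simp add: power2_eq_square mult_ac)
qed

lemma set_integral_eq_HK:
  fixes f :: "real \<Rightarrow> real"
  assumes "continuous_on {a..b} f"
  shows "(\<integral>\<tau>. indicator {a..b} \<tau> * f \<tau> \<partial>lborel) = integral {a..b} f"
proof -
  have "set_integrable lborel {a..b} f" by (rule borel_integrable_atLeastAtMost'[OF assms])
  from set_borel_integral_eq_integral(2)[OF this] show ?thesis by (simp add: set_lebesgue_integral_def)
qed

text \<open>A pressure whose gradient is continuous in space and time is, up to its value at the origin,
  itself continuous; time integrals of the gradient are therefore gradients.\<close>

lemma integrated_pressure:
  fixes p :: "real \<Rightarrow> real^3 \<Rightarrow> real" and gp :: "3 \<Rightarrow> real \<Rightarrow> real^3 \<Rightarrow> real"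
  assumes cg: "\<And>j. continuous_on (J \<times> UNIV) (\<lambda>z. gp j (fst z) (snd z))"
    and dp: "\<And>t x. t \<in> J \<Longrightarrow> (p t has_derivative (\<lambda>v. \<Sum>j\<in>UNIV. gp j t x * v $ j)) (at x)"
    and st: "{s..t} \<subseteq> J"
  defines "P \<equiv> \<lambda>x. integral {s..t} (\<lambda>\<tau>. p \<tau> x - p \<tau> 0)"
  shows "continuous_on UNIV P" "has_pd j P (\<lambda>x. integral {s..t} (\<lambda>\<tau>. gp j \<tau> x))"
    "continuous_on UNIV (\<lambda>x. integral {s..t} (\<lambda>\<tau>. gp j \<tau> x))"
proof -
  let ?q = "\<lambda>\<tau> x. p \<tau> x - p \<tau> 0"
  have q: "?q \<tau> x = integral {0..1} (\<lambda>r. \<Sum>j\<in>UNIV. gp j \<tau> (r *\<^sub>R x) * x $ j)" if "\<tau> \<in> J" for \<tau> x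
  proof -
    have "((\<lambda>r. \<Sum>j\<in>UNIV. gp j \<tau> (r *\<^sub>R x) * x $ j) has_integral p \<tau> (1 *\<^sub>R x) - p \<tau> (0 *\<^sub>R x)) {0..1}"
    proof (rule fundamental_theorem_of_calculus)
      fix r :: real
      have "((\<lambda>r. p \<tau> (r *\<^sub>R x)) has_derivative (\<lambda>h. \<Sum>j\<in>UNIV. gp j \<tau> (r *\<^sub>R x) * (h *\<^sub>R x) $ j)) (at r within {0..1})"
        by (rule has_derivative_compose[OF _ dp[OF that]]) (auto intro!: derivative_eq_intros)
      then show "((\<lambda>r. p \<tau> (r *\<^sub>R x)) has_vector_derivative (\<Sum>j\<in>UNIV. gp j \<tau> (r *\<^sub>R x) * x $ j)) (at r within {0..1})"
        unfolding has_vector_derivative_def by (simp add: sum_distrib_left mult_ac)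
    qed simp
    then show ?thesis by (simp add: integral_unique)
  qed
  have cq: "continuous_on (J \<times> UNIV) (\<lambda>z. ?q (fst z) (snd z))"
  proof -
    have "continuous_on ((J \<times> UNIV) \<times> cbox (0::real) 1)
        (\<lambda>(z, r). \<Sum>j\<in>UNIV. gp j (fst z) (r *\<^sub>R snd z) * snd z $ j)"
    proof -
      have "continuous_on ((J \<times> UNIV) \<times> cbox (0::real) 1) (\<lambda>y. gp j (fst (fst (fst y), snd y *\<^sub>R snd (fst y)))
          (snd (fst (fst y), snd y *\<^sub>R snd (fst y))))" for j
        by (intro continuous_on_compose2[OF cg] continuous_intros) auto
      then have "continuous_on ((J \<times> UNIV) \<times> cbox (0::real) 1) (\<lambda>y. gp j (fst (fst y)) (snd y *\<^sub>R snd (fst y)))" for j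
        by simp
      then show ?thesis unfolding case_prod_beta by (intro continuous_intros)
    qed
    from integral_continuous_on_param[OF this]
    have "continuous_on (J \<times> UNIV) (\<lambda>z. integral {0..1} (\<lambda>r. \<Sum>j\<in>UNIV. gp j (fst z) (r *\<^sub>R snd z) * snd z $ j))"
      by simp
    then show ?thesis by (rule continuous_on_eq) (auto simp: q)
  qed
  have swap: "continuous_on (UNIV \<times> cbox s t) (\<lambda>(x, \<tau>). g \<tau> (h x))"
    if "continuous_on (J \<times> UNIV) (\<lambda>z. g (fst z) (snd z))" "continuous_on UNIV h"
    for g :: "real \<Rightarrow> real^3 \<Rightarrow> real" and h :: "'c::topological_space \<Rightarrow> real^3"
  proof -
    have "continuous_on (UNIV \<times> cbox s t) (\<lambda>y. h (fst y))"
      by (rule continuous_on_compose2[OF that(2)]) (auto intro!: continuous_intros)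
    then have "continuous_on (UNIV \<times> cbox s t) (\<lambda>y. g (fst (snd y, h (fst y))) (snd (snd y, h (fst y))))"
      using st by (intro continuous_on_compose2[OF that(1)] continuous_intros) auto
    then show ?thesis by (simp add: case_prod_beta)
  qed
  show "continuous_on UNIV P"
    using integral_continuous_on_param[OF swap[OF cq continuous_on_id]] by (simp add: P_def)
  show "continuous_on UNIV (\<lambda>x. integral {s..t} (\<lambda>\<tau>. gp j \<tau> x))"
    using integral_continuous_on_param[OF swap[OF cg continuous_on_id]] by simp
  show "has_pd j P (\<lambda>x. integral {s..t} (\<lambda>\<tau>. gp j \<tau> x))"
    unfolding has_pd_def
  proof
    fix x :: "real^3"
    let ?l = "\<lambda>r. x + r *\<^sub>R axis j 1"
    have lc: "continuous_on UNIV ?l" by (intro continuous_intros)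
    have "((\<lambda>r. integral (cbox s t) (\<lambda>\<tau>. ?q \<tau> (?l r))) has_real_derivative integral (cbox s t) (\<lambda>\<tau>. gp j \<tau> (?l 0))) (at 0 within UNIV)"
    proof (rule leibniz_rule_field_derivative)
      fix r \<tau> assume "\<tau> \<in> cbox s t"
      then have \<tau>: "\<tau> \<in> J" using st by auto
      have "((\<lambda>r. p \<tau> (?l r)) has_derivative (\<lambda>h. \<Sum>i\<in>UNIV. gp i \<tau> (?l r) * (h *\<^sub>R axis j 1) $ i)) (at r)"
        by (rule has_derivative_compose[OF _ dp[OF \<tau>]]) (auto intro!: derivative_eq_intros)
      moreover have "(\<Sum>i\<in>UNIV. gp i \<tau> (?l r) * (h *\<^sub>R axis j 1) $ i) = gp j \<tau> (?l r) * h" for h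
        by (simp add: axis_def if_distrib cong: if_cong)
      ultimately have "((\<lambda>r. p \<tau> (?l r)) has_real_derivative gp j \<tau> (?l r)) (at r)"
        by (simp add: has_field_derivative_def)
      then show "((\<lambda>r. ?q \<tau> (?l r)) has_real_derivative gp j \<tau> (?l r)) (at r within UNIV)"
        by (auto intro!: derivative_eq_intros)
    next
      fix r :: real
      have "continuous_on (cbox s t) (\<lambda>\<tau>. ?q \<tau> (?l r))"
      proof -
        have "continuous_on (cbox s t) (\<lambda>\<tau>. ?q (fst (\<tau>, ?l r)) (snd (\<tau>, ?l r)))"
          using st by (intro continuous_on_compose2[OF cq] continuous_intros) auto
        then show ?thesis by simp
      qed
      then show "(\<lambda>\<tau>. ?q \<tau> (?l r)) integrable_on cbox s t" by (rule integrable_continuous)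
    next
      show "continuous_on (UNIV \<times> cbox s t) (\<lambda>(r, \<tau>). gp j \<tau> (?l r))" by (rule swap[OF cg lc])
    qed auto
    then show "((\<lambda>r. P (?l r)) has_real_derivative integral {s..t} (\<lambda>\<tau>. gp j \<tau> x)) (at 0)"
      by (simp add: P_def)
  qed
qed

section \<open>Conservation of energy\<close>

text \<open>The system on \<open>[0, b]\<close> in components: \<open>Du j i\<close> is the \<open>j\<close>-th partial derivative of \<open>u\<^sub>i\<close>, \<open>f i k\<close> is the
  entry of \<open>F\<close> in row \<open>i\<close> and column \<open>k\<close>, \<open>Df j i k\<close> is its \<open>j\<close>-th partial derivative, and \<open>gp\<close> is the
  pressure gradient. One constant \<open>K\<close> bounds the fields and their first derivatives, and the \<open>L\<^sup>2\<close>
  norms of the fields.\<close>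

locale viscoelastic_flow =
  fixes b K :: real
    and u ut :: "3 \<Rightarrow> real \<Rightarrow> real^3 \<Rightarrow> real" and Du :: "3 \<Rightarrow> 3 \<Rightarrow> real \<Rightarrow> real^3 \<Rightarrow> real"
    and f ft :: "3 \<Rightarrow> 3 \<Rightarrow> real \<Rightarrow> real^3 \<Rightarrow> real" and Df :: "3 \<Rightarrow> 3 \<Rightarrow> 3 \<Rightarrow> real \<Rightarrow> real^3 \<Rightarrow> real"
    and p :: "real \<Rightarrow> real^3 \<Rightarrow> real" and gp :: "3 \<Rightarrow> real \<Rightarrow> real^3 \<Rightarrow> real"
  assumes b: "0 < b"
    and cu: "\<And>i. continuous_on ({0..b} \<times> UNIV) (\<lambda>z. u i (fst z) (snd z))"
    and cut: "\<And>i. continuous_on ({0..b} \<times> UNIV) (\<lambda>z. ut i (fst z) (snd z))"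
    and cDu: "\<And>j i. continuous_on ({0..b} \<times> UNIV) (\<lambda>z. Du j i (fst z) (snd z))"
    and cf: "\<And>i k. continuous_on ({0..b} \<times> UNIV) (\<lambda>z. f i k (fst z) (snd z))"
    and cDf: "\<And>j i k. continuous_on ({0..b} \<times> UNIV) (\<lambda>z. Df j i k (fst z) (snd z))"
    and pdu: "\<And>t j i. t \<in> {0..b} \<Longrightarrow> has_pd j (u i t) (Du j i t)"
    and pdf: "\<And>t j i k. t \<in> {0..b} \<Longrightarrow> has_pd j (f i k t) (Df j i k t)"
    and tdu: "\<And>t x i. t \<in> {0..b} \<Longrightarrow> ((\<lambda>s. u i s x) has_real_derivative ut i t x) (at t within {0..b})"
    and tdf: "\<And>t x i k. t \<in> {0..b} \<Longrightarrow> ((\<lambda>s. f i k s x) has_real_derivative ft i k t x) (at t within {0..b})"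
    and momentum: "\<And>t x i. t \<in> {0..b} \<Longrightarrow> ut i t x + (\<Sum>j\<in>UNIV. u j t x * Du j i t x) =
        - gp i t x + (\<Sum>k\<in>UNIV. \<Sum>j\<in>UNIV. f j k t x * Df j i k t x)"
    and transport: "\<And>t x i k. t \<in> {0..b} \<Longrightarrow> ft i k t x + (\<Sum>j\<in>UNIV. u j t x * Df j i k t x) =
        (\<Sum>j\<in>UNIV. f j k t x * Du j i t x)"
    and divu: "\<And>t x. t \<in> {0..b} \<Longrightarrow> (\<Sum>j\<in>UNIV. Du j j t x) = 0"
    and divf: "\<And>t x k. t \<in> {0..b} \<Longrightarrow> (\<Sum>j\<in>UNIV. Df j j k t x) = 0"
    and dp: "\<And>t x. t \<in> {0..b} \<Longrightarrow> (p t has_derivative (\<lambda>v. \<Sum>j\<in>UNIV. gp j t x * v $ j)) (at x)"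
    and L2u: "\<And>t i. t \<in> {0..b} \<Longrightarrow> L2 (u i t)" "\<And>t i. t \<in> {0..b} \<Longrightarrow> L2sq (u i t) \<le> K\<^sup>2"
    and L2f: "\<And>t i k. t \<in> {0..b} \<Longrightarrow> L2 (f i k t)" "\<And>t i k. t \<in> {0..b} \<Longrightarrow> L2sq (f i k t) \<le> K\<^sup>2"
    and Bu: "\<And>t x i. t \<in> {0..b} \<Longrightarrow> \<bar>u i t x\<bar> \<le> K" and Bf: "\<And>t x i k. t \<in> {0..b} \<Longrightarrow> \<bar>f i k t x\<bar> \<le> K"
    and BDu: "\<And>t x j i. t \<in> {0..b} \<Longrightarrow> \<bar>Du j i t x\<bar> \<le> K" and BDf: "\<And>t x j i k. t \<in> {0..b} \<Longrightarrow> \<bar>Df j i k t x\<bar> \<le> K"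
begin

lemma slice:
  fixes g :: "real \<Rightarrow> real^3 \<Rightarrow> real"
  assumes "continuous_on ({0..b} \<times> UNIV) (\<lambda>z. g (fst z) (snd z))" "t \<in> {0..b}"
  shows "continuous_on UNIV (g t)" "g t \<in> borel_measurable borel"
proof -
  have "continuous_on UNIV (\<lambda>x. g (fst (t, x)) (snd (t, x)))"
    using assms(2) by (intro continuous_on_compose2[OF assms(1)] continuous_intros) auto
  then show "continuous_on UNIV (g t)" by simp
  then show "g t \<in> borel_measurable borel" by (rule borel_measurable_continuous_onI)
qed

lemma time_slice:
  fixes g :: "real \<Rightarrow> real^3 \<Rightarrow> real"
  assumes "continuous_on ({0..b} \<times> UNIV) (\<lambda>z. g (fst z) (snd z))" "{s..t} \<subseteq> {0..b}"
  shows "continuous_on {s..t} (\<lambda>\<tau>. g \<tau> x)"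
proof -
  have "continuous_on {s..t} (\<lambda>\<tau>. g (fst (\<tau>, x)) (snd (\<tau>, x)))"
    using assms(2) by (intro continuous_on_compose2[OF assms(1)] continuous_intros) auto
  then show ?thesis by simp
qed

text \<open>The nonlinear terms of the momentum equation, so that \<open>u\<^sub>t + N = - \<nabla>p\<close>.\<close>

definition N :: "3 \<Rightarrow> real \<Rightarrow> real^3 \<Rightarrow> real" where
  "N i t x = (\<Sum>j\<in>UNIV. u j t x * Du j i t x) - (\<Sum>k\<in>UNIV. \<Sum>j\<in>UNIV. f j k t x * Df j i k t x)"

lemma cN: "continuous_on ({0..b} \<times> UNIV) (\<lambda>z. N i (fst z) (snd z))"
  unfolding N_def by (intro continuous_intros cu cDu cf cDf)

lemma gp_eq: "t \<in> {0..b} \<Longrightarrow> gp i t x = - (ut i t x + N i t x)"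
  using momentum[of t i x] by (simp add: N_def)

lemma cgp: "continuous_on ({0..b} \<times> UNIV) (\<lambda>z. gp i (fst z) (snd z))"
proof (rule continuous_on_eq)
  show "continuous_on ({0..b} \<times> UNIV) (\<lambda>z. - (ut i (fst z) (snd z) + N i (fst z) (snd z)))"
    by (intro continuous_intros cut cN)
qed (auto simp: gp_eq)

lemma L2_times:
  assumes "t \<in> {0..b}" "L2 (g t)" "L2sq (g t) \<le> K\<^sup>2" "\<And>x. \<bar>d t x\<bar> \<le> K" "d t \<in> borel_measurable borel"
  shows "L2 (\<lambda>x. g t x * d t x)" "L2sq (\<lambda>x. g t x * d t x) \<le> K^4"
proof -
  note L = L2_bounded_mult[OF assms(2,5), of K]
  show "L2 (\<lambda>x. g t x * d t x)" using L(1) assms(4) by (simp add: mult.commute)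
  have "L2sq (\<lambda>x. g t x * d t x) \<le> K\<^sup>2 * L2sq (g t)" using L(2) assms(4) by (simp add: mult.commute)
  also have "\<dots> \<le> K\<^sup>2 * K\<^sup>2" by (intro mult_left_mono assms(3)) simp
  finally show "L2sq (\<lambda>x. g t x * d t x) \<le> K^4" by (simp add: power_add[symmetric])
qed

text \<open>A sum of three functions multiplies the bound on the squared norms of the summands by \<open>3\<^sup>2 = 9\<close>.\<close>

definition KN :: real where "KN = 2 * (9 * K^4) + 2 * (9 * (9 * K^4))"

lemma L2_N:
  assumes t: "t \<in> {0..b}" shows "L2 (N i t)" "L2sq (N i t) \<le> KN"
proof -
  have 1: "L2 (\<lambda>x. u j t x * Du j i t x)" "L2sq (\<lambda>x. u j t x * Du j i t x) \<le> K^4" for j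
    by (rule L2_times[where g = "u j" and d = "Du j i", OF t L2u[OF t] BDu[OF t] slice(2)[OF cDu t]])+
  have 2: "L2 (\<lambda>x. f j k t x * Df j i k t x)" "L2sq (\<lambda>x. f j k t x * Df j i k t x) \<le> K^4" for j k
    by (rule L2_times[where g = "f j k" and d = "Df j i k", OF t L2f[OF t] BDf[OF t] slice(2)[OF cDf t]])+
  have A: "L2 (\<lambda>x. \<Sum>j\<in>UNIV. u j t x * Du j i t x)" "L2sq (\<lambda>x. \<Sum>j\<in>UNIV. u j t x * Du j i t x) \<le> 9 * K^4"
    using L2_sum_bound[of UNIV "\<lambda>j x. u j t x * Du j i t x" "K^4"] 1 by auto
  have B: "L2 (\<lambda>x. \<Sum>j\<in>UNIV. f j k t x * Df j i k t x)"
    "L2sq (\<lambda>x. \<Sum>j\<in>UNIV. f j k t x * Df j i k t x) \<le> 9 * K^4" for k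
    using L2_sum_bound[of UNIV "\<lambda>j x. f j k t x * Df j i k t x" "K^4"] 2 by auto
  have C: "L2 (\<lambda>x. \<Sum>k\<in>UNIV. \<Sum>j\<in>UNIV. f j k t x * Df j i k t x)"
    "L2sq (\<lambda>x. \<Sum>k\<in>UNIV. \<Sum>j\<in>UNIV. f j k t x * Df j i k t x) \<le> 9 * (9 * K^4)"
    using L2_sum_bound[of UNIV "\<lambda>k x. \<Sum>j\<in>UNIV. f j k t x * Df j i k t x" "9 * K^4"] B by auto
  show "L2 (N i t)" "L2sq (N i t) \<le> KN"
    using L2_diff[OF A(1) C(1)] A(2) C(2) unfolding N_def[abs_def] KN_def by auto
qed

lemma KN_nonneg: "0 \<le> KN"
  using order_trans[OF L2sq_nonneg L2_N(2)[of 0 1]] b by simp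

text \<open>The pressure enters the time-integrated momentum balance as a gradient, so it drops out of the
  pairing with the solenoidal increment \<open>u(t) - u(s)\<close>.\<close>

lemma velocity_increment_le:
  assumes st: "s \<le> t" "s \<in> {0..b}" "t \<in> {0..b}"
  shows "(\<Sum>i\<in>UNIV. L2sq (\<lambda>x. u i t x - u i s x)) \<le> 3 * ((t - s)\<^sup>2 * KN)"
proof -
  have sub: "{s..t} \<subseteq> {0..b}" using st by auto
  let ?w = "\<lambda>i x. u i t x - u i s x"
  let ?V = "\<lambda>i x. integral {s..t} (\<lambda>\<tau>. gp i \<tau> x)"
  let ?\<Phi> = "\<lambda>i x. \<integral>\<tau>. indicator {s..t} \<tau> * N i \<tau> x \<partial>lborel"
  have Lw: "L2 (?w i)" for i by (intro L2_diff L2u st)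
  have cNst: "continuous_on ({s..t} \<times> UNIV) (\<lambda>(\<tau>, x). N i \<tau> x)" for i
    unfolding case_prod_beta using cN by (rule continuous_on_subset) (use sub in auto)
  have L\<Phi>: "L2 (?\<Phi> i)" "L2sq (?\<Phi> i) \<le> (t - s)\<^sup>2 * KN" for i
    using L2_time_integral[OF st(1) cNst[of i], of KN] L2_N sub by (auto simp: subset_iff)
  have V: "?V i x = - (?w i x + ?\<Phi> i x)" for i x
  proof -
    have N: "((\<lambda>\<tau>. N i \<tau> x) has_integral ?\<Phi> i x) {s..t}"
      using set_integral_eq_HK[OF time_slice[OF cN sub]] integrable_continuous_interval[OF time_slice[OF cN sub]]
      by (simp add: has_integral_integral)
    have U: "((\<lambda>\<tau>. ut i \<tau> x) has_integral ?w i x) {s..t}"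
    proof (rule fundamental_theorem_of_calculus[OF st(1)])
      fix \<tau> assume "\<tau> \<in> {s..t}"
      then have "((\<lambda>s. u i s x) has_real_derivative ut i \<tau> x) (at \<tau> within {s..t})"
        using sub by (intro DERIV_subset[OF tdu sub]) auto
      then show "((\<lambda>s. u i s x) has_vector_derivative ut i \<tau> x) (at \<tau> within {s..t})"
        by (simp add: has_real_derivative_iff_has_vector_derivative)
    qed
    have "((\<lambda>\<tau>. gp i \<tau> x) has_integral - (?w i x + ?\<Phi> i x)) {s..t}"
      by (rule has_integral_eq[OF _ has_integral_neg[OF has_integral_add[OF U N]]]) (use sub gp_eq in auto)
    then show ?thesis by (rule integral_unique)
  qed
  have LV: "L2 (?V i)" for i unfolding V by (intro L2_uminus L2_add Lw L\<Phi>)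
  have "(\<integral>x. (\<Sum>i\<in>UNIV. ?w i x * ?V i x) \<partial>lborel) = 0"
  proof (rule gradient_orthogonal_solenoidal)
    show "has_pd j (?w j) (\<lambda>x. Du j j t x - Du j j s x)" for j by (intro has_pd_diff pdu st)
    show "(\<Sum>j\<in>UNIV. Du j j t x - Du j j s x) = 0" for x using divu st by (simp add: sum_subtractf)
    show "continuous_on UNIV (?w j)" "continuous_on UNIV (\<lambda>x. Du j j t x - Du j j s x)" for j
      by (intro continuous_intros slice(1)[OF cu] slice(1)[OF cDu] st)+
  qed (use integrated_pressure[OF cgp dp sub] Lw LV in auto)
  then have z: "(\<Sum>i\<in>UNIV. \<integral>x. ?w i x * ?V i x \<partial>lborel) = 0"
    by (subst Bochner_Integration.integral_sum[symmetric]) (auto intro: L2_mult Lw LV)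
  have "L2sq (?w i) / 2 \<le> - (\<integral>x. ?w i x * ?V i x \<partial>lborel) + L2sq (?\<Phi> i) / 2" for i
  proof -
    have "L2sq (?w i) = (\<integral>x. (?w i x)\<^sup>2 \<partial>lborel)" by (simp add: L2sq_def)
    also have "\<dots> \<le> (\<integral>x. - (?w i x * ?V i x) + ((?w i x)\<^sup>2 + (?\<Phi> i x)\<^sup>2) / 2 \<partial>lborel)"
    proof (rule integral_mono)
      show "integrable lborel (\<lambda>x. (?w i x)\<^sup>2)" using L2_integrable[OF Lw[of i]] by simp
      show "integrable lborel (\<lambda>x. - (?w i x * ?V i x) + ((?w i x)\<^sup>2 + (?\<Phi> i x)\<^sup>2) / 2)"
        using L2_integrable[OF Lw[of i]] L2_integrable[OF L\<Phi>(1)[of i]] L2_mult[OF Lw[of i] LV[of i]] by simp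
      fix x
      have "a\<^sup>2 \<le> - (a * v) + (a\<^sup>2 + c\<^sup>2) / 2" if "v = - (a + c)" for a c v :: real
        using zero_le_power2[of "a + c"] unfolding that by (simp add: power2_eq_square field_simps)
      from this[OF V] show "(?w i x)\<^sup>2 \<le> - (?w i x * ?V i x) + ((?w i x)\<^sup>2 + (?\<Phi> i x)\<^sup>2) / 2" .
    qed
    also have "\<dots> = - (\<integral>x. ?w i x * ?V i x \<partial>lborel) + (L2sq (?w i) + L2sq (?\<Phi> i)) / 2"
      using L2_integrable[OF Lw[of i]] L2_integrable[OF L\<Phi>(1)[of i]] L2_mult[OF Lw[of i] LV[of i]]
      by (simp add: L2sq_def)
    finally show ?thesis by (simp add: add_divide_distrib)
  qed
  then have "(\<Sum>i\<in>UNIV. L2sq (?w i) / 2) \<le> (\<Sum>i\<in>UNIV. - (\<integral>x. ?w i x * ?V i x \<partial>lborel) + L2sq (?\<Phi> i) / 2)"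
    by (rule sum_mono)
  also have "\<dots> = (\<Sum>i\<in>UNIV. L2sq (?\<Phi> i) / 2)" using z by (simp add: sum.distrib sum_negf sum_subtractf)
  also have "\<dots> \<le> (\<Sum>i\<in>(UNIV::3 set). (t - s)\<^sup>2 * KN / 2)" using L\<Phi>(2) by (intro sum_mono divide_right_mono) auto
  finally show ?thesis by (simp add: sum_divide_distrib[symmetric])
qed

lemma L2_velocity_increment:
  assumes "s \<in> {0..b}" "t \<in> {0..b}"
  shows "L2sq (\<lambda>x. u i t x - u i s x) \<le> 3 * ((t - s)\<^sup>2 * KN)"
proof -
  have *: "L2sq (\<lambda>x. u i t x - u i s x) \<le> 3 * ((t - s)\<^sup>2 * KN)" if "s \<le> t" "s \<in> {0..b}" "t \<in> {0..b}" for s t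
  proof -
    have "L2sq (\<lambda>x. u i t x - u i s x) \<le> (\<Sum>i\<in>UNIV. L2sq (\<lambda>x. u i t x - u i s x))"
      by (rule member_le_sum) auto
    then show ?thesis using velocity_increment_le[OF that] by simp
  qed
  show ?thesis
  proof (cases "s \<le> t")
    case False
    have "L2sq (\<lambda>x. u i t x - u i s x) = L2sq (\<lambda>x. u i s x - u i t x)" by (simp add: L2sq_def abs_minus_commute power2_commute)
    then show ?thesis using *[of t s] False assms by (simp add: power2_commute[of t s])
  qed (use * assms in blast)
qed

text \<open>Difference quotients of the Lipschitz map \<open>t \<mapsto> u(t)\<close> are bounded in \<open>L\<^sup>2\<close> and converge
  pointwise, so Fatou's lemma puts \<open>u\<^sub>t\<close>, and with it the pressure gradient, into \<open>L\<^sup>2\<close>.\<close>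

lemma L2_ut:
  assumes t: "t \<in> {0..b}" shows "L2 (ut i t)" "L2sq (ut i t) \<le> 3 * KN"
proof -
  have [measurable]: "u i s \<in> borel_measurable borel" "ut i s \<in> borel_measurable borel" if "s \<in> {0..b}" for s
    by (rule slice(2)[OF cu that], rule slice(2)[OF cut that])
  have "t islimpt {0..b}" using b t by (simp add: islimpt_Icc)
  then obtain r where r: "\<And>n::nat. r n \<in> {0..b} - {t}" "r \<longlonglongrightarrow> t" by (auto simp: islimpt_sequential)
  let ?q = "\<lambda>n x. (u i (r n) x - u i t x) / (r n - t)"
  have q: "(\<integral>\<^sup>+x. ennreal ((norm (?q n x))\<^sup>2) \<partial>lborel) \<le> ennreal (3 * KN)" for n
  proof -
    have rn: "r n \<in> {0..b}" "r n \<noteq> t" using r(1)[of n] by auto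
    let ?d = "\<lambda>x. u i (r n) x - u i t x"
    have d: "L2 ?d" by (intro L2_diff L2u rn t)
    have m: "?q n \<in> borel_measurable borel" using L2_measurable[OF d] by simp
    have "L2 (?q n)" "L2sq (?q n) \<le> (1 / \<bar>r n - t\<bar>)\<^sup>2 * L2sq ?d"
      by (rule L2_mono[OF d m, where c = "1 / \<bar>r n - t\<bar>"], simp add: abs_divide)+
    moreover have "(1 / \<bar>r n - t\<bar>)\<^sup>2 * L2sq ?d \<le> (1 / \<bar>r n - t\<bar>)\<^sup>2 * (3 * ((r n - t)\<^sup>2 * KN))"
      by (intro mult_left_mono L2_velocity_increment rn t) simp
    moreover have "(1 / \<bar>r n - t\<bar>)\<^sup>2 * (3 * ((r n - t)\<^sup>2 * KN)) = 3 * KN"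
      using rn(2) by (simp add: power_divide)
    ultimately show ?thesis unfolding L2_nn[OF \<open>L2 (?q n)\<close>] by (intro ennreal_leI) linarith
  qed
  have lim: "(\<lambda>n. ?q n x) \<longlonglongrightarrow> ut i t x" for x
  proof -
    have "((\<lambda>s. (u i s x - u i t x) / (s - t)) \<longlongrightarrow> ut i t x) (at t within {0..b})"
      using tdu[OF t] by (simp add: has_field_derivative_iff)
    from filterlim_compose[OF this, of r sequentially] r
    show ?thesis by (simp add: filterlim_at)
  qed
  have rm: "?q n \<in> borel_measurable borel" for n
  proof -
    have rn: "r n \<in> {0..b}" using r(1)[of n] by auto
    show ?thesis using slice(2)[OF cu rn] slice(2)[OF cu t] by simp
  qed
  have "(\<integral>\<^sup>+x. ennreal ((norm (ut i t x))\<^sup>2) \<partial>lborel) = (\<integral>\<^sup>+x. liminf (\<lambda>n. ennreal ((norm (?q n x))\<^sup>2)) \<partial>lborel)"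
    by (intro nn_integral_cong lim_imp_Liminf[symmetric] tendsto_ennrealI tendsto_power tendsto_norm lim) simp
  also have "\<dots> \<le> liminf (\<lambda>n. \<integral>\<^sup>+x. ennreal ((norm (?q n x))\<^sup>2) \<partial>lborel)"
  proof (rule nn_integral_liminf)
    fix n
    note [measurable] = rm[of n]
    show "(\<lambda>x. ennreal ((norm (?q n x))\<^sup>2)) \<in> borel_measurable lborel" by measurable
  qed
  also have "\<dots> \<le> ennreal (3 * KN)"
    by (rule order_trans[OF Liminf_mono[OF always_eventually[OF allI[OF q]]]]) (simp add: Liminf_const)
  finally have *: "(\<integral>\<^sup>+x. ennreal ((norm (ut i t x))\<^sup>2) \<partial>lborel) \<le> ennreal (3 * KN)" .
  then show L: "L2 (ut i t)" unfolding L2_iff_nn using slice(2)[OF cut t] by (auto intro: le_less_trans)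
  from * show "L2sq (ut i t) \<le> 3 * KN" unfolding L2_nn[OF L] using KN_nonneg by simp
qed

lemma pressure_orthogonal:
  assumes t: "t \<in> {0..b}"
  shows "integrable lborel (\<lambda>x. \<Sum>i\<in>UNIV. u i t x * gp i t x)"
    "(\<integral>x. (\<Sum>i\<in>UNIV. u i t x * gp i t x) \<partial>lborel) = 0"
proof -
  have Lg: "L2 (gp i t)" for i
    using L2_uminus[OF L2_add(1)[OF L2_ut(1)[OF t] L2_N(1)[OF t]]] by (simp add: gp_eq[OF t, abs_def])
  show "integrable lborel (\<lambda>x. \<Sum>i\<in>UNIV. u i t x * gp i t x)"
    by (intro Bochner_Integration.integrable_sum L2_mult L2u t Lg)
  show "(\<integral>x. (\<Sum>i\<in>UNIV. u i t x * gp i t x) \<partial>lborel) = 0"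
  proof (rule gradient_orthogonal_solenoidal[where w = "\<lambda>j. u j t" and W = "\<lambda>j. Du j j t"
        and P = "p t" and V = "\<lambda>j. gp j t"])
    show "has_pd j (p t) (gp j t)" for j unfolding has_pd_def
    proof
      fix x
      have "((\<lambda>r. p t (x + r *\<^sub>R axis j 1)) has_derivative (\<lambda>h. \<Sum>i\<in>UNIV. gp i t (x + 0 *\<^sub>R axis j 1) * (h *\<^sub>R axis j 1) $ i)) (at 0)"
        by (rule has_derivative_compose[OF _ dp[OF t]]) (auto intro!: derivative_eq_intros)
      moreover have "(\<Sum>i\<in>UNIV. gp i t (x + 0 *\<^sub>R axis j 1) * (h *\<^sub>R axis j 1) $ i) = gp j t x * h" for h
        by (simp add: axis_def if_distrib cong: if_cong)
      ultimately show "((\<lambda>r. p t (x + r *\<^sub>R axis j 1)) has_real_derivative gp j t x) (at 0)"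
        by (simp add: has_field_derivative_def)
    qed
    show "continuous_on UNIV (p t)"
      using dp[OF t] by (auto simp: continuous_on_eq_continuous_at intro: has_derivative_continuous)
  qed (use pdu[OF t] slice(1)[OF cu t] slice(1)[OF cDu t] L2u(1)[OF t] divu[OF t] slice(1)[OF cgp t] Lg in auto)
qed

definition edens :: "real \<Rightarrow> real^3 \<Rightarrow> real" where
  "edens t x = (\<Sum>i\<in>UNIV. (u i t x)\<^sup>2) + (\<Sum>i\<in>UNIV. \<Sum>k\<in>UNIV. (f i k t x)\<^sup>2)"

definition edens_t :: "real \<Rightarrow> real^3 \<Rightarrow> real" where
  "edens_t t x = (\<Sum>i\<in>UNIV. 2 * (u i t x * ut i t x)) + (\<Sum>i\<in>UNIV. \<Sum>k\<in>UNIV. 2 * (f i k t x * ft i k t x))"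

text \<open>The negative of the energy flux: the work of the elastic stress \<open>F F\<^sup>T\<close> minus the transport of the energy
  density by \<open>u\<close>.\<close>

definition flux :: "3 \<Rightarrow> real \<Rightarrow> real^3 \<Rightarrow> real" where
  "flux j t x = (\<Sum>k\<in>UNIV. \<Sum>i\<in>UNIV. 2 * ((u i t x * f i k t x) * f j k t x)) - u j t x * edens t x"

definition edens_pd :: "3 \<Rightarrow> real \<Rightarrow> real^3 \<Rightarrow> real" where
  "edens_pd j t x = (\<Sum>i\<in>UNIV. Du j i t x * u i t x + u i t x * Du j i t x)
     + (\<Sum>i\<in>UNIV. \<Sum>k\<in>UNIV. Df j i k t x * f i k t x + f i k t x * Df j i k t x)"

definition flux_pd :: "3 \<Rightarrow> real \<Rightarrow> real^3 \<Rightarrow> real" where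
  "flux_pd j t x = (\<Sum>k\<in>UNIV. \<Sum>i\<in>UNIV. 2 * ((Du j i t x * f i k t x + u i t x * Df j i k t x) * f j k t x
        + (u i t x * f i k t x) * Df j j k t x))
     - (Du j j t x * edens t x + u j t x * edens_pd j t x)"

lemma has_pd_flux:
  assumes t: "t \<in> {0..b}" shows "has_pd j (flux j t) (flux_pd j t)"
proof -
  have "has_pd j (edens t) (edens_pd j t)"
    unfolding edens_def[abs_def] edens_pd_def[abs_def] power2_eq_square
    by (intro has_pd_add has_pd_sum has_pd_mult pdu[OF t] pdf[OF t])
  then show ?thesis
    unfolding flux_def[abs_def] flux_pd_def[abs_def]
    by (intro has_pd_diff has_pd_sum has_pd_cmult has_pd_mult pdu[OF t] pdf[OF t])
qed

text \<open>Pointwise energy balance: apart from the work of the pressure, the energy density changes by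
  a divergence.\<close>

lemma energy_balance:
  assumes t: "t \<in> {0..b}"
  shows "edens_t t x = (\<Sum>j\<in>UNIV. flux_pd j t x) - 2 * (\<Sum>i\<in>UNIV. u i t x * gp i t x)"
proof -
  have ut: "ut i t x = - gp i t x - (\<Sum>j\<in>UNIV. u j t x * Du j i t x) + (\<Sum>k\<in>UNIV. \<Sum>j\<in>UNIV. f j k t x * Df j i k t x)" for i
    using momentum[OF t, of i x] by simp
  have ft: "ft i k t x = (\<Sum>j\<in>UNIV. f j k t x * Du j i t x) - (\<Sum>j\<in>UNIV. u j t x * Df j i k t x)" for i k
    using transport[OF t, of i k x] by simp
  have "(\<Sum>j\<in>UNIV. flux_pd j t x) - 2 * (\<Sum>i\<in>UNIV. u i t x * gp i t x) - edens_t t x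
     = 2 * (\<Sum>k\<in>UNIV. (\<Sum>i\<in>UNIV. u i t x * f i k t x) * (\<Sum>j\<in>UNIV. Df j j k t x))
       - (\<Sum>j\<in>UNIV. Du j j t x) * edens t x"
    unfolding edens_t_def ut ft flux_pd_def edens_pd_def sum_3 by (simp add: algebra_simps)
  also have "\<dots> = 0" by (simp add: divu[OF t] divf[OF t])
  finally show ?thesis by simp
qed

lemma ft_eq: "t \<in> {0..b} \<Longrightarrow> ft i k t x = (\<Sum>j\<in>UNIV. f j k t x * Du j i t x) - (\<Sum>j\<in>UNIV. u j t x * Df j i k t x)"
  using transport[of t i k x] by simp

lemma cft: "continuous_on ({0..b} \<times> UNIV) (\<lambda>z. ft i k (fst z) (snd z))"
proof (rule continuous_on_eq)
  show "continuous_on ({0..b} \<times> UNIV) (\<lambda>z. (\<Sum>j\<in>UNIV. f j k (fst z) (snd z) * Du j i (fst z) (snd z))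
      - (\<Sum>j\<in>UNIV. u j (fst z) (snd z) * Df j i k (fst z) (snd z)))"
    by (intro continuous_intros cu cf cDu cDf)
qed (auto simp: ft_eq)

lemma L2_ft:
  assumes t: "t \<in> {0..b}" shows "L2 (ft i k t)" "L2sq (ft i k t) \<le> 36 * K^4"
proof -
  have 1: "L2 (\<lambda>x. f j k t x * Du j i t x)" "L2sq (\<lambda>x. f j k t x * Du j i t x) \<le> K^4" for j
    by (rule L2_times[where g = "f j k" and d = "Du j i", OF t L2f[OF t] BDu[OF t] slice(2)[OF cDu t]])+
  have 2: "L2 (\<lambda>x. u j t x * Df j i k t x)" "L2sq (\<lambda>x. u j t x * Df j i k t x) \<le> K^4" for j
    by (rule L2_times[where g = "u j" and d = "Df j i k", OF t L2u[OF t] BDf[OF t] slice(2)[OF cDf t]])+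
  have A: "L2 (\<lambda>x. \<Sum>j\<in>UNIV. f j k t x * Du j i t x)" "L2sq (\<lambda>x. \<Sum>j\<in>UNIV. f j k t x * Du j i t x) \<le> 9 * K^4"
    using L2_sum_bound[of UNIV "\<lambda>j x. f j k t x * Du j i t x" "K^4"] 1 by auto
  have B: "L2 (\<lambda>x. \<Sum>j\<in>UNIV. u j t x * Df j i k t x)" "L2sq (\<lambda>x. \<Sum>j\<in>UNIV. u j t x * Df j i k t x) \<le> 9 * K^4"
    using L2_sum_bound[of UNIV "\<lambda>j x. u j t x * Df j i k t x" "K^4"] 2 by auto
  have eq: "ft i k t = (\<lambda>x. (\<Sum>j\<in>UNIV. f j k t x * Du j i t x) - (\<Sum>j\<in>UNIV. u j t x * Df j i k t x))"
    using ft_eq[OF t] by blast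
  show "L2 (ft i k t)" "L2sq (ft i k t) \<le> 36 * K^4"
    unfolding eq using L2_diff[OF A(1) B(1)] A(2) B(2) by auto
qed

lemma integrable_flux:
  assumes t: "t \<in> {0..b}" shows "integrable lborel (flux j t)"
proof -
  have 1: "L2 (\<lambda>x. u i t x * f i k t x)" "L2 (\<lambda>x. u i t x * u j t x)" "L2 (\<lambda>x. f i k t x * u j t x)" for i k
    by (rule L2_times(1)[where g = "u i" and d = "f i k", OF t L2u[OF t] Bf[OF t] slice(2)[OF cf t]],
        rule L2_times(1)[where g = "u i" and d = "u j", OF t L2u[OF t] Bu[OF t] slice(2)[OF cu t]],
        rule L2_times(1)[where g = "f i k" and d = "u j", OF t L2f[OF t] Bu[OF t] slice(2)[OF cu t]])
  have eq: "flux j t = (\<lambda>x. (\<Sum>k\<in>UNIV. \<Sum>i\<in>UNIV. 2 * ((u i t x * f i k t x) * f j k t x))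
     - ((\<Sum>i\<in>UNIV. (u i t x * u j t x) * u i t x) + (\<Sum>i\<in>UNIV. \<Sum>k\<in>UNIV. (f i k t x * u j t x) * f i k t x)))"
    by (rule ext) (simp add: flux_def edens_def distrib_left sum_distrib_left power2_eq_square ac_simps)
  show ?thesis unfolding eq
    by (intro Bochner_Integration.integrable_diff Bochner_Integration.integrable_add
        Bochner_Integration.integrable_sum integrable_mult_right L2_mult 1 L2u(1)[OF t] L2f(1)[OF t])
qed

lemma integrable_edens:
  assumes t: "t \<in> {0..b}" shows "integrable lborel (edens t)"
  unfolding edens_def[abs_def] power2_eq_square
  by (intro Bochner_Integration.integrable_add Bochner_Integration.integrable_sum L2_mult L2u(1)[OF t] L2f(1)[OF t])

definition KE :: real where "KE = 3 * (K\<^sup>2 + 3 * KN) + 9 * (K\<^sup>2 + 36 * K^4)"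

text \<open>The work of the pressure vanishes by orthogonality, and the rest of the balance is the divergence of
  the integrable field \<open>flux\<close>. The uniform bound is what Fubini's theorem in time requires.\<close>

lemma edens_t_integral:
  assumes t: "t \<in> {0..b}"
  shows "integrable lborel (edens_t t)" "(\<integral>x. edens_t t x \<partial>lborel) = 0" "(\<integral>x. \<bar>edens_t t x\<bar> \<partial>lborel) \<le> KE"
proof -
  note P = pressure_orthogonal[OF t]
  show i: "integrable lborel (edens_t t)"
    unfolding edens_t_def[abs_def]
    by (intro Bochner_Integration.integrable_add Bochner_Integration.integrable_sum integrable_mult_right
        L2_mult L2u(1)[OF t] L2f(1)[OF t] L2_ut(1)[OF t] L2_ft(1)[OF t])
  have div: "(\<Sum>j\<in>UNIV. flux_pd j t x) = edens_t t x + 2 * (\<Sum>i\<in>UNIV. u i t x * gp i t x)" for x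
    using energy_balance[OF t, of x] by simp
  have fl: "integrable lborel (\<lambda>x. \<Sum>j\<in>UNIV. flux_pd j t x)" unfolding div using i P(1) by simp
  have c: "continuous_on UNIV (u i t)" "continuous_on UNIV (f i k t)" "continuous_on UNIV (Du j i t)"
    "continuous_on UNIV (Df j i k t)" for i j k
    by (intro slice(1)[OF cu t] slice(1)[OF cf t] slice(1)[OF cDu t] slice(1)[OF cDf t])+
  have "(\<integral>x. (\<Sum>j\<in>UNIV. flux_pd j t x) \<partial>lborel) = 0"
  proof (rule integral_divergence_eq_0[OF has_pd_flux[OF t] _ _ integrable_flux[OF t] fl])
    show "continuous_on UNIV (flux j t)" "continuous_on UNIV (flux_pd j t)" for j
      unfolding flux_def[abs_def] flux_pd_def[abs_def] edens_def edens_pd_def by (intro continuous_intros c)+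
  qed
  then show "(\<integral>x. edens_t t x \<partial>lborel) = 0" unfolding div using i P by simp
  have pt: "\<bar>edens_t t x\<bar> \<le> (\<Sum>i\<in>UNIV. (u i t x)\<^sup>2 + (ut i t x)\<^sup>2) + (\<Sum>i\<in>UNIV. \<Sum>k\<in>UNIV. (f i k t x)\<^sup>2 + (ft i k t x)\<^sup>2)" for x
  proof -
    have ab: "\<bar>2 * (a * c)\<bar> \<le> a\<^sup>2 + c\<^sup>2" for a c :: real
      using zero_le_power2[of "a + c"] zero_le_power2[of "a - c"] unfolding power2_sum power2_diff by (simp add: abs_le_iff)
    show ?thesis unfolding edens_t_def
      by (intro order_trans[OF abs_triangle_ineq] add_mono order_trans[OF sum_abs] sum_mono ab)
  qed
  have sqi: "integrable lborel (\<lambda>x. (u i t x)\<^sup>2)" "integrable lborel (\<lambda>x. (ut i t x)\<^sup>2)"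
    "integrable lborel (\<lambda>x. (f i k t x)\<^sup>2)" "integrable lborel (\<lambda>x. (ft i k t x)\<^sup>2)" for i k
    using L2_integrable[OF L2u(1)[OF t]] L2_integrable[OF L2f(1)[OF t]]
      L2_integrable[OF L2_ut(1)[OF t]] L2_integrable[OF L2_ft(1)[OF t]] by simp_all
  have "(\<integral>x. \<bar>edens_t t x\<bar> \<partial>lborel) \<le> (\<integral>x. (\<Sum>i\<in>UNIV. (u i t x)\<^sup>2 + (ut i t x)\<^sup>2) + (\<Sum>i\<in>UNIV. \<Sum>k\<in>UNIV. (f i k t x)\<^sup>2 + (ft i k t x)\<^sup>2) \<partial>lborel)"
    by (intro integral_mono integrable_abs i pt Bochner_Integration.integrable_add Bochner_Integration.integrable_sum sqi)
  also have "\<dots> = (\<Sum>i\<in>UNIV. L2sq (u i t) + L2sq (ut i t)) + (\<Sum>i\<in>UNIV. \<Sum>k\<in>UNIV. L2sq (f i k t) + L2sq (ft i k t))"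
    using sqi unfolding L2sq_def by (simp add: Bochner_Integration.integral_add Bochner_Integration.integral_sum)
  also have "\<dots> \<le> (\<Sum>i\<in>(UNIV::3 set). K\<^sup>2 + 3 * KN) + (\<Sum>i\<in>(UNIV::3 set). \<Sum>k\<in>(UNIV::3 set). K\<^sup>2 + 36 * K^4)"
    by (intro add_mono sum_mono L2u(2)[OF t] L2f(2)[OF t] L2_ut(2)[OF t] L2_ft(2)[OF t])
  finally show "(\<integral>x. \<bar>edens_t t x\<bar> \<partial>lborel) \<le> KE" by (simp add: KE_def)
qed

text \<open>The pointwise change of the energy density over \<open>[s, t]\<close> is the time integral of \<open>edens_t\<close>; by Fubini's
  theorem its integral over space is a time integral of zeros.\<close>

theorem energy_conserved:
  assumes st: "s \<le> t" "{s..t} \<subseteq> {0..b}"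
  shows "(\<integral>x. edens t x \<partial>lborel) = (\<integral>x. edens s x \<partial>lborel)"
proof -
  have sb: "s \<in> {0..b}" and tb: "t \<in> {0..b}" using st by auto
  have ce: "continuous_on ({0..b} \<times> UNIV) (\<lambda>z. edens_t (fst z) (snd z))"
    unfolding edens_t_def by (intro continuous_intros cu cf cut cft)
  have m: "(\<lambda>(\<tau>, x). indicator {s..t} \<tau> * edens_t \<tau> x) \<in> borel_measurable (lborel \<Otimes>\<^sub>M lborel)"
    by (rule measurable_slice, unfold case_prod_beta, rule continuous_on_subset[OF ce]) (use st(2) in auto)
  have pt: "(\<integral>\<tau>. indicator {s..t} \<tau> * edens_t \<tau> x \<partial>lborel) = edens t x - edens s x" for x
  proof -
    have "((\<lambda>\<tau>. edens_t \<tau> x) has_integral edens t x - edens s x) {s..t}"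
    proof (rule fundamental_theorem_of_calculus[OF st(1)])
      fix \<tau> assume "\<tau> \<in> {s..t}"
      then have \<tau>: "\<tau> \<in> {0..b}" using st by auto
      have "((\<lambda>\<tau>. edens \<tau> x) has_real_derivative edens_t \<tau> x) (at \<tau> within {0..b})"
        unfolding edens_def edens_t_def
        by (intro DERIV_add DERIV_sum) (auto intro!: derivative_eq_intros tdu[OF \<tau>] tdf[OF \<tau>])
      then show "((\<lambda>\<tau>. edens \<tau> x) has_vector_derivative edens_t \<tau> x) (at \<tau> within {s..t})"
        using DERIV_subset[OF _ st(2)] by (simp add: has_real_derivative_iff_has_vector_derivative)
    qed
    then show ?thesis using set_integral_eq_HK[OF time_slice[OF ce st(2)], of x] by (simp add: integral_unique)
  qed
  have "integrable (lborel \<Otimes>\<^sub>M lborel) (\<lambda>(\<tau>, x). indicator {s..t} \<tau> * edens_t \<tau> x)"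
  proof (rule lborel_pair.Fubini_integrable[OF m])
    let ?I = "\<lambda>\<tau>. \<integral>x. norm (case (\<tau>, x) of (\<tau>, x) \<Rightarrow> indicator {s..t} \<tau> * edens_t \<tau> x) \<partial>lborel"
    show "integrable lborel ?I"
    proof (rule Bochner_Integration.integrable_bound)
      show "integrable lborel (\<lambda>\<tau>. indicator {s..t} \<tau> *\<^sub>R KE)" by (rule borel_integrable_compact) auto
      show "?I \<in> borel_measurable lborel"
        by (rule lborel.borel_measurable_lebesgue_integral) (use m in measurable)
      show "AE \<tau> in lborel. norm (?I \<tau>) \<le> norm (indicator {s..t} \<tau> *\<^sub>R KE)"
      proof (rule AE_I2)
        fix \<tau>
        show "norm (?I \<tau>) \<le> norm (indicator {s..t} \<tau> *\<^sub>R KE)"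
          using edens_t_integral(3)[of \<tau>] st(2) by (cases "\<tau> \<in> {s..t}") (auto simp: subset_iff)
      qed
    qed
    have "integrable lborel (\<lambda>x. indicator {s..t} \<tau> * edens_t \<tau> x)" for \<tau>
      using edens_t_integral(1)[of \<tau>] st(2) by (cases "\<tau> \<in> {s..t}") auto
    then show "AE \<tau> in lborel. integrable lborel (\<lambda>x. case (\<tau>, x) of (\<tau>, x) \<Rightarrow> indicator {s..t} \<tau> * edens_t \<tau> x)" by simp
  qed
  from lborel_pair.Fubini_integral[OF this]
  have "(\<integral>x. edens t x - edens s x \<partial>lborel) = (\<integral>\<tau>. indicator {s..t} \<tau> * (\<integral>x. edens_t \<tau> x \<partial>lborel) \<partial>lborel)"
    unfolding pt by simp
  also have "\<dots> = integral\<^sup>L lborel (\<lambda>\<tau>::real. 0::real)"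
    using st(2) edens_t_integral(2) by (intro Bochner_Integration.integral_cong) (auto simp: indicator_def)
  finally show ?thesis using integrable_edens[OF sb] integrable_edens[OF tb] by simp
qed

end

lemma at_within_Ico_neq_bot:
  assumes "t \<in> {0..<T::real}" shows "at t within {0..<T} \<noteq> bot"
proof -
  have "t islimpt {t..(t + T) / 2}" using assms by (simp add: islimpt_Icc)
  then have "t islimpt {0..<T}" by (rule islimpt_subset) (use assms in auto)
  then show ?thesis by (simp add: trivial_limit_within)
qed

lemma C1_on_slices:
  fixes g :: "real \<Rightarrow> real^3 \<Rightarrow> 'b::euclidean_space"
  assumes "C1_on ({0..<T} \<times> UNIV) (\<lambda>(t, x). g t x)"
  shows "\<And>t x. t \<in> {0..<T} \<Longrightarrow> g t differentiable (at x)"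
    and "\<And>j. continuous_on ({0..<T} \<times> UNIV) (\<lambda>z. partial_deriv j (g (fst z)) (snd z))"
    and "\<And>t x. t \<in> {0..<T} \<Longrightarrow>
      ((\<lambda>s. g s x) has_vector_derivative vector_derivative (\<lambda>s. g s x) (at t within {0..<T})) (at t within {0..<T})"
    and "continuous_on ({0..<T} \<times> UNIV) (\<lambda>z. vector_derivative (\<lambda>s. g s (snd z)) (at (fst z) within {0..<T}))"
    and "continuous_on ({0..<T} \<times> UNIV) (\<lambda>z. g (fst z) (snd z))"
proof -
  let ?S = "{0..<T} \<times> (UNIV :: (real^3) set)"
  obtain g' where d: "\<And>z. z \<in> ?S \<Longrightarrow> ((\<lambda>(t, x). g t x) has_derivative blinfun_apply (g' z)) (at z within ?S)"
    and c: "continuous_on ?S g'"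
    using assms unfolding C1_on_def by blast
  have cv: "continuous_on ?S (\<lambda>z. g' z v)" for v
    by (intro bounded_bilinear.continuous_on[OF bounded_bilinear_blinfun_apply] c continuous_on_const)
  have dx: "(g t has_derivative (\<lambda>v. g' (t, x) (0, v))) (at x)" if "t \<in> {0..<T}" for t x
  proof -
    have "(Pair t has_derivative (\<lambda>v. (0, v))) (at x within UNIV)" by (auto intro!: derivative_eq_intros)
    from has_derivative_in_compose[OF this, of "\<lambda>(t, x). g t x" "blinfun_apply (g' (t, x))"]
      has_derivative_subset[OF d[of "(t, x)"], of "range (Pair t)"] that
    show ?thesis by (simp add: image_subset_iff)
  qed
  have pd: "partial_deriv j (g t) x = g' (t, x) (0, axis j 1)" if "t \<in> {0..<T}" for t x j
    unfolding partial_deriv_def frechet_derivative_at[OF dx[OF that], symmetric] ..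
  have dt: "((\<lambda>s. g s x) has_vector_derivative g' (t, x) (1, 0)) (at t within {0..<T})" if "t \<in> {0..<T}" for t x
  proof -
    have "((\<lambda>s. (s, x)) has_derivative (\<lambda>h. (h, 0))) (at t within {0..<T})" by (auto intro!: derivative_eq_intros)
    from has_derivative_in_compose[OF this, of "\<lambda>(t, x). g t x" "blinfun_apply (g' (t, x))"]
      has_derivative_subset[OF d[of "(t, x)"], of "(\<lambda>s. (s, x)) ` {0..<T}"] that
    have D: "((\<lambda>s. g s x) has_derivative (\<lambda>h. g' (t, x) (h, 0))) (at t within {0..<T})"
      by (simp add: image_subset_iff)
    have "g' (t, x) (h, 0) = h *\<^sub>R g' (t, x) (1, 0)" for h
      using blinfun.scaleR_right[of "g' (t, x)" h "(1, 0)"] by simp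
    then have eq: "(\<lambda>h. g' (t, x) (h, 0)) = (\<lambda>h. h *\<^sub>R g' (t, x) (1, 0))" by (rule ext)
    from D show ?thesis unfolding eq has_vector_derivative_def .
  qed
  have vd: "vector_derivative (\<lambda>s. g s x) (at t within {0..<T}) = g' (t, x) (1, 0)" if "t \<in> {0..<T}" for t x
    by (rule vector_derivative_within[OF at_within_Ico_neq_bot[OF that] dt[OF that]])
  show "\<And>t x. t \<in> {0..<T} \<Longrightarrow> g t differentiable (at x)" using dx by (auto simp: differentiable_def)
  show "continuous_on ?S (\<lambda>z. partial_deriv j (g (fst z)) (snd z))" for j
    by (rule continuous_on_eq[OF cv]) (auto simp: pd)
  show "\<And>t x. t \<in> {0..<T} \<Longrightarrow>
      ((\<lambda>s. g s x) has_vector_derivative vector_derivative (\<lambda>s. g s x) (at t within {0..<T})) (at t within {0..<T})"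
    using dt vd by simp
  show "continuous_on ?S (\<lambda>z. vector_derivative (\<lambda>s. g s (snd z)) (at (fst z) within {0..<T}))"
    by (rule continuous_on_eq[OF cv]) (auto simp: vd)
  have "continuous_on ?S (\<lambda>(t, x). g t x)"
    using has_derivative_continuous[OF d] by (auto simp: continuous_on_eq_continuous_within)
  then show "continuous_on ?S (\<lambda>z. g (fst z) (snd z))" by (simp add: case_prod_beta)
qed

lemma has_derivative_partials:
  fixes f :: "real^3 \<Rightarrow> 'b::real_normed_vector"
  assumes "f differentiable (at x)"
  shows "(f has_derivative (\<lambda>v. \<Sum>j\<in>UNIV. (v $ j) *\<^sub>R partial_deriv j f x)) (at x)"
proof -
  have d: "(f has_derivative frechet_derivative f (at x)) (at x)" using assms by (simp add: frechet_derivative_works)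
  then interpret linear "frechet_derivative f (at x)" by (rule has_derivative_linear)
  have "frechet_derivative f (at x) v = (\<Sum>j\<in>UNIV. (v $ j) *\<^sub>R partial_deriv j f x)" for v
  proof -
    have "v = (\<Sum>j\<in>UNIV. (v $ j) *\<^sub>R axis j 1)"
      using basis_expansion[of v] by (simp add: scalar_mult_eq_scaleR)
    then have "frechet_derivative f (at x) v = frechet_derivative f (at x) (\<Sum>j\<in>UNIV. (v $ j) *\<^sub>R axis j 1)" by simp
    then show ?thesis by (simp add: sum scale partial_deriv_def)
  qed
  then show ?thesis using d by (metis (no_types, lifting) ext)
qed

lemma partial_deriv_eqI:
  assumes "(f has_derivative f') (at x)" shows "partial_deriv j f x = f' (axis j 1)"
  unfolding partial_deriv_def frechet_derivative_at[OF assms, symmetric] ..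

lemma partial_deriv_linear:
  assumes l: "bounded_linear l" and f: "f differentiable (at x)"
  shows "partial_deriv j (\<lambda>y. l (f y)) x = l (partial_deriv j f x)"
  using partial_deriv_eqI[OF bounded_linear.has_derivative[OF l frechet_derivative_works[THEN iffD1, OF f]], of j] 
  by (simp add: partial_deriv_def)

lemma has_pd_partial_deriv:
  fixes f :: "real^3 \<Rightarrow> 'b::real_normed_vector"
  assumes l: "bounded_linear l" and f: "\<And>x. f differentiable (at x)"
  shows "has_pd j (\<lambda>x. l (f x)) (\<lambda>x. l (partial_deriv j f x))"
  unfolding has_pd_def
proof
  fix x
  have d: "(f has_derivative frechet_derivative f (at x)) (at (x + 0 *\<^sub>R axis j 1))"
    using f[of x] by (simp add: frechet_derivative_works)
  have "((\<lambda>r. x + r *\<^sub>R axis j 1) has_derivative (\<lambda>h. h *\<^sub>R axis j 1)) (at 0)"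
    by (auto intro!: derivative_eq_intros)
  from bounded_linear.has_derivative[OF l has_derivative_compose[OF this d]]
  have "((\<lambda>r. l (f (x + r *\<^sub>R axis j 1))) has_derivative (\<lambda>h. l (frechet_derivative f (at x) (h *\<^sub>R axis j 1)))) (at 0)" .
  moreover have c: "frechet_derivative f (at x) (h *\<^sub>R axis j 1) = h *\<^sub>R partial_deriv j f x" for h
    unfolding partial_deriv_def using linear_frechet_derivative[OF f] by (rule linear_cmul)
  moreover have "(\<lambda>h. l (frechet_derivative f (at x) (h *\<^sub>R axis j 1))) = (*) (l (partial_deriv j f x))"
    using l by (intro ext) (simp add: c linear_simps)
  ultimately show "((\<lambda>r. l (f (x + r *\<^sub>R axis j 1))) has_real_derivative l (partial_deriv j f x)) (at 0)"
    by (simp add: has_field_derivative_def mult.commute)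
qed

lemma has_pd_bound:
  assumes pd: "has_pd j f D" and L: "\<And>x y. \<bar>f x - f y\<bar> \<le> K * norm (x - y)"
  shows "\<bar>D x\<bar> \<le> K"
proof -
  have "((\<lambda>h. (f (x + h *\<^sub>R axis j 1) - f x) / h) \<longlongrightarrow> D x) (at 0)"
    using pd by (auto simp: has_pd_def DERIV_def)
  from tendsto_rabs[OF this]
  show ?thesis
  proof (rule tendsto_upperbound)
    have "\<forall>\<^sub>F h in at (0::real). h \<noteq> 0" by (simp add: eventually_at_filter)
    then show "\<forall>\<^sub>F h in at 0. \<bar>(f (x + h *\<^sub>R axis j 1) - f x) / h\<bar> \<le> K"
    proof eventually_elim
      case (elim h)
      then show ?case using L[of "x + h *\<^sub>R axis j 1" x] by (simp add: abs_divide divide_le_eq)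
    qed
  qed simp
qed


lemma L2_linear_bound:
  fixes g :: "real^3 \<Rightarrow> 'b::euclidean_space"
  assumes l: "bounded_linear l" "\<And>v. \<bar>l v\<bar> \<le> norm v" and g: "L2_Lip_bound K g"
  shows "L2 (\<lambda>x. l (g x))" "L2sq (\<lambda>x. l (g x)) \<le> K\<^sup>2" "\<bar>l (g x)\<bar> \<le> K"
    "\<bar>l (g x) - l (g y)\<bar> \<le> K * norm (x - y)"
proof -
  note G = g[unfolded L2_Lip_bound_def]
  have m: "(\<lambda>x. l (g x)) \<in> borel_measurable borel"
    using L2_measurable[of g] G by (intro borel_measurable_continuous_on[OF bounded_linear.continuous_on[OF l(1)]]) auto
  have le: "norm (l (g x)) \<le> 1 * norm (g x)" for x using l(2) by simp
  show "L2 (\<lambda>x. l (g x))" "L2sq (\<lambda>x. l (g x)) \<le> K\<^sup>2"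
    using L2_mono[OF _ m le] G by auto
  show "\<bar>l (g x)\<bar> \<le> K" using G l(2) by (blast intro: order_trans)
  have "l (g x) - l (g y) = l (g x - g y)" using l(1) by (simp add: linear_simps)
  then show "\<bar>l (g x) - l (g y)\<bar> \<le> K * norm (x - y)" using G l(2) order_trans by metis
qed

lemma norm_sq_vec: "(norm v)\<^sup>2 = (\<Sum>i\<in>UNIV. (norm (v $ i))\<^sup>2)" for v :: "'a::real_normed_vector^'n"
  by (simp add: norm_vec_def L2_set_def sum_nonneg)

lemma bounded_linear_column: "bounded_linear (column k :: real^'n^'m \<Rightarrow> real^'m)"
  by (intro linear_conv_bounded_linear[THEN iffD1] linearI) (simp_all add: column_def vec_eq_iff)

lemma bounded_linear_entry: "bounded_linear (\<lambda>A::real^'n^'m. A $ i $ k)"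
  by (rule bounded_linear_compose[OF bounded_linear_vec_nth bounded_linear_vec_nth])

text \<open>The Sobolev embedding supplies the bounds of \<open>viscoelastic_flow\<close> on every compact subinterval
  \<open>[0, t]\<close> of \<open>[0, T)\<close>.\<close>

theorem viscoelastic_energy_conserved:
  assumes m: "m > 5/2" and cu: "continuous_sobolev {0..<T} m u" and cF: "continuous_sobolev {0..<T} m F"
    and sol: "viscoelastic_solution {0..<T} u0 F0 u F" and t: "t \<in> {0<..<T}"
  shows "L2sq (u t) + L2sq (F t) = L2sq (u 0) + L2sq (F 0)"
proof -
  have Cu: "C1_on ({0..<T} \<times> UNIV) (\<lambda>(t, x). u t x)" and CF: "C1_on ({0..<T} \<times> UNIV) (\<lambda>(t, x). F t x)"
    using sol by (auto simp: viscoelastic_solution_def)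
  note U = C1_on_slices[OF Cu] and V = C1_on_slices[OF CF]
  have cont: "continuous_on UNIV (u s)" "continuous_on UNIV (F s)" if "s \<in> {0..<T}" for s
    using U(1)[OF that] V(1)[OF that] by (auto simp: continuous_on_eq_continuous_at intro: differentiable_imp_continuous_within)
  obtain K1 where K1: "\<And>s. s \<in> {0..t} \<Longrightarrow> L2_Lip_bound K1 (u s)"
    by (rule continuous_sobolev_bounded[OF m cu, of t]) (use cont t in auto)
  obtain K2 where K2: "\<And>s. s \<in> {0..t} \<Longrightarrow> L2_Lip_bound K2 (F s)"
    by (rule continuous_sobolev_bounded[OF m cF, of t]) (use cont t in auto)
  define K where "K = max K1 K2"
  have Ku: "L2_Lip_bound K (u s)" and KF: "L2_Lip_bound K (F s)" if "s \<in> {0..t}" for s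
    using L2_Lip_bound_mono[OF K1[OF that]] L2_Lip_bound_mono[OF K2[OF that]] by (auto simp: K_def)
  obtain p where p: "\<And>s. s \<in> {0..<T} \<Longrightarrow> p s differentiable_on UNIV"
    and mom: "\<And>s x. s \<in> {0..<T} \<Longrightarrow> vector_derivative (\<lambda>s. u s x) (at s within {0..<T}) + advect (u s) (u s) x =
          - grad (p s) x + (\<Sum>k\<in>UNIV. advect (\<lambda>y. column k (F s y)) (\<lambda>y. column k (F s y)) x)"
    using sol unfolding viscoelastic_solution_def by blast
  have tra: "vector_derivative (\<lambda>s. column k (F s x)) (at s within {0..<T}) + advect (u s) (\<lambda>y. column k (F s y)) x =
        advect (\<lambda>y. column k (F s y)) (u s) x"
    and dvu: "divergence (u s) x = 0" and dvF: "divergence (\<lambda>y. column k (F s y)) x = 0" if "s \<in> {0..<T}" for s x k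
    using sol that unfolding viscoelastic_solution_def by blast+
  have pdc: "partial_deriv j (\<lambda>y. column k (F s y)) x = column k (partial_deriv j (F s) x)" if "s \<in> {0..<T}" for s j k x
    by (rule partial_deriv_linear[OF bounded_linear_column V(1)[OF that]])
  have vdc: "vector_derivative (\<lambda>s. column k (F s x)) (at s within {0..<T}) =
      column k (vector_derivative (\<lambda>s. F s x) (at s within {0..<T}))" if "s \<in> {0..<T}" for s k x
    by (rule vector_derivative_within[OF at_within_Ico_neq_bot[OF that]])
       (rule bounded_linear.has_vector_derivative[OF bounded_linear_column V(3)[OF that]])
  have sub: "{0..t} \<subseteq> {0..<T}" using t by auto
  have sub2: "{0..t} \<times> UNIV \<subseteq> {0..<T} \<times> (UNIV :: (real^3) set)" using sub by auto
  have cc: "column k A $ i = A $ i $ k" for A :: "real^3^3" and i k by (simp add: column_def)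
  have bn: "\<bar>v $ i\<bar> \<le> norm v" for v :: "real^3" and i by (rule component_le_norm_cart)
  have be: "\<bar>A $ i $ k\<bar> \<le> norm A" for A :: "real^3^3" and i k
    by (rule order_trans[OF component_le_norm_cart Finite_Cartesian_Product.norm_nth_le])
  interpret viscoelastic_flow t K "\<lambda>i s x. u s x $ i"
    "\<lambda>i s x. vector_derivative (\<lambda>s. u s x) (at s within {0..<T}) $ i" "\<lambda>j i s x. partial_deriv j (u s) x $ i"
    "\<lambda>i k s x. F s x $ i $ k" "\<lambda>i k s x. vector_derivative (\<lambda>s. F s x) (at s within {0..<T}) $ i $ k"
    "\<lambda>j i k s x. partial_deriv j (F s) x $ i $ k" p "\<lambda>j s x. partial_deriv j (p s) x"
  proof
    show "0 < t" using t by simp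
    show "continuous_on ({0..t} \<times> UNIV) (\<lambda>z. u (fst z) (snd z) $ i)"
      "continuous_on ({0..t} \<times> UNIV) (\<lambda>z. vector_derivative (\<lambda>s. u s (snd z)) (at (fst z) within {0..<T}) $ i)"
      "continuous_on ({0..t} \<times> UNIV) (\<lambda>z. partial_deriv j (u (fst z)) (snd z) $ i)"
      "continuous_on ({0..t} \<times> UNIV) (\<lambda>z. F (fst z) (snd z) $ i $ k)"
      "continuous_on ({0..t} \<times> UNIV) (\<lambda>z. partial_deriv j (F (fst z)) (snd z) $ i $ k)" for i j k
      by (intro continuous_intros continuous_on_subset[OF U(5) sub2] continuous_on_subset[OF U(4) sub2]
          continuous_on_subset[OF U(2) sub2] continuous_on_subset[OF V(5) sub2] continuous_on_subset[OF V(2) sub2])+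
  next
    fix s i j k and x :: "real^3" assume s: "s \<in> {0..t}"
    then have sT: "s \<in> {0..<T}" using sub by auto
    show pu: "has_pd j (\<lambda>x. u s x $ i) (\<lambda>x. partial_deriv j (u s) x $ i)"
      by (rule has_pd_partial_deriv[OF bounded_linear_vec_nth U(1)[OF sT]])
    show pF: "has_pd j (\<lambda>x. F s x $ i $ k) (\<lambda>x. partial_deriv j (F s) x $ i $ k)"
      by (rule has_pd_partial_deriv[OF bounded_linear_entry V(1)[OF sT]])
    have "((\<lambda>s. u s x $ i) has_vector_derivative vector_derivative (\<lambda>s. u s x) (at s within {0..<T}) $ i) (at s within {0..<T})"
      by (rule bounded_linear.has_vector_derivative[OF bounded_linear_vec_nth U(3)[OF sT]])
    then show "((\<lambda>s. u s x $ i) has_real_derivative vector_derivative (\<lambda>s. u s x) (at s within {0..<T}) $ i) (at s within {0..t})"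
      using DERIV_subset[OF _ sub] by (simp add: has_real_derivative_iff_has_vector_derivative)
    have "((\<lambda>s. F s x $ i $ k) has_vector_derivative vector_derivative (\<lambda>s. F s x) (at s within {0..<T}) $ i $ k) (at s within {0..<T})"
      by (rule bounded_linear.has_vector_derivative[OF bounded_linear_entry V(3)[OF sT]])
    then show "((\<lambda>s. F s x $ i $ k) has_real_derivative vector_derivative (\<lambda>s. F s x) (at s within {0..<T}) $ i $ k) (at s within {0..t})"
      using DERIV_subset[OF _ sub] by (simp add: has_real_derivative_iff_has_vector_derivative)
    show "vector_derivative (\<lambda>s. u s x) (at s within {0..<T}) $ i + (\<Sum>j\<in>UNIV. u s x $ j * partial_deriv j (u s) x $ i) =
        - partial_deriv i (p s) x + (\<Sum>k\<in>UNIV. \<Sum>j\<in>UNIV. F s x $ j $ k * partial_deriv j (F s) x $ i $ k)"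
      using arg_cong[OF mom[OF sT, of x], of "\<lambda>v. v $ i"]
      by (simp add: advect_def grad_def pdc[OF sT] cc)
    show "vector_derivative (\<lambda>s. F s x) (at s within {0..<T}) $ i $ k + (\<Sum>j\<in>UNIV. u s x $ j * partial_deriv j (F s) x $ i $ k) =
        (\<Sum>j\<in>UNIV. F s x $ j $ k * partial_deriv j (u s) x $ i)"
      using arg_cong[OF tra[OF sT, of k x], of "\<lambda>v. v $ i"]
      by (simp add: advect_def pdc[OF sT] vdc[OF sT] cc)
    show "(\<Sum>j\<in>UNIV. partial_deriv j (u s) x $ j) = 0" using dvu[OF sT] by (simp add: divergence_def)
    show "(\<Sum>j\<in>UNIV. partial_deriv j (F s) x $ j $ k) = 0"
      using dvF[OF sT, of k x] by (simp add: divergence_def pdc[OF sT] cc)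
    have "p s differentiable (at x)" using p[OF sT] by (simp add: differentiable_on_def)
    from has_derivative_partials[OF this]
    show "(p s has_derivative (\<lambda>v. \<Sum>j\<in>UNIV. partial_deriv j (p s) x * v $ j)) (at x)" by (simp add: mult.commute)
    note Lu = L2_linear_bound[where l = "\<lambda>v. v $ i", OF bounded_linear_vec_nth bn Ku[OF s]]
    note LF = L2_linear_bound[where l = "\<lambda>A. A $ i $ k", OF bounded_linear_entry be KF[OF s]]
    show "L2 (\<lambda>x. u s x $ i)" "L2sq (\<lambda>x. u s x $ i) \<le> K\<^sup>2" "\<bar>u s x $ i\<bar> \<le> K" by (rule Lu)+
    show "L2 (\<lambda>x. F s x $ i $ k)" "L2sq (\<lambda>x. F s x $ i $ k) \<le> K\<^sup>2" "\<bar>F s x $ i $ k\<bar> \<le> K" by (rule LF)+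
    show "\<bar>partial_deriv j (u s) x $ i\<bar> \<le> K" by (rule has_pd_bound[OF pu Lu(4)])
    show "\<bar>partial_deriv j (F s) x $ i $ k\<bar> \<le> K" by (rule has_pd_bound[OF pF LF(4)])
  qed
  have e: "(\<integral>x. edens s x \<partial>lborel) = L2sq (u s) + L2sq (F s)" if "s \<in> {0..t}" for s
  proof -
    have "edens s x = (norm (u s x))\<^sup>2 + (norm (F s x))\<^sup>2" for x
      unfolding edens_def by (simp add: norm_sq_vec)
    then show ?thesis using Ku[OF that] KF[OF that] by (simp add: L2_Lip_bound_def L2_def L2sq_def)
  qed
  show ?thesis using energy_conserved[of 0 t] e[of 0] e[of t] t by simp
qed

section \<open>Decay along a self-similar profile\<close>

text \<open>The set where a continuous function exceeds \<open>c\<close> is open, and a nonempty open set is not negligible.\<close>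

lemma AE_le_continuous:
  fixes f :: "'a::euclidean_space \<Rightarrow> real"
  assumes f: "continuous_on UNIV f" and ae: "AE x in lborel. f x \<le> c"
  shows "f x \<le> c"
proof (rule ccontr)
  assume x: "\<not> f x \<le> c"
  have o: "open {x. c < f x}" using open_Collect_less[OF continuous_on_const f] by simp
  have "AE x in lebesgue. x \<notin> {x. c < f x}"
    using AE_completion[OF ae] by eventually_elim simp
  then have "negligible {x. c < f x}"
    by (simp add: negligible_iff_null_sets AE_iff_null_sets o borel_open)
  moreover have "x \<in> {x. c < f x}" using x by simp
  ultimately show False using open_not_negligible[OF o] by blast
qed

lemma L2sq_zero_continuous:
  fixes f :: "real^3 \<Rightarrow> 'b::euclidean_space"
  assumes "L2 f" "L2sq f \<le> 0" "continuous_on UNIV f"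
  shows "f x = 0"
proof -
  have "AE x in lborel. norm (f x) \<le> 0" using L2sq_0_AE[OF assms(1,2)] by eventually_elim simp
  from AE_le_continuous[OF continuous_on_norm[OF assms(3)] this] show ?thesis by simp
qed

text \<open>A form of \<open>C1_on UNIV\<close> in terms of partial derivatives, stable under the operations below without
  choosing a derivative in the space of bounded linear maps.\<close>

definition C1_space :: "(real^3 \<Rightarrow> 'b::real_normed_vector) \<Rightarrow> bool" where
  "C1_space f \<longleftrightarrow> (\<forall>x. f differentiable (at x)) \<and> (\<forall>j. continuous_on UNIV (partial_deriv j f))"

lemma C1_space_cont: "C1_space f \<Longrightarrow> continuous_on UNIV f"
  by (auto simp: C1_space_def continuous_on_eq_continuous_at intro: differentiable_imp_continuous_within)

lemma C1_space_grad_cont: "C1_space f \<Longrightarrow> continuous_on UNIV (grad f)"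
  unfolding C1_space_def grad_def[abs_def] by (intro continuous_on_vec_lambda) auto

lemma C1_on_UNIV_C1_space:
  assumes "C1_on UNIV f" shows "C1_space f"
proof -
  obtain f' where d: "\<And>x. (f has_derivative blinfun_apply (f' x)) (at x)" and c: "continuous_on UNIV f'"
    using assms unfolding C1_on_def by auto
  have "partial_deriv j f = (\<lambda>x. f' x (axis j 1))" for j
    using partial_deriv_eqI[OF d] by blast
  moreover have "continuous_on UNIV (\<lambda>x. f' x (axis j 1))" for j
    by (intro bounded_bilinear.continuous_on[OF bounded_bilinear_blinfun_apply] c continuous_on_const)
  ultimately show ?thesis using d by (auto simp: C1_space_def differentiable_def)
qed

lemma sum_axis_scaleR:
  fixes P :: "3 \<Rightarrow> 'b::real_vector"
  shows "(\<Sum>i\<in>UNIV. ((c *\<^sub>R axis j (1::real)) $ i) *\<^sub>R P i) = c *\<^sub>R P j"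
proof -
  have "(\<Sum>i\<in>UNIV. ((c *\<^sub>R axis j (1::real)) $ i) *\<^sub>R P i) = (\<Sum>i\<in>UNIV. if i = j then c *\<^sub>R P i else 0)"
    by (rule sum.cong) (auto simp: axis_def)
  then show ?thesis by simp
qed

lemma C1_space_diff:
  assumes "C1_space f" "C1_space g"
  shows "C1_space (\<lambda>x. f x - g x)" "grad (\<lambda>x. f x - g x) = (\<lambda>x. grad f x - grad g x)"
proof -
  have d: "f differentiable (at x)" "g differentiable (at x)" for x using assms by (auto simp: C1_space_def)
  have pd: "partial_deriv j (\<lambda>x. f x - g x) x = partial_deriv j f x - partial_deriv j g x" for j x
    using sum_axis_scaleR[of 1 j "\<lambda>i. partial_deriv i f x"] sum_axis_scaleR[of 1 j "\<lambda>i. partial_deriv i g x"]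
    by (subst partial_deriv_eqI[OF has_derivative_diff[OF has_derivative_partials[OF d(1)] has_derivative_partials[OF d(2)]]]) simp
  show "C1_space (\<lambda>x. f x - g x)"
    using assms unfolding C1_space_def by (auto simp: pd[abs_def] intro!: continuous_intros)
  show "grad (\<lambda>x. f x - g x) = (\<lambda>x. grad f x - grad g x)"
    by (rule ext) (simp add: grad_def vec_eq_iff pd)
qed

lemma grad_dilated:
  assumes f: "C1_space f" and s: "s > 0"
  shows "C1_space (dilated s f)" "grad (dilated s f) x = grad f (x /\<^sub>R sqrt s) /\<^sub>R sqrt s"
proof -
  have cj: "continuous_on UNIV (partial_deriv j f)" for j using f by (simp add: C1_space_def)
  have pd: "(dilated s f has_derivative (\<lambda>v. \<Sum>j\<in>UNIV. ((v /\<^sub>R sqrt s) $ j) *\<^sub>R partial_deriv j f (x /\<^sub>R sqrt s))) (at x)" for x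
    unfolding dilated_def[abs_def]
    using f by (intro has_derivative_compose[OF _ has_derivative_partials]) (auto simp: C1_space_def intro!: derivative_eq_intros)
  have pdj: "partial_deriv j (dilated s f) x = partial_deriv j f (x /\<^sub>R sqrt s) /\<^sub>R sqrt s" for j x
    by (subst partial_deriv_eqI[OF pd]) (rule sum_axis_scaleR)
  have "continuous_on UNIV (\<lambda>x. partial_deriv j f (x /\<^sub>R sqrt s))" for j
    by (rule continuous_on_compose2[OF cj]) (auto intro!: continuous_intros)
  then show "C1_space (dilated s f)"
    using pd unfolding C1_space_def by (auto simp: pdj[abs_def] differentiable_def intro!: continuous_intros)
  show "grad (dilated s f) x = grad f (x /\<^sub>R sqrt s) /\<^sub>R sqrt s"
    by (simp add: grad_def vec_eq_iff pdj)
qed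

lemma grad_rescaled:
  assumes f: "C1_space f" and s: "s > 0"
  shows "C1_space (rescaled s f)" "grad (rescaled s f) = (\<lambda>x. grad (dilated s f) x /\<^sub>R sqrt s)"
proof -
  have d: "C1_space (dilated s f)" by (rule grad_dilated[OF f s])
  have pd: "partial_deriv j (rescaled s f) x = partial_deriv j (dilated s f) x /\<^sub>R sqrt s" for j x
    unfolding rescaled_def[abs_def]
    using d by (intro partial_deriv_linear[OF bounded_linear_scaleR_right]) (auto simp: C1_space_def)
  show "C1_space (rescaled s f)"
    unfolding C1_space_def
  proof (intro conjI allI)
    have "(\<lambda>x. dilated s f x /\<^sub>R sqrt s) differentiable (at x)" for x
      using d by (intro differentiable_scaleR differentiable_const) (simp add: C1_space_def)
    then show "rescaled s f differentiable (at x)" for x by (simp add: rescaled_def[abs_def])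
    have "continuous_on UNIV (\<lambda>x. partial_deriv j (dilated s f) x /\<^sub>R sqrt s)" for j
      using d by (intro continuous_intros) (simp add: C1_space_def)
    then show "continuous_on UNIV (partial_deriv j (rescaled s f))" for j unfolding pd[symmetric] .
  qed
  show "grad (rescaled s f) = (\<lambda>x. grad (dilated s f) x /\<^sub>R sqrt s)"
    by (rule ext) (simp add: grad_def vec_eq_iff pd)
qed

lemma Linf_norm_grad_le:
  assumes f: "continuous_on UNIV f" and le: "Linf_norm f \<le> ennreal c" and c: "c \<ge> 0"
  shows "norm (f x) \<le> c"
proof (rule AE_le_continuous[OF continuous_on_norm[OF f]])
  show "AE x in lborel. norm (f x) \<le> c"
  proof -
    have "AE x in lborel. ennreal (norm (f x)) \<le> esssup lborel (\<lambda>x. ennreal (norm (f x)))"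
      by (rule esssup_AE)
    then show ?thesis
  proof eventually_elim
    case (elim x)
    then have "ennreal (norm (f x)) \<le> ennreal c" using le unfolding Linf_norm_def by (rule order_trans)
    then show ?case using c by simp
  qed
  qed
qed

lemma grad_bound_Lipschitz:
  fixes f :: "real^3 \<Rightarrow> 'b::real_normed_vector"
  assumes f: "C1_space f" and L: "\<And>x. norm (grad f x) \<le> L"
  shows "norm (f x - f y) \<le> 3 * L * norm (x - y)"
proof (rule differentiable_bound[of UNIV f "\<lambda>x v. \<Sum>j\<in>UNIV. (v $ j) *\<^sub>R partial_deriv j f x"])
  fix x
  show "(f has_derivative (\<lambda>v. \<Sum>j\<in>UNIV. (v $ j) *\<^sub>R partial_deriv j f x)) (at x within UNIV)"
    using f by (auto simp: C1_space_def intro: has_derivative_partials)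
  show "onorm (\<lambda>v. \<Sum>j\<in>UNIV. (v $ j) *\<^sub>R partial_deriv j f x) \<le> 3 * L"
  proof (rule onorm_le)
    fix v :: "real^3"
    have "norm (\<Sum>j\<in>UNIV. (v $ j) *\<^sub>R partial_deriv j f x) \<le> (\<Sum>j\<in>(UNIV::3 set). norm v * L)"
    proof (rule sum_norm_le)
      fix j :: 3
      have "norm (partial_deriv j f x) \<le> L"
        using Finite_Cartesian_Product.norm_nth_le[of "grad f x" j] L[of x] by (simp add: grad_def)
      then show "norm ((v $ j) *\<^sub>R partial_deriv j f x) \<le> norm v * L"
        using component_le_norm_cart[of v j] by (simp add: mult_mono)
    qed
    then show "norm (\<Sum>j\<in>UNIV. (v $ j) *\<^sub>R partial_deriv j f x) \<le> 3 * L * norm v" by (simp add: mult_ac)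
  qed
qed auto

text \<open>A function with Lipschitz constant \<open>L\<close> is at least half of its value at \<open>x\<close> on a ball of radius
  \<open>|w(x)| / 2 L\<close> around \<open>x\<close>, so its integral bounds its supremum.\<close>

lemma sup_le_L1_Lipschitz:
  fixes w :: "real^3 \<Rightarrow> 'b::euclidean_space"
  assumes Lip: "\<And>x y. norm (w x - w y) \<le> L * norm (x - y)" and L: "L > 0"
    and A: "(\<integral>\<^sup>+x. ennreal (norm (w x)) \<partial>lborel) \<le> ennreal A" "A \<ge> 0"
  shows "(norm (w x))^4 \<le> 4 * L^3 * A"
proof -
  define a where "a = norm (w x)"
  define r where "r = a / (2 * L)"
  have a: "a \<ge> 0" and r: "r \<ge> 0" using L by (simp_all add: a_def r_def)
  have half: "a / 2 \<le> norm (w y)" if "y \<in> ball x r" for y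
  proof -
    have "norm (w x - w y) \<le> L * norm (x - y)" by (rule Lip)
    also have "\<dots> \<le> L * r" using that L by (intro mult_left_mono) (auto simp: dist_norm)
    also have "\<dots> = a / 2" using L by (simp add: r_def)
    finally have "norm (w x - w y) \<le> a / 2" .
    moreover have "norm (w x) \<le> norm (w x - w y) + norm (w y)"
      using norm_triangle_ineq[of "w x - w y" "w y"] by simp
    ultimately show ?thesis by (simp add: a_def)
  qed
  have "ennreal (a / 2 * (4 / 3 * r^3 * pi)) = ennreal (a / 2) * emeasure lborel (ball x r)"
  proof -
    have "emeasure lborel (ball x r) = ennreal (measure lborel (ball x r))"
      using emeasure_lborel_ball_finite[of x r] by (intro emeasure_eq_ennreal_measure) auto
    then have "emeasure lborel (ball x r) = ennreal (4 / 3 * r^3 * pi)" unfolding sphere_volume[OF r] .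
    moreover have "ennreal (a / 2 * (4 / 3 * r^3 * pi)) = ennreal (a / 2) * ennreal (4 / 3 * r^3 * pi)"
      using a by (intro ennreal_mult') simp
    ultimately show ?thesis by simp
  qed
  also have "\<dots> = (\<integral>\<^sup>+y. ennreal (a / 2) * indicator (ball x r) y \<partial>lborel)"
    by (simp add: nn_integral_cmult_indicator)
  also have "\<dots> \<le> (\<integral>\<^sup>+y. ennreal (norm (w y)) \<partial>lborel)"
    using half by (intro nn_integral_mono) (auto simp: indicator_def ennreal_leI)
  also have "\<dots> \<le> ennreal A" by (rule A)
  finally have 1: "a / 2 * (4 / 3 * r^3 * pi) \<le> A" using A(2) by simp
  \<comment> \<open>the ball has volume at least \<open>4 * r^3\<close>\<close>
  have "a / 2 * (4 / 3 * r^3 * 3) \<le> a / 2 * (4 / 3 * r^3 * pi)"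
    using a r pi_gt3 by (intro mult_left_mono) auto
  then have "a / 2 * (4 / 3 * r^3 * 3) \<le> A" using 1 by simp
  then have "a^4 / (4 * L^3) \<le> A"
    using L by (simp add: r_def power_divide power_mult_distrib eval_nat_numeral field_simps)
  then show ?thesis using L by (simp add: a_def field_simps)
qed

text \<open>Interpolation: the square of the function is at most its supremum times its modulus.\<close>

lemma L2_le_L1_Lipschitz:
  fixes w :: "real^3 \<Rightarrow> 'b::euclidean_space"
  assumes c: "continuous_on UNIV w" and Lip: "\<And>x y. norm (w x - w y) \<le> L * norm (x - y)" and L: "L > 0"
    and A: "(\<integral>\<^sup>+x. ennreal (norm (w x)) \<partial>lborel) \<le> ennreal A" "A \<ge> 0"
    and S: "4 * L^3 * A \<le> S^4" "S \<ge> 0"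
  shows "L2 w" "L2sq w \<le> S * A"
proof -
  have m[measurable]: "w \<in> borel_measurable borel" using c by (rule borel_measurable_continuous_onI)
  have le: "norm (w x) \<le> S" for x
  proof (rule power_le_imp_le_base[OF _ S(2)])
    show "norm (w x) ^ Suc 3 \<le> S ^ Suc 3"
      using order_trans[OF sup_le_L1_Lipschitz[OF Lip L A, of x] S(1)] by simp
  qed
  have i: "integrable lborel (\<lambda>x. norm (w x))"
    using A(1) by (auto simp: integrable_iff_bounded intro: le_less_trans)
  have I: "(\<integral>x. norm (w x) \<partial>lborel) \<le> A"
    using A nn_integral_eq_integral[OF i] by simp
  have si: "integrable lborel (\<lambda>x. S * norm (w x))" using i by simp
  have le2: "(norm (w x))\<^sup>2 \<le> S * norm (w x)" for x
    using le[of x] by (simp add: power2_eq_square mult_right_mono)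
  show "L2 w" by (rule L2_bound(1)[OF m si le2])
  have "L2sq w \<le> (\<integral>x. S * norm (w x) \<partial>lborel)" by (rule L2_bound(2)[OF m si le2])
  also have "\<dots> \<le> S * A" using I S(2) by (simp add: mult_left_mono)
  finally show "L2sq w \<le> S * A" .
qed

text \<open>The dilation contributes \<open>s^(3/2)\<close> and the squared prefactor \<open>1 / s\<close>, so a positive power of \<open>s\<close> remains:
  the rescaling is subcritical for the energy.\<close>

lemma L2_rescaled:
  fixes V :: "real^3 \<Rightarrow> 'b::euclidean_space"
  assumes s: "s > 0" and m: "V \<in> borel_measurable borel"
  shows "L2 (rescaled s V) \<longleftrightarrow> L2 V" "L2sq (rescaled s V) = sqrt s * L2sq V"
proof -
  note [measurable] = m
  let ?h = "\<lambda>x. (norm (rescaled s V x))\<^sup>2"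
  have [measurable]: "rescaled s V \<in> borel_measurable borel" unfolding rescaled_def dilated_def by measurable
  have h: "?h (0 + sqrt s *\<^sub>R x) = (norm (V x))\<^sup>2 / s" for x
    using s by (simp add: rescaled_def dilated_def power_mult_distrib power_divide divide_inverse power_inverse)
  have hi: "?h x = (norm (V (0 + (1 / sqrt s) *\<^sub>R x)))\<^sup>2 / s" for x
    using s by (simp add: rescaled_def dilated_def power_mult_distrib power_divide divide_inverse power_inverse)
  show "L2 (rescaled s V) \<longleftrightarrow> L2 V"
  proof
    assume "L2 (rescaled s V)"
    from integrable_affine[OF L2_integrable[OF this], of "sqrt s" 0] s
    have "integrable lborel (\<lambda>x. (norm (V x))\<^sup>2 / s)" unfolding h by simp
    from integrable_mult_right[OF this, of s] s show "L2 V" by (simp add: L2_def)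
  next
    assume "L2 V"
    from integrable_affine[OF L2_integrable[OF this], of "1 / sqrt s" 0] s
    show "L2 (rescaled s V)" unfolding L2_def hi by simp
  qed
  have "L2sq (rescaled s V) = \<bar>sqrt s\<bar>^3 *\<^sub>R (\<integral>x. ?h (0 + sqrt s *\<^sub>R x) \<partial>lborel)"
    unfolding L2sq_def by (subst integral_affine[where c = "sqrt s" and t = 0]) (use s in simp_all)
  also have "\<dots> = sqrt s * L2sq V"
    unfolding h using s by (simp add: L2sq_def power3_eq_cube)
  finally show "L2sq (rescaled s V) = sqrt s * L2sq V" .
qed


text \<open>The limit condition in usable form: near \<open>T\<close> the essential supremum bounds the continuous gradient
  of the difference at every point.\<close>

lemma eventually_gradient_gap:
  fixes g :: "real \<Rightarrow> real^3 \<Rightarrow> 'b::euclidean_space"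
  assumes T: "T > 0" and g: "\<And>t. t \<in> {0..<T} \<Longrightarrow> C1_space (g t)" and V: "C1_space V"
    and lim: "((\<lambda>t. ennreal (T - t) *
        Linf_norm (\<lambda>x. grad (g t) x - grad (dilated (T - t) V) x /\<^sub>R sqrt (T - t))) \<longlongrightarrow> 0) (at_left T)"
    and e: "\<epsilon> > 0"
  shows "\<forall>\<^sub>F t in at_left T. t \<in> {0<..<T} \<and> C1_space (\<lambda>x. g t x - rescaled (T - t) V x) \<and>
    (\<forall>x. norm (grad (\<lambda>x. g t x - rescaled (T - t) V x) x) \<le> \<epsilon> / (T - t))"
proof -
  have "\<forall>\<^sub>F t in at_left T. ennreal (T - t) *
      Linf_norm (\<lambda>x. grad (g t) x - grad (dilated (T - t) V) x /\<^sub>R sqrt (T - t)) < ennreal \<epsilon>"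
    by (rule order_tendstoD(2)[OF lim]) (use e in simp)
  moreover have "\<forall>\<^sub>F t in at_left T. t \<in> {0<..<T}" by (rule eventually_at_left_real[OF T])
  ultimately show ?thesis
  proof eventually_elim
    case (elim t)
    define s where "s = T - t"
    have s: "s > 0" using elim by (simp add: s_def)
    have gt: "C1_space (g t)" using elim by (intro g) auto
    let ?w = "\<lambda>x. g t x - rescaled s V x"
    have w: "C1_space ?w" by (rule C1_space_diff(1)[OF gt grad_rescaled(1)[OF V s]])
    have gw: "grad ?w = (\<lambda>x. grad (g t) x - grad (dilated s V) x /\<^sub>R sqrt s)"
      unfolding C1_space_diff(2)[OF gt grad_rescaled(1)[OF V s]] grad_rescaled(2)[OF V s] ..
    have "Linf_norm (grad ?w) = ennreal (1 / s) * (ennreal s * Linf_norm (grad ?w))"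
      using s by (simp add: mult.assoc[symmetric] ennreal_mult[symmetric])
    also have "\<dots> \<le> ennreal (1 / s) * ennreal \<epsilon>"
      using elim(1) unfolding gw unfolding s_def by (intro mult_left_mono) auto
    also have "\<dots> = ennreal (\<epsilon> / s)" using s e by (simp add: ennreal_mult[symmetric])
    finally have "norm (grad ?w x) \<le> \<epsilon> / s" for x
      using s e by (intro Linf_norm_grad_le C1_space_grad_cont w) auto
    then show ?case using w elim(2) by (simp add: s_def)
  qed
qed

text \<open>The difference to the rescaled profile has integral at most \<open>M s\<close> and Lipschitz constant at most
  \<open>3 / s\<close>, where \<open>s = T - t\<close>, so its squared \<open>L\<^sup>2\<close> norm is of order \<open>s^(1/2)\<close>. That the profile is square
  integrable is a consequence, because \<open>g t\<close> is.\<close>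

lemma self_similar_energy_decay:
  fixes g :: "real \<Rightarrow> real^3 \<Rightarrow> 'b::euclidean_space"
  assumes T: "T > 0" and g: "\<And>t. t \<in> {0..<T} \<Longrightarrow> C1_space (g t)" and V: "C1_space V"
    and L2g: "\<And>t. t \<in> {0..<T} \<Longrightarrow> L2 (g t)"
    and sup: "(SUP t\<in>{0<..<T}. ennreal (1 / (T - t)) * L1_norm (\<lambda>x. g t x - rescaled (T - t) V x)) < \<infinity>"
    and lim: "((\<lambda>t. ennreal (T - t) *
        Linf_norm (\<lambda>x. grad (g t) x - grad (dilated (T - t) V) x /\<^sub>R sqrt (T - t))) \<longlongrightarrow> 0) (at_left T)"
  shows "((\<lambda>t. L2sq (g t)) \<longlongrightarrow> 0) (at_left T)"
proof -
  obtain M where M: "M \<ge> 0"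
    "(SUP t\<in>{0<..<T}. ennreal (1 / (T - t)) * L1_norm (\<lambda>x. g t x - rescaled (T - t) V x)) = ennreal M"
    using sup by (cases "SUP t\<in>{0<..<T}. ennreal (1 / (T - t)) * L1_norm (\<lambda>x. g t x - rescaled (T - t) V x)") auto
  have Vm: "V \<in> borel_measurable borel" by (rule borel_measurable_continuous_onI[OF C1_space_cont[OF V]])
  define C where "C = 2 * ((108 * M + 1) * M) + 2 * L2sq V"
  have "\<forall>\<^sub>F t in at_left T. t \<in> {0<..<T} \<and> C1_space (\<lambda>x. g t x - rescaled (T - t) V x) \<and>
    (\<forall>x. norm (grad (\<lambda>x. g t x - rescaled (T - t) V x) x) \<le> 1 / (T - t))"
    by (rule eventually_gradient_gap[OF T g V lim zero_less_one])
  then have "\<forall>\<^sub>F t in at_left T. L2sq (g t) \<le> C * sqrt (T - t)"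
  proof eventually_elim
    case (elim t)
    define s where "s = T - t"
    define w where "w x = g t x - rescaled s V x" for x
    have s: "s > 0" using elim by (simp add: s_def)
    have t: "t \<in> {0..<T}" "t \<in> {0<..<T}" using elim by auto
    have w: "C1_space w" and gw: "\<And>x. norm (grad w x) \<le> 1 / s"
      using elim by (auto simp: w_def[abs_def] s_def)
    have "ennreal (1 / s) * L1_norm w \<le> ennreal M"
      unfolding M(2)[symmetric] s_def w_def[abs_def] by (rule SUP_upper[OF t(2)])
    then have "ennreal s * (ennreal (1 / s) * L1_norm w) \<le> ennreal s * ennreal M" by (rule mult_left_mono) simp
    then have A: "(\<integral>\<^sup>+x. ennreal (norm (w x)) \<partial>lborel) \<le> ennreal (M * s)" "0 \<le> M * s"
      using s M(1) by (simp_all add: mult.assoc[symmetric] ennreal_mult[symmetric] L1_norm_def mult.commute)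
    have Lip: "norm (w x - w y) \<le> 3 / s * norm (x - y)" for x y
      using grad_bound_Lipschitz[OF w gw, of x y] by simp
    \<comment> \<open>\<open>108\<close> is \<open>4 * 3^3\<close>; adding \<open>1\<close> makes the base at least \<open>1\<close>, so that it is below its fourth power\<close>
    have S0: "0 \<le> (108 * M + 1) / sqrt s" using M s by simp
    have "4 * (3 / s)^3 * (M * s) = 108 * M / s\<^sup>2"
      using s by (simp add: power_divide power2_eq_square power3_eq_cube)
    also have "\<dots> \<le> (108 * M + 1)^4 / s\<^sup>2"
    proof (rule divide_right_mono)
      have "108 * M \<le> (108 * M + 1)^1" by simp
      also have "\<dots> \<le> (108 * M + 1)^4" using M by (intro power_increasing) auto
      finally show "108 * M \<le> (108 * M + 1)^4" .
    qed simp
    also have "\<dots> = ((108 * M + 1) / sqrt s)^4"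
    proof -
      have "(sqrt s)^4 = ((sqrt s)\<^sup>2)\<^sup>2" by (simp add: power_mult[symmetric])
      then show ?thesis using s by (simp add: power_divide)
    qed
    finally have S: "4 * (3 / s)^3 * (M * s) \<le> ((108 * M + 1) / sqrt s)^4" .
    have "3 / s > 0" using s by simp
    note W = L2_le_L1_Lipschitz[OF C1_space_cont[OF w] Lip this A S S0]
    have eq: "rescaled s V = (\<lambda>x. g t x - w x)" by (simp add: w_def)
    have LR: "L2 (rescaled s V)" unfolding eq by (intro L2_diff L2g t W)
    have "(108 * M + 1) / sqrt s * (M * s) = (108 * M + 1) * M * sqrt s"
      using s by (simp add: field_simps)
    then have W2: "L2sq w \<le> (108 * M + 1) * M * sqrt s" using W(2) by simp
    have "g t = (\<lambda>x. w x + rescaled s V x)" by (simp add: w_def)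
    then have "L2sq (g t) \<le> 2 * L2sq w + 2 * L2sq (rescaled s V)"
      using L2_add(2)[OF W(1) LR] by simp
    also have "\<dots> \<le> 2 * ((108 * M + 1) * M * sqrt s) + 2 * (sqrt s * L2sq V)"
      using W2 L2_rescaled(2)[OF s Vm] by simp
    also have "\<dots> = C * sqrt s" by (simp add: C_def algebra_simps)
    finally show ?case by (simp add: s_def)
  qed
  moreover have "((\<lambda>t. C * sqrt (T - t)) \<longlongrightarrow> C * sqrt (T - T)) (at_left T)"
    by (intro tendsto_intros)
  ultimately show ?thesis
    by (intro tendsto_sandwich[where f = "\<lambda>_. 0" and g = "\<lambda>t. L2sq (g t)" and h = "\<lambda>t. C * sqrt (T - t)"]) auto
qed

text \<open>If the solution vanishes, the scale-invariant quantity in the limit condition is the supremum of the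
  gradient of the profile at every time, so it has to be zero.\<close>

lemma self_similar_profile_zero:
  fixes g :: "real \<Rightarrow> real^3 \<Rightarrow> 'b::euclidean_space"
  assumes T: "T > 0" and g: "\<And>t. t \<in> {0..<T} \<Longrightarrow> g t = (\<lambda>x. 0)" and V: "C1_vanishing V"
    and lim: "((\<lambda>t. ennreal (T - t) *
        Linf_norm (\<lambda>x. grad (g t) x - grad (dilated (T - t) V) x /\<^sub>R sqrt (T - t))) \<longlongrightarrow> 0) (at_left T)"
  shows "V = (\<lambda>x. 0)"
proof -
  have V1: "C1_space V" using V by (intro C1_on_UNIV_C1_space) (simp add: C1_vanishing_def)
  have z: "C1_space (\<lambda>x::real^3. 0::'b)" "grad (\<lambda>x::real^3. 0::'b) = (\<lambda>x. 0)"
    by (auto simp: C1_space_def grad_def partial_deriv_def[abs_def] vec_eq_iff frechet_derivative_const)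
  have small: "norm (grad V y) \<le> \<epsilon>" if e: "\<epsilon> > 0" for \<epsilon> y
  proof -
    have "\<forall>\<^sub>F t in at_left T. t \<in> {0<..<T} \<and> C1_space (\<lambda>x. g t x - rescaled (T - t) V x) \<and>
      (\<forall>x. norm (grad (\<lambda>x. g t x - rescaled (T - t) V x) x) \<le> \<epsilon> / (T - t))"
      by (rule eventually_gradient_gap[OF T _ V1 lim e]) (simp add: g z)
    from eventually_happens'[OF trivial_limit_at_left_real this]
    obtain t where t: "t \<in> {0<..<T}"
      and b: "\<And>x. norm (grad (\<lambda>x. g t x - rescaled (T - t) V x) x) \<le> \<epsilon> / (T - t)" by blast
    define s where "s = T - t"
    have s: "s > 0" using t by (simp add: s_def)
    have gt: "g t = (\<lambda>x. 0)" using t by (intro g) auto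
    have "grad (\<lambda>x. g t x - rescaled s V x) (sqrt s *\<^sub>R y) = - (grad V y /\<^sub>R s)"
      unfolding gt C1_space_diff(2)[OF z(1) grad_rescaled(1)[OF V1 s]] z grad_rescaled(2)[OF V1 s]
        grad_dilated(2)[OF V1 s]
      using s by (simp add: inverse_mult_distrib[symmetric])
    then have "norm (grad V y) / s \<le> \<epsilon> / s" using b[of "sqrt s *\<^sub>R y"] s by (simp add: s_def[symmetric] divide_inverse mult.commute)
    then show ?thesis using s by (simp add: divide_le_cancel)
  qed
  have "grad V y = 0" for y
  proof -
    have "norm (grad V y) \<le> 0" by (rule field_le_epsilon) (use small in simp)
    then show ?thesis by simp
  qed
  then have "partial_deriv j V y = 0" for j y by (simp add: grad_def vec_eq_iff)
  then have "(V has_derivative (\<lambda>h. 0)) (at y within UNIV)" for y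
    using has_derivative_partials[of V y] V1 by (simp add: C1_space_def)
  from has_derivative_zero_constant[OF convex_UNIV this]
  obtain c where c: "\<And>x. V x = c" by auto
  have "(V \<longlongrightarrow> 0) at_infinity" using V by (simp add: C1_vanishing_def)
  then have "((\<lambda>x::real^3. c) \<longlongrightarrow> 0) at_infinity" by (simp add: c[abs_def])
  from tendsto_unique[OF trivial_limit_at_infinity tendsto_const this] have "c = 0" .
  then show ?thesis using c by auto
qed

text \<open>The interval has to be nondegenerate, since the derivative within a single point is arbitrary.\<close>

lemma zero_viscoelastic_solution:
  assumes b: "b > 0"
  shows "viscoelastic_solution {0..b} (\<lambda>x. 0) (\<lambda>x. 0) (\<lambda>t x. 0) (\<lambda>t x. 0)"
proof -
  have C1: "C1_on (I \<times> UNIV) (\<lambda>(t, x). 0 :: 'b::real_normed_vector)" for I :: "real set"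
    unfolding C1_on_def case_prod_beta by (intro exI[of _ "\<lambda>_. 0"]) (simp add: zero_blinfun.rep_eq)
  have col: "column k (0 :: real^3^3) = 0" for k by (simp add: column_def vec_eq_iff)
  have pd: "partial_deriv j (\<lambda>x. 0 :: 'b::real_normed_vector) y = 0" for j y
    by (simp add: partial_deriv_def frechet_derivative_const)
  have vd: "vector_derivative (\<lambda>s. 0 :: 'b::real_normed_vector) (at t within {0..b}) = 0" if "t \<in> {0..b}" for t
  proof (rule vector_derivative_within)
    show "at t within {0..b} \<noteq> bot" using that b by (simp add: trivial_limit_within islimpt_Icc)
  qed simp
  show ?thesis
    unfolding viscoelastic_solution_def
    by (intro conjI exI[of _ "\<lambda>_ _. 0"] C1)
       (auto simp: col pd vd advect_def divergence_def grad_def vec_eq_iff)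
qed

theorem theorem1p3:
  fixes T m q :: real
    and u0 :: "real^3 \<Rightarrow> real^3" and F0 :: "real^3 \<Rightarrow> real^3^3"
    and u :: "real \<Rightarrow> real^3 \<Rightarrow> real^3" and F :: "real \<Rightarrow> real^3 \<Rightarrow> real^3^3"
    and U :: "real^3 \<Rightarrow> real^3" and E :: "real^3 \<Rightarrow> real^3^3"
  assumes "T > 0" and "m > 3/2 + 1"
    and "continuous_sobolev {0..<T} m u" and "continuous_sobolev {0..<T} m F"
    and "viscoelastic_solution {0..<T} u0 F0 u F"
    and "C1_vanishing U" and "C1_vanishing E"
    and "q > 0" and "\<forall>r\<in>{0<..<q}. Lp r (curl U) \<and> Lp r E"
    and "(SUP t\<in>{0<..<T}. ennreal (1 / (T - t)) * L1_norm (\<lambda>x. u t x - rescaled (T - t) U x)) +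
         (SUP t\<in>{0<..<T}. ennreal (1 / (T - t)) * L1_norm (\<lambda>x. F t x - rescaled (T - t) E x)) < \<infinity>"
    and "((\<lambda>t. ennreal (T - t) *
           Linf_norm (\<lambda>x. grad (u t) x - grad (dilated (T - t) U) x /\<^sub>R sqrt (T - t))) \<longlongrightarrow> 0)
         (at_left T)"
    and "((\<lambda>t. ennreal (T - t) *
           Linf_norm (\<lambda>x. grad (F t) x - grad (dilated (T - t) E) x /\<^sub>R sqrt (T - t))) \<longlongrightarrow> 0)
         (at_left T)"
  shows "U = (\<lambda>x. 0) \<and> E = (\<lambda>x. 0) \<and>
    (\<exists>\<delta>>0. \<exists>v G. (\<forall>t\<in>{0..<T}. v t = u t \<and> G t = F t) \<and>
       viscoelastic_solution {0..T + \<delta>} u0 F0 v G \<and>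
       continuous_sobolev {0..T + \<delta>} m v \<and> continuous_sobolev {0..T + \<delta>} m G)"
proof -
  note T = assms(1) and cu = assms(3) and cF = assms(4) and sol = assms(5)
  have m: "m > 5/2" using assms(2) by simp
  have slice: "C1_space (g t)" if "C1_on ({0..<T} \<times> UNIV) (\<lambda>(t, x). g t x)" "t \<in> {0..<T}"
    for g :: "real \<Rightarrow> real^3 \<Rightarrow> 'b::euclidean_space" and t
  proof -
    have "continuous_on UNIV (\<lambda>x. partial_deriv j (g (fst (t, x))) (snd (t, x)))" for j
      using that(2) by (intro continuous_on_compose2[OF C1_on_slices(2)[OF that(1)]] continuous_intros) auto
    then show ?thesis using C1_on_slices(1)[OF that] by (simp add: C1_space_def)
  qed
  have u1: "C1_space (u t)" and F1: "C1_space (F t)" if "t \<in> {0..<T}" for t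
    using slice[OF _ that] sol by (auto simp: viscoelastic_solution_def)
  have L2u: "L2 (u t)" and L2F: "L2 (F t)" if "t \<in> {0..<T}" for t
    using cu cF that by (auto simp: continuous_sobolev_def intro: sobolev_L2)
  have U1: "C1_space U" and E1: "C1_space E"
    using assms(6,7) by (auto simp: C1_vanishing_def intro: C1_on_UNIV_C1_space)
  have supU: "(SUP t\<in>{0<..<T}. ennreal (1 / (T - t)) * L1_norm (\<lambda>x. u t x - rescaled (T - t) U x)) < \<infinity>"
    and supE: "(SUP t\<in>{0<..<T}. ennreal (1 / (T - t)) * L1_norm (\<lambda>x. F t x - rescaled (T - t) E x)) < \<infinity>"
    using assms(10) by auto
  define e where "e = L2sq (u 0) + L2sq (F 0)"
  have cons: "L2sq (u t) + L2sq (F t) = e" if "t \<in> {0..<T}" for t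
    using viscoelastic_energy_conserved[OF m cu cF sol, of t] that by (cases "t = 0") (auto simp: e_def)
  have "((\<lambda>t. L2sq (u t) + L2sq (F t)) \<longlongrightarrow> 0 + 0) (at_left T)"
    by (intro tendsto_add self_similar_energy_decay[OF T u1 U1 L2u supU assms(11)]
        self_similar_energy_decay[OF T F1 E1 L2F supE assms(12)])
  moreover have "((\<lambda>t. L2sq (u t) + L2sq (F t)) \<longlongrightarrow> e) (at_left T)"
    by (rule tendsto_eventually, rule eventually_mono[OF eventually_at_left_real[OF T]]) (use cons in auto)
  ultimately have e0: "e = 0" using tendsto_unique[OF trivial_limit_at_left_real] by fastforce
  have zero: "u t = (\<lambda>x. 0)" "F t = (\<lambda>x. 0)" if t: "t \<in> {0..<T}" for t
  proof -
    have "L2sq (u t) \<le> 0" "L2sq (F t) \<le> 0"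
      using cons[OF t] e0 L2sq_nonneg[of "u t"] L2sq_nonneg[of "F t"] by linarith+
    then show "u t = (\<lambda>x. 0)" "F t = (\<lambda>x. 0)"
      using L2sq_zero_continuous[OF L2u[OF t] _ C1_space_cont[OF u1[OF t]]]
        L2sq_zero_continuous[OF L2F[OF t] _ C1_space_cont[OF F1[OF t]]] by blast+
  qed
  have "U = (\<lambda>x. 0)" by (rule self_similar_profile_zero[OF T zero(1) assms(6,11)])
  moreover have "E = (\<lambda>x. 0)" by (rule self_similar_profile_zero[OF T zero(2) assms(7,12)])
  \<comment> \<open>the zero solution exists for all times, so the length \<open>1\<close> of the extension is arbitrary\<close>
  moreover have "viscoelastic_solution {0..T + 1} u0 F0 (\<lambda>t x. 0) (\<lambda>t x. 0)"
  proof -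
    have "u0 = u 0" "F0 = F 0" using sol by (auto simp: viscoelastic_solution_def)
    then have "u0 = (\<lambda>x. 0)" "F0 = (\<lambda>x. 0)" using zero[of 0] T by auto
    then show ?thesis using zero_viscoelastic_solution[of "T + 1"] T by simp
  qed
  moreover have "continuous_sobolev {0..T + 1} m (\<lambda>t x. 0 :: real^3)"
    "continuous_sobolev {0..T + 1} m (\<lambda>t x. 0 :: real^3^3)"
    by (simp_all add: continuous_sobolev_def sobolev_zero)
  ultimately show ?thesis
    using zero by (intro conjI exI[of _ "1::real"] exI[of _ "\<lambda>t x. 0"]) auto
qed

end
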